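(* Let $q\in(0,1)$, $t\in[0,1]$, and let $D$ be the self-adjoint operator on the Hilbert space of spinors $\mathcal H$ given on the orthonormal basis by $Dv^l_{m,\pm}=(l+\tfrac12)v^l_{m,\mp}$, $l=\tfrac12,\tfrac32,\dots$, $m=-l,\dots,l$. Then the dimension spectrum of the (regular) spectral triple $(\mathcal A(S^2_{qt}),\mathcal H,D)$ is $\Sigma=\{1,2\}$.
   Context: Let $[n]=(q^n-q^{-n})/(q-q^{-1})$ for $n\in\mathbb R$. Algebra. $\mathcal A(S^2_{qt})$ is the unital complex $*$-algebra generated by $x_{-1},x_0,x_1$ with relations $x_{-1}(x_0-t)=q^2(x_0-t)x_{-1}$, $x_1(x_0-t)=q^{-2}(x_0-t)x_1$, $-[2]x_{-1}x_1+(q^2x_0+t)(x_0-t)=[2]^2(1-t)$, $-[2]x_1x_{-1}+(q^{-2}x_0+t)(x_0-t)=[2]^2(1-t)$, and involution $x_{-1}^*=-q^{-1}x_1$, $x_0^*=x_0$. Spinors. $\mathcal H$ is the Hilbert space with orthonormal basis $v^l_{m,\pm}$ ($l\in\tfrac12+\mathbb N_0$, $m=-l,\dots,l$). $\mathcal A(S^2_{qt})$ acts on $\mathcal H$ through the faithful bounded $*$-representation $\pi$ given by $$\pi(x_i)v^l_{m,\pm}=\alpha_i^-(l,m;\pm\tfrac12)v^{l-1}_{m+i,\pm}+\alpha_i^0(l,m;\pm\tfrac12)v^l_{m+i,\pm}+\alpha_i^+(l,m;\pm\tfrac12)v^{l+1}_{m+i,\pm},$$ where a term is $0$ if the vector in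 it does not exist (i.e. $l-1<\tfrac12$ or $|m+i|$ exceeds the spin), and $\alpha^+_1(l,m;N)=q^{-l+m}[l+m+1]^{1/2}[l+m+2]^{1/2}[2l+1]^{-1/2}[2l+2]^{-1/2}\alpha_N(l+1)$, $\alpha^0_1(l,m;N)=-q^{m+2}[l-m]^{1/2}[l+m+1]^{1/2}[2]^{1/2}[2l]^{-1}\beta_N(l)$, $\alpha^-_1(l,m;N)=-q^{l+m+1}[l-m-1]^{1/2}[l-m]^{1/2}[2l-1]^{-1/2}[2l]^{-1/2}\alpha_N(l)$, $\alpha^+_0(l,m;N)=q^m[l-m+1]^{1/2}[l+m+1]^{1/2}[2]^{1/2}[2l+1]^{-1/2}[2l+2]^{-1/2}\alpha_N(l+1)$, $\alpha^0_0(l,m;N)=[2l]^{-1}\big([l-m+1][l+m]-q^2[l-m][l+m+1]\big)\beta_N(l)$, $\alpha^-_0(l,m;N)=q^m[l-m]^{1/2}[l+m]^{1/2}[2]^{1/2}[2l-1]^{-1/2}[2l]^{-1/2}\alpha_N(l)$, $\alpha^+_{-1}(l,m;N)=q^{l+m}[l-m+1]^{1/2}[l-m+2]^{1/2}[2l+1]^{-1/2}[2l+2]^{-1/2}\alpha_N(l+1)$, $\alpha^0_{-1}(l,m;N)=q^m[l-m+1]^{1/2}[l+m]^{1/2}[2]^{1/2}[2l]^{-1}\beta_N(l)$, $\alpha^-_{-1}(l,m;N)=-q^{-l+m-1}[l+m-1]^{1/2}[l+m]^{1/2}[2l-1]^{-1/2}[2l]^{-1/2}\alpha_N(l)$, with,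 for $\epsilon=\mathrm{sign}(N)$, $$\alpha_N(l)=\frac{[2]^{1/2}[l+N]^{1/2}[l-N]^{1/2}[2l]^{1/2}}{[2l+1]^{1/2}[l]}\Big(1-t+q^{-2N}[2l]^{-2}[l]^2(t-1+q^{2N})^2\Big)^{1/2},$$ $$\beta_N(l)=\frac{\epsilon[2|N|](q^{-1}+q-q^{\epsilon}t)+t(q-q^{-1})\{[|N|][|N|+1]-[l][l+1]\}}{q[2l+2]}.$$ Definitions. Let $\delta(a)=[|D|,a]$ (unbounded derivation on $\mathcal B(\mathcal H)$). $\Psi^0$ is the algebra generated by $\mathcal A(S^2_{qt})$ (identified with its image under $\pi$), the commutators $[D,\mathcal A(S^2_{qt})]$ and iterated applications of $\delta$ to these. For $a\in\Psi^0$ the function $\zeta_a(z)=\mathrm{Tr}_{\mathcal H}(a|D|^{-z})$ is holomorphic for $\mathrm{Re}\,z>2$. The triple has dimension spectrum $\Sigma\subset\mathbb C$ (a countable set) if all $\zeta_a$, $a\in\Psi^0$, extend to meromorphic functions on $\mathbb C$ whose only singularities are poles in $\Sigma$, with $\Sigma$ the set of poles that actually occur (each point of $\Sigma$ is a pole of $\zeta_a$ for some $a\in\Psi^0$). *)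

theory Defs
  imports "HOL-Complex_Analysis.Complex_Analysis"
begin

section \<open>The Hilbert space of spinors\<close>

text \<open>The label \<open>(l, m, N)\<close> with \<open>N = 1/2\<close> or \<open>N = -1/2\<close> stands for the basis vector
  \<open>v\<^sup>l\<close> with lower index \<open>m\<close> and sign that of \<open>N\<close>.\<close>

definition labels :: "(real \<times> real \<times> real) set" where
  "labels = {(l, m, N). (\<exists>k j :: nat. l = real k + 1/2 \<and> j \<le> 2 * k + 1 \<and> m = - l + real j)
                        \<and> (N = 1/2 \<or> N = -1/2)}"

text \<open>The model of the Hilbert space is the space of square-summable families on the labels.\<close>

typedef spinor =
  "{f :: real \<times> real \<times> real \<Rightarrow> complex.
      (\<forall>i. i \<notin> labels \<longrightarrow> f i = 0) \<and> (\<lambda>i. (cmod (f i))\<^sup>2) summable_on UNIV}"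
  morphisms coord Abs_spinor
  by (rule exI[of _ "\<lambda>_. 0"]) auto

setup_lifting type_definition_spinor

lemma spinor_eqI: "(\<And>i. coord x i = coord y i) \<Longrightarrow> x = y"
  using coord_inject by blast

lemma coord_outside: "i \<notin> labels \<Longrightarrow> coord x i = 0"
  using coord[of x] by blast

lemma coord_summable: "(\<lambda>i. (cmod (coord x i))\<^sup>2) summable_on UNIV"
  using coord[of x] by blast

lemma square_summable_add:
  fixes f g :: "'i \<Rightarrow> complex"
  assumes "(\<lambda>i. (cmod (f i))\<^sup>2) summable_on UNIV" "(\<lambda>i. (cmod (g i))\<^sup>2) summable_on UNIV"
  shows "(\<lambda>i. (cmod (f i + g i))\<^sup>2) summable_on UNIV"
proof (rule summable_on_comparison_test)
  show "(\<lambda>i. 2 * (cmod (f i))\<^sup>2 + 2 * (cmod (g i))\<^sup>2) summable_on UNIV"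
    by (intro summable_on_add summable_on_cmult_right assms)
  show "(cmod (f i + g i))\<^sup>2 \<le> 2 * (cmod (f i))\<^sup>2 + 2 * (cmod (g i))\<^sup>2" for i
  proof -
    have "(cmod (f i + g i))\<^sup>2 \<le> (cmod (f i) + cmod (g i))\<^sup>2"
      by (simp add: norm_triangle_ineq power_mono)
    also have "\<dots> \<le> 2 * (cmod (f i))\<^sup>2 + 2 * (cmod (g i))\<^sup>2"
      using sum_squares_bound[of "cmod (f i)" "cmod (g i)"] by (simp add: power2_sum)
    finally show ?thesis .
  qed
qed auto

lemma square_summable_scale:
  fixes f :: "'i \<Rightarrow> complex"
  assumes "(\<lambda>i. (cmod (f i))\<^sup>2) summable_on UNIV"
  shows "(\<lambda>i. (cmod (c * f i))\<^sup>2) summable_on UNIV"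
  using summable_on_cmult_right[OF assms, of "(cmod c)\<^sup>2"]
  by (simp add: norm_mult power_mult_distrib)

lemma product_summable:
  fixes f g :: "'i \<Rightarrow> complex"
  assumes "(\<lambda>i. (cmod (f i))\<^sup>2) summable_on UNIV" "(\<lambda>i. (cmod (g i))\<^sup>2) summable_on UNIV"
  shows "(\<lambda>i. cnj (f i) * g i) summable_on UNIV"
proof (rule abs_summable_summable, rule summable_on_comparison_test)
  show "(\<lambda>i. (cmod (f i))\<^sup>2 + (cmod (g i))\<^sup>2) summable_on UNIV"
    by (intro summable_on_add assms)
  show "cmod (cnj (f i) * g i) \<le> (cmod (f i))\<^sup>2 + (cmod (g i))\<^sup>2" for i
  proof -
    have "0 \<le> cmod (f i) * cmod (g i)"
      by simp
    then show ?thesis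
      using sum_squares_bound[of "cmod (f i)" "cmod (g i)"] unfolding norm_mult complex_mod_cnj
      by linarith
  qed
qed auto

lift_definition scaleC :: "complex \<Rightarrow> spinor \<Rightarrow> spinor" is "\<lambda>c f i. c * f i"
  by (auto intro: square_summable_scale)

definition cinner :: "spinor \<Rightarrow> spinor \<Rightarrow> complex" where
  "cinner x y = (\<Sum>\<^sub>\<infinity>i. cnj (coord x i) * coord y i)"

instantiation spinor :: real_inner
begin

lift_definition zero_spinor :: spinor is "\<lambda>_. 0" by auto

lift_definition plus_spinor :: "spinor \<Rightarrow> spinor \<Rightarrow> spinor" is "\<lambda>f g i. f i + g i"
  by (auto intro: square_summable_add)

lift_definition uminus_spinor :: "spinor \<Rightarrow> spinor" is "\<lambda>f i. - f i" by auto

definition minus_spinor :: "spinor \<Rightarrow> spinor \<Rightarrow> spinor" where "minus_spinor x y = x + (- y)"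

definition scaleR_spinor :: "real \<Rightarrow> spinor \<Rightarrow> spinor" where
  "scaleR_spinor r x = scaleC (complex_of_real r) x"

definition inner_spinor :: "spinor \<Rightarrow> spinor \<Rightarrow> real" where "inner_spinor x y = Re (cinner x y)"

definition norm_spinor :: "spinor \<Rightarrow> real" where "norm_spinor x = sqrt (inner x x)"

definition sgn_spinor :: "spinor \<Rightarrow> spinor" where "sgn_spinor x = inverse (norm x) *\<^sub>R x"

definition dist_spinor :: "spinor \<Rightarrow> spinor \<Rightarrow> real" where "dist_spinor x y = norm (x - y)"

definition uniformity_spinor :: "(spinor \<times> spinor) filter" where
  "uniformity_spinor = (INF e\<in>{0<..}. principal {(x, y). dist x y < e})"

definition open_spinor :: "spinor set \<Rightarrow> bool" where
  "open_spinor S = (\<forall>x\<in>S. \<forall>\<^sub>F (x', y) in uniformity. x' = x \<longrightarrow> y \<in> S)"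

lemma cinner_summable: "(\<lambda>i. cnj (coord x i) * coord y i) summable_on UNIV"
  by (intro product_summable coord_summable)

lemma cinner_self: "cinner x x = complex_of_real (\<Sum>\<^sub>\<infinity>i. (cmod (coord x i))\<^sup>2)"
proof -
  have "cnj (coord x i) * coord x i = complex_of_real ((cmod (coord x i))\<^sup>2)" for i
    by (metis complex_norm_square mult.commute)
  then show ?thesis
    unfolding cinner_def
    using infsumI[OF has_sum_of_real_iff[THEN iffD2, OF has_sum_infsum[OF coord_summable[of x]]]]
    by simp
qed

instance
proof
  fix x y z :: spinor and a b r :: real
  show "x + y + z = x + (y + z)" "x + y = y + x" "0 + x = x"
    by (transfer; simp add: algebra_simps fun_eq_iff)+
  show "- x + x = 0"
    by (transfer; simp)
  show "x - y = x + - y"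
    by (simp add: minus_spinor_def)
  show "a *\<^sub>R (x + y) = a *\<^sub>R x + a *\<^sub>R y" "(a + b) *\<^sub>R x = a *\<^sub>R x + b *\<^sub>R x"
    "a *\<^sub>R b *\<^sub>R x = (a * b) *\<^sub>R x" "1 *\<^sub>R x = x"
    unfolding scaleR_spinor_def by (transfer; simp add: algebra_simps)+
  show "dist x y = norm (x - y)" "sgn x = inverse (norm x) *\<^sub>R x"
    by (simp_all add: dist_spinor_def sgn_spinor_def)
  show "(uniformity :: (spinor \<times> spinor) filter) = (INF e\<in>{0<..}. principal {(x, y). dist x y < e})"
    by (rule uniformity_spinor_def)
  show "open S = (\<forall>x\<in>S. \<forall>\<^sub>F (x', y) in uniformity. x' = x \<longrightarrow> y \<in> S)" for S :: "spinor set"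
    by (rule open_spinor_def)
  show "norm x = sqrt (inner x x)"
    by (rule norm_spinor_def)
  have "cinner y x = cnj (cinner x y)"
    unfolding cinner_def by (subst infsum_cnj[symmetric]) (simp add: mult.commute)
  then show "inner x y = inner y x"
    by (simp add: inner_spinor_def)
  have "cinner (x + y) z = cinner x z + cinner y z"
    unfolding cinner_def
    by (subst infsum_add[symmetric]) (simp_all add: cinner_summable plus_spinor.rep_eq distrib_right)
  then show "inner (x + y) z = inner x z + inner y z"
    by (simp add: inner_spinor_def)
  have "cinner (r *\<^sub>R x) y = of_real r * cinner x y"
    unfolding cinner_def scaleR_spinor_def
    by (simp add: scaleC.rep_eq mult.assoc infsum_cmult_right')
  then show "inner (r *\<^sub>R x) y = r * inner x y"
    by (simp add: inner_spinor_def)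
  have inner_self: "inner x x = (\<Sum>\<^sub>\<infinity>i. (cmod (coord x i))\<^sup>2)"
    by (simp add: inner_spinor_def cinner_self)
  show "0 \<le> inner x x"
    unfolding inner_self by (intro infsum_nonneg) auto
  show "(inner x x = 0) = (x = 0)"
  proof
    assume "inner x x = 0"
    then have "(cmod (coord x i))\<^sup>2 = 0" for i
      unfolding inner_self
      using nonneg_infsum_le_0D[of "\<lambda>i. (cmod (coord x i))\<^sup>2" UNIV i] coord_summable[of x] by simp
    then show "x = 0"
      by (intro spinor_eqI) (simp add: zero_spinor.rep_eq)
  next
    assume "x = 0"
    then show "inner x x = 0"
      unfolding inner_self by (simp add: zero_spinor.rep_eq)
  qed
qed

end

text \<open>\<open>bvec l m N\<close> is the orthonormal basis vector with the given label, and \<open>0\<close> if the label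
  does not exist; this is the convention of the formulas for the representation.\<close>

lift_definition bvec :: "real \<Rightarrow> real \<Rightarrow> real \<Rightarrow> spinor" is
  "\<lambda>l m N i. if i = (l, m, N) \<and> i \<in> labels then 1 else 0"
proof -
  fix l m N :: real
  have "(\<lambda>i. (cmod (if i = (l, m, N) \<and> i \<in> labels then 1 else 0))\<^sup>2) summable_on UNIV"
    by (rule summable_on_cong_neutral[THEN iffD1, OF _ _ _ summable_on_finite[of "{(l, m, N)}"]])
       auto
  then show "(\<forall>i. i \<notin> labels \<longrightarrow> (if i = (l, m, N) \<and> i \<in> labels then 1 else 0 :: complex) = 0) \<and>
     (\<lambda>i. (cmod (if i = (l, m, N) \<and> i \<in> labels then 1 else 0))\<^sup>2) summable_on UNIV"
    by auto
qed

section \<open>Operators\<close>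

definition bounded_op :: "(spinor \<Rightarrow> spinor) \<Rightarrow> bool" where
  "bounded_op a \<longleftrightarrow> bounded_linear a \<and> (\<forall>c x. a (scaleC c x) = scaleC c (a x))"

definition adjoint_op :: "(spinor \<Rightarrow> spinor) \<Rightarrow> spinor \<Rightarrow> spinor" where
  "adjoint_op a = (THE b. bounded_op b \<and> (\<forall>x y. cinner (a x) y = cinner x (b y)))"

inductive_set generated_algebra :: "(spinor \<Rightarrow> spinor) set \<Rightarrow> (spinor \<Rightarrow> spinor) set"
  for G where
    gen: "a \<in> G \<Longrightarrow> a \<in> generated_algebra G"
  | one: "id \<in> generated_algebra G"
  | scale: "a \<in> generated_algebra G \<Longrightarrow> (\<lambda>x. scaleC c (a x)) \<in> generated_algebra G"
  | add: "a \<in> generated_algebra G \<Longrightarrow> b \<in> generated_algebra G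
      \<Longrightarrow> (\<lambda>x. a x + b x) \<in> generated_algebra G"
  | mult: "a \<in> generated_algebra G \<Longrightarrow> b \<in> generated_algebra G
      \<Longrightarrow> a \<circ> b \<in> generated_algebra G"

text \<open>The domain on which \<open>D\<close> is self-adjoint, which is also the domain of \<open>\<bar>D\<bar>\<close>. The values of
  \<open>dirac\<close> and \<open>abs_dirac\<close> outside of it are irrelevant.\<close>

definition dirac_domain :: "spinor set" where
  "dirac_domain = {x. (\<lambda>(l, m, N). (l + 1/2)\<^sup>2 * (cmod (coord x (l, m, N)))\<^sup>2) summable_on UNIV}"

definition dirac :: "spinor \<Rightarrow> spinor" where
  "dirac x = Abs_spinor (\<lambda>(l, m, N). of_real (l + 1/2) * coord x (l, m, - N))"

definition abs_dirac :: "spinor \<Rightarrow> spinor" where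
  "abs_dirac x = Abs_spinor (\<lambda>(l, m, N). of_real (l + 1/2) * coord x (l, m, N))"

lemma labels_flip: "(l, m, - N) \<in> labels \<longleftrightarrow> (l, m, N) \<in> labels"
  unfolding labels_def by auto

lemma coord_abs_dirac:
  assumes "x \<in> dirac_domain"
  shows "coord (abs_dirac x) (l, m, N) = of_real (l + 1/2) * coord x (l, m, N)"
proof -
  have "(\<lambda>i. (cmod (case i of (l, m, N) \<Rightarrow> of_real (l + 1/2) * coord x (l, m, N)))\<^sup>2)
      = (\<lambda>(l, m, N). (l + 1/2)\<^sup>2 * (cmod (coord x (l, m, N)))\<^sup>2)"
    by (auto simp: fun_eq_iff norm_mult power_mult_distrib simp del: of_real_add)
  moreover have "\<dots> summable_on UNIV"
    using assms unfolding dirac_domain_def by simp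
  ultimately show ?thesis
    unfolding abs_dirac_def by (subst Abs_spinor_inverse) (auto simp: coord_outside case_prod_unfold simp del: of_real_add)
qed

lemma coord_dirac:
  assumes "x \<in> dirac_domain"
  shows "coord (dirac x) (l, m, N) = of_real (l + 1/2) * coord x (l, m, - N)"
proof -
  define g where "g = (\<lambda>(l, m, N). (l + 1/2)\<^sup>2 * (cmod (coord x (l, m, N)))\<^sup>2)"
  define h where "h = (\<lambda>(l, m, N). (l, m, - N) :: real \<times> real \<times> real)"
  have "bij h"
    by (rule o_bij[of h]) (auto simp: h_def)
  moreover have "g summable_on UNIV"
    using assms unfolding dirac_domain_def g_def by simp
  ultimately have "(g \<circ> h) summable_on UNIV"
    using summable_on_reindex_bij_betw[of h UNIV UNIV g] by (simp add: o_def)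
  moreover have "(\<lambda>i. (cmod (case i of (l, m, N) \<Rightarrow> of_real (l + 1/2) * coord x (l, m, - N)))\<^sup>2) = g \<circ> h"
    by (auto simp: fun_eq_iff g_def h_def norm_mult power_mult_distrib simp del: of_real_add)
  ultimately show ?thesis
    unfolding dirac_def by (subst Abs_spinor_inverse) (auto simp: coord_outside labels_flip simp del: of_real_add)
qed

lemma bvec_in_domain: "bvec l m N \<in> dirac_domain"
proof -
  have "(\<lambda>(l', m', N'). (l' + 1/2)\<^sup>2 * (cmod (coord (bvec l m N) (l', m', N')))\<^sup>2) summable_on UNIV"
    by (rule summable_on_cong_neutral[THEN iffD1, OF _ _ _ summable_on_finite[of "{(l, m, N)}"]])
       (auto simp: bvec.rep_eq split: if_splits)
  then show ?thesis by (simp add: dirac_domain_def)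
qed

lemma dirac_bvec: "dirac (bvec l m N) = scaleC (of_real (l + 1/2)) (bvec l m (- N))"
proof (rule spinor_eqI)
  fix i :: "real \<times> real \<times> real"
  obtain l' m' N' where "i = (l', m', N')" by (cases i)
  then show "coord (dirac (bvec l m N)) i = coord (scaleC (of_real (l + 1/2)) (bvec l m (- N))) i"
    by (auto simp: coord_dirac[OF bvec_in_domain] scaleC.rep_eq bvec.rep_eq labels_flip)
qed

lemma abs_dirac_bvec: "abs_dirac (bvec l m N) = scaleC (of_real (l + 1/2)) (bvec l m N)"
proof (rule spinor_eqI)
  fix i :: "real \<times> real \<times> real"
  obtain l' m' N' where "i = (l', m', N')" by (cases i)
  then show "coord (abs_dirac (bvec l m N)) i = coord (scaleC (of_real (l + 1/2)) (bvec l m N)) i"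
    by (auto simp: coord_abs_dirac[OF bvec_in_domain] scaleC.rep_eq bvec.rep_eq)
qed

text \<open>\<open>\<bar>D\<bar>\<close> is the diagonal, hence positive and self-adjoint, operator with \<open>\<bar>D\<bar>\<^sup>2 = D\<^sup>2\<close>.\<close>

lemma abs_dirac_square:
  assumes "x \<in> dirac_domain" "dirac x \<in> dirac_domain" "abs_dirac x \<in> dirac_domain"
  shows "abs_dirac (abs_dirac x) = dirac (dirac x)"
proof (rule spinor_eqI)
  fix i :: "real \<times> real \<times> real"
  obtain l m N where "i = (l, m, N)" by (cases i)
  then show "coord (abs_dirac (abs_dirac x)) i = coord (dirac (dirac x)) i"
    using assms by (simp add: coord_dirac coord_abs_dirac)
qed

text \<open>\<open>abs_dirac_powr s\<close> is \<open>\<bar>D\<bar>\<^sup>s\<close> for \<open>Re s \<le> 0\<close>, a bounded operator.\<close>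

definition abs_dirac_powr :: "complex \<Rightarrow> spinor \<Rightarrow> spinor" where
  "abs_dirac_powr s x =
     Abs_spinor (\<lambda>(l, m, N). complex_of_real (l + 1/2) powr s * coord x (l, m, N))"

text \<open>For \<open>T = dirac\<close> or \<open>T = abs_dirac\<close>: the bounded operators \<open>a\<close> that preserve the domain of
  \<open>T\<close> and for which \<open>[T, a]\<close> extends to a bounded operator, and this unique extension.\<close>

definition commutator_domain :: "(spinor \<Rightarrow> spinor) \<Rightarrow> (spinor \<Rightarrow> spinor) set" where
  "commutator_domain T = {a. bounded_op a \<and> a ` dirac_domain \<subseteq> dirac_domain \<and>
     (\<exists>b. bounded_op b \<and> (\<forall>x\<in>dirac_domain. b x = T (a x) - a (T x)))}"

definition commutator :: "(spinor \<Rightarrow> spinor) \<Rightarrow> (spinor \<Rightarrow> spinor) \<Rightarrow> spinor \<Rightarrow> spinor" where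
  "commutator T a = (THE b. bounded_op b \<and> (\<forall>x\<in>dirac_domain. b x = T (a x) - a (T x)))"

abbreviation \<delta> :: "(spinor \<Rightarrow> spinor) \<Rightarrow> spinor \<Rightarrow> spinor" where
  "\<delta> \<equiv> commutator abs_dirac"

definition trace :: "(spinor \<Rightarrow> spinor) \<Rightarrow> complex" where
  "trace T = (\<Sum>\<^sub>\<infinity>(l, m, N)\<in>labels. cinner (bvec l m N) (T (bvec l m N)))"

section \<open>Dimension spectrum\<close>

text \<open>In this section \<open>\<A>\<close> is the image of the algebra of the triple in the bounded operators.\<close>

definition regular_triple :: "(spinor \<Rightarrow> spinor) set \<Rightarrow> bool" where
  "regular_triple \<A> \<longleftrightarrow>
     \<A> \<subseteq> commutator_domain dirac \<and>
     (\<forall>a \<in> \<A> \<union> commutator dirac ` \<A>. \<forall>n. (\<delta> ^^ n) a \<in> commutator_domain abs_dirac)"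

definition Psi0 :: "(spinor \<Rightarrow> spinor) set \<Rightarrow> (spinor \<Rightarrow> spinor) set" where
  "Psi0 \<A> = generated_algebra {(\<delta> ^^ n) a | n a. a \<in> \<A> \<union> commutator dirac ` \<A>}"

definition zeta :: "(spinor \<Rightarrow> spinor) \<Rightarrow> complex \<Rightarrow> complex" where
  "zeta a z = trace (a \<circ> abs_dirac_powr (- z))"

definition continues_zeta :: "(complex \<Rightarrow> complex) \<Rightarrow> (spinor \<Rightarrow> spinor) \<Rightarrow> bool" where
  "continues_zeta f a \<longleftrightarrow> f meromorphic_on UNIV \<and> (\<forall>z. Re z > 2 \<longrightarrow> f z = zeta a z)"

text \<open>Regularity is part of the definition, because it is what makes the iterated commutators
  in \<open>Psi0\<close> meaningful.\<close>

definition has_dimension_spectrum :: "(spinor \<Rightarrow> spinor) set \<Rightarrow> complex set \<Rightarrow> bool" where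
  "has_dimension_spectrum \<A> \<Sigma> \<longleftrightarrow>
     regular_triple \<A> \<and> countable \<Sigma> \<and>
     (\<forall>a \<in> Psi0 \<A>. \<exists>f. continues_zeta f a \<and> (\<forall>z. f analytic_on {z} \<or> z \<in> \<Sigma> \<and> is_pole f z)) \<and>
     (\<forall>s \<in> \<Sigma>. \<exists>a \<in> Psi0 \<A>. \<exists>f. continues_zeta f a \<and> is_pole f s)"

section \<open>The algebra of the quantum sphere\<close>

definition qnum :: "real \<Rightarrow> real \<Rightarrow> real" where
  "qnum q n = (q powr n - q powr (- n)) / (q - inverse q)"

datatype generator = Xm | X0 | Xp

text \<open>Expressions for the elements of the free unital complex \<open>*\<close>-algebra on the generators.\<close>

datatype expr = Gen generator | Const complex | Plus expr expr | Times expr expr | Star expr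

abbreviation RConst :: "real \<Rightarrow> expr" where "RConst r \<equiv> Const (complex_of_real r)"

abbreviation Minus :: "expr \<Rightarrow> expr \<Rightarrow> expr" where "Minus a b \<equiv> Plus a (Times (Const (- 1)) b)"

text \<open>The least congruence making the quotient a unital complex \<open>*\<close>-algebra that satisfies the
  defining relations (the last six rules).\<close>

inductive podles_eq :: "real \<Rightarrow> real \<Rightarrow> expr \<Rightarrow> expr \<Rightarrow> bool" for q t where
    refl: "podles_eq q t a a"
  | sym: "podles_eq q t a b \<Longrightarrow> podles_eq q t b a"
  | trans: "podles_eq q t a b \<Longrightarrow> podles_eq q t b c \<Longrightarrow> podles_eq q t a c"
  | cong_Plus: "podles_eq q t a a' \<Longrightarrow> podles_eq q t b b' \<Longrightarrow> podles_eq q t (Plus a b) (Plus a' b')"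
  | cong_Times: "podles_eq q t a a' \<Longrightarrow> podles_eq q t b b' \<Longrightarrow> podles_eq q t (Times a b) (Times a' b')"
  | cong_Star: "podles_eq q t a a' \<Longrightarrow> podles_eq q t (Star a) (Star a')"
  | Plus_assoc: "podles_eq q t (Plus (Plus a b) c) (Plus a (Plus b c))"
  | Plus_commute: "podles_eq q t (Plus a b) (Plus b a)"
  | Plus_zero: "podles_eq q t (Plus (Const 0) a) a"
  | Plus_minus: "podles_eq q t (Minus a a) (Const 0)"
  | Times_assoc: "podles_eq q t (Times (Times a b) c) (Times a (Times b c))"
  | Times_one: "podles_eq q t (Times (Const 1) a) a"
  | distrib_right: "podles_eq q t (Times (Plus a b) c) (Plus (Times a c) (Times b c))"
  | distrib_left: "podles_eq q t (Times a (Plus b c)) (Plus (Times a b) (Times a c))"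
  | Const_central: "podles_eq q t (Times (Const z) a) (Times a (Const z))"
  | Const_plus: "podles_eq q t (Plus (Const z) (Const w)) (Const (z + w))"
  | Const_times: "podles_eq q t (Times (Const z) (Const w)) (Const (z * w))"
  | Star_Const: "podles_eq q t (Star (Const z)) (Const (cnj z))"
  | Star_Plus: "podles_eq q t (Star (Plus a b)) (Plus (Star a) (Star b))"
  | Star_Times: "podles_eq q t (Star (Times a b)) (Times (Star b) (Star a))"
  | Star_Star: "podles_eq q t (Star (Star a)) a"
  | rel_Xm_X0: "podles_eq q t (Times (Gen Xm) (Minus (Gen X0) (RConst t)))
      (Times (RConst (q\<^sup>2)) (Times (Minus (Gen X0) (RConst t)) (Gen Xm)))"
  | rel_Xp_X0: "podles_eq q t (Times (Gen Xp) (Minus (Gen X0) (RConst t)))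
      (Times (RConst (inverse (q\<^sup>2))) (Times (Minus (Gen X0) (RConst t)) (Gen Xp)))"
  | rel_Xm_Xp: "podles_eq q t
      (Plus (Times (RConst (- qnum q 2)) (Times (Gen Xm) (Gen Xp)))
         (Times (Plus (Times (RConst (q\<^sup>2)) (Gen X0)) (RConst t)) (Minus (Gen X0) (RConst t))))
      (RConst ((qnum q 2)\<^sup>2 * (1 - t)))"
  | rel_Xp_Xm: "podles_eq q t
      (Plus (Times (RConst (- qnum q 2)) (Times (Gen Xp) (Gen Xm)))
         (Times (Plus (Times (RConst (inverse (q\<^sup>2))) (Gen X0)) (RConst t)) (Minus (Gen X0) (RConst t))))
      (RConst ((qnum q 2)\<^sup>2 * (1 - t)))"
  | star_Xm: "podles_eq q t (Star (Gen Xm)) (Times (RConst (- inverse q)) (Gen Xp))"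
  | star_X0: "podles_eq q t (Star (Gen X0)) (Gen X0)"

definition podles_algebra :: "real \<Rightarrow> real \<Rightarrow> expr set set" where
  "podles_algebra q t = UNIV // {(a, b). podles_eq q t a b}"

section \<open>The representation on spinors\<close>

definition alpha_N :: "real \<Rightarrow> real \<Rightarrow> real \<Rightarrow> real \<Rightarrow> real" where
  "alpha_N q t N l =
     sqrt (qnum q 2) * sqrt (qnum q (l + N)) * sqrt (qnum q (l - N)) * sqrt (qnum q (2 * l))
       / (sqrt (qnum q (2 * l + 1)) * qnum q l)
     * sqrt (1 - t + q powr (- 2 * N) / (qnum q (2 * l))\<^sup>2 * (qnum q l)\<^sup>2
                       * (t - 1 + q powr (2 * N))\<^sup>2)"

definition beta_N :: "real \<Rightarrow> real \<Rightarrow> real \<Rightarrow> real \<Rightarrow> real" where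
  "beta_N q t N l =
     (sgn N * qnum q (2 * \<bar>N\<bar>) * (inverse q + q - q powr (sgn N) * t)
        + t * (q - inverse q) * (qnum q \<bar>N\<bar> * qnum q (\<bar>N\<bar> + 1) - qnum q l * qnum q (l + 1)))
     / (q * qnum q (2 * l + 2))"

fun alpha_plus :: "real \<Rightarrow> real \<Rightarrow> generator \<Rightarrow> real \<Rightarrow> real \<Rightarrow> real \<Rightarrow> real" where
  "alpha_plus q t Xp l m N =
     q powr (- l + m) * sqrt (qnum q (l + m + 1)) * sqrt (qnum q (l + m + 2))
       / (sqrt (qnum q (2 * l + 1)) * sqrt (qnum q (2 * l + 2))) * alpha_N q t N (l + 1)"
| "alpha_plus q t X0 l m N =
     q powr m * sqrt (qnum q (l - m + 1)) * sqrt (qnum q (l + m + 1)) * sqrt (qnum q 2)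
       / (sqrt (qnum q (2 * l + 1)) * sqrt (qnum q (2 * l + 2))) * alpha_N q t N (l + 1)"
| "alpha_plus q t Xm l m N =
     q powr (l + m) * sqrt (qnum q (l - m + 1)) * sqrt (qnum q (l - m + 2))
       / (sqrt (qnum q (2 * l + 1)) * sqrt (qnum q (2 * l + 2))) * alpha_N q t N (l + 1)"

fun alpha_zero :: "real \<Rightarrow> real \<Rightarrow> generator \<Rightarrow> real \<Rightarrow> real \<Rightarrow> real \<Rightarrow> real" where
  "alpha_zero q t Xp l m N =
     - (q powr (m + 2)) * sqrt (qnum q (l - m)) * sqrt (qnum q (l + m + 1)) * sqrt (qnum q 2)
       / qnum q (2 * l) * beta_N q t N l"
| "alpha_zero q t X0 l m N =
     (qnum q (l - m + 1) * qnum q (l + m) - q\<^sup>2 * qnum q (l - m) * qnum q (l + m + 1))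
       / qnum q (2 * l) * beta_N q t N l"
| "alpha_zero q t Xm l m N =
     q powr m * sqrt (qnum q (l - m + 1)) * sqrt (qnum q (l + m)) * sqrt (qnum q 2)
       / qnum q (2 * l) * beta_N q t N l"

fun alpha_minus :: "real \<Rightarrow> real \<Rightarrow> generator \<Rightarrow> real \<Rightarrow> real \<Rightarrow> real \<Rightarrow> real" where
  "alpha_minus q t Xp l m N =
     - (q powr (l + m + 1)) * sqrt (qnum q (l - m - 1)) * sqrt (qnum q (l - m))
       / (sqrt (qnum q (2 * l - 1)) * sqrt (qnum q (2 * l))) * alpha_N q t N l"
| "alpha_minus q t X0 l m N =
     q powr m * sqrt (qnum q (l - m)) * sqrt (qnum q (l + m)) * sqrt (qnum q 2)
       / (sqrt (qnum q (2 * l - 1)) * sqrt (qnum q (2 * l))) * alpha_N q t N l"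
| "alpha_minus q t Xm l m N =
     - (q powr (- l + m - 1)) * sqrt (qnum q (l + m - 1)) * sqrt (qnum q (l + m))
       / (sqrt (qnum q (2 * l - 1)) * sqrt (qnum q (2 * l))) * alpha_N q t N l"

fun shift :: "generator \<Rightarrow> real" where
  "shift Xm = - 1" | "shift X0 = 0" | "shift Xp = 1"

definition generator_op :: "real \<Rightarrow> real \<Rightarrow> generator \<Rightarrow> spinor \<Rightarrow> spinor" where
  "generator_op q t g = (THE a. bounded_op a \<and>
     (\<forall>(l, m, N) \<in> labels. a (bvec l m N) =
        scaleC (of_real (alpha_minus q t g l m N)) (bvec (l - 1) (m + shift g) N)
      + scaleC (of_real (alpha_zero q t g l m N)) (bvec l (m + shift g) N)
      + scaleC (of_real (alpha_plus q t g l m N)) (bvec (l + 1) (m + shift g) N)))"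

primrec podles_rep :: "real \<Rightarrow> real \<Rightarrow> expr \<Rightarrow> spinor \<Rightarrow> spinor" where
  "podles_rep q t (Gen g) = generator_op q t g"
| "podles_rep q t (Const c) = scaleC c"
| "podles_rep q t (Plus a b) = (\<lambda>x. podles_rep q t a x + podles_rep q t b x)"
| "podles_rep q t (Times a b) = podles_rep q t a \<circ> podles_rep q t b"
| "podles_rep q t (Star a) = adjoint_op (podles_rep q t a)"

text \<open>The representation respects the relations, so \<open>podles_rep\<close> is constant on each class and
  the following set is the image of the algebra.\<close>

definition podles_image :: "real \<Rightarrow> real \<Rightarrow> (spinor \<Rightarrow> spinor) set" where
  "podles_image q t = (\<Union>c \<in> podles_algebra q t. podles_rep q t ` c)"

end

theory Submission
  imports Defs
begin

text \<open>In the basis labelled by \<open>j = l + m\<close> and \<open>d = l - m\<close>, the generators are banded matrices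
  whose entries are functions of \<open>j\<close> alone up to an error of order \<open>r\<^sup>j\<^sup>+\<^sup>d\<close> with \<open>r < 1\<close>; these functions
  converge exponentially as \<open>j\<close> grows, and to \<open>0\<close> for entries that change \<open>d\<close>. Matrices of this kind form
  an algebra stable under adjoints and under commutators with \<open>\<bar>D\<bar>\<close>, and \<open>D\<close> differs from \<open>\<bar>D\<bar>\<close> by a sign that
  commutes with the generators up to such an error. Hence every element of \<open>\<Psi>\<^sup>0\<close> has trace
  \<open>\<alpha>(k + 1) + \<beta> + O(r\<^sup>k)\<close> over the eigenspace of \<open>\<bar>D\<bar>\<close> for the eigenvalue \<open>k + 1\<close>, and its zeta function is
  \<open>\<alpha>\<zeta>(z - 1) + \<beta>\<zeta>(z)\<close> plus an entire function. The identity has \<open>\<alpha> \<noteq> 0\<close>. For \<open>y = x\<^sub>0 - t\<close> the entries of \<open>y\<^sup>*y\<close>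
  decay in \<open>j\<close>, so \<open>\<alpha> = 0\<close>, and \<open>\<beta> \<noteq> 0\<close> is a limit of sums of squares
  that do not all tend to \<open>0\<close>.\<close>

section \<open>Continuation of the Riemann zeta function\<close>

text \<open>The obstacle is the edge of the quadrant j, d \<ge> 0: a shifted product of matrices
  also runs through positions that the unshifted product lacks. At the edge j = 0 the extra paths
  occur only where j is bounded, and there smallness in j asks for no more than boundedness. At the
  edge d = 0 such a path changes d, so entries that change d have to decay in j. Near invariance is
  stated through differences under steps of 2, so that no limit matrix is named and the parity of j
  + d, which singles out the basis vectors, is preserved. The asymptotics of the generators rest on
  two limits for large l: the factor \<open>alpha_N\<close> of the coefficients that change l tends
  to a multiple of sqrt (1 - t), the factor \<open>beta_N\<close> of the others to t. Both limits
  are the same for the two signs, hence the sign of D almost commutes with the algebra; and they are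
  never both 0, hence the trace of y^* y does not fade. The roles of j and d differ because the
  powers of q left after cancelling q-numbers involve only j and j + d.\<close>

lemma holomorphic_on_suminf:
  fixes f :: "nat \<Rightarrow> complex \<Rightarrow> complex"
  assumes "open S" and hol: "\<And>n. f n holomorphic_on S"
    and bound: "\<And>z. z \<in> S \<Longrightarrow> \<exists>d>0. \<exists>M. summable M \<and> (\<forall>n. \<forall>w\<in>S. dist z w \<le> d \<longrightarrow> norm (f n w) \<le> M n)"
  shows "(\<lambda>z. \<Sum>n. f n z) holomorphic_on S"
proof (rule holomorphic_uniform_sequence[OF \<open>open S\<close>, of "\<lambda>n z. \<Sum>i<n. f i z"])
  show "(\<lambda>z. \<Sum>i<n. f i z) holomorphic_on S" for n
    by (intro holomorphic_intros hol)
  fix z assume z: "z \<in> S"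
  obtain d M where d: "d > 0" "summable M"
    "\<And>n w. w \<in> S \<Longrightarrow> dist z w \<le> d \<Longrightarrow> norm (f n w) \<le> M n"
    using bound[OF z] by blast
  obtain e where e: "e > 0" "cball z e \<subseteq> S"
    using \<open>open S\<close> z open_contains_cball by blast
  have "uniform_limit (cball z (min d e)) (\<lambda>n w. \<Sum>i<n. f i w) (\<lambda>w. \<Sum>i. f i w) sequentially"
    using d e by (intro Weierstrass_m_test[of _ _ M]) (auto simp: subset_iff)
  then show "\<exists>d>0. cball z d \<subseteq> S \<and> uniform_limit (cball z d) (\<lambda>n w. \<Sum>i<n. f i w) (\<lambda>w. \<Sum>i. f i w) sequentially"
    using d e by (intro exI[of _ "min d e"]) (auto simp: subset_iff)
qed

lemma norm_of_nat_powr: "0 < n \<Longrightarrow> norm (of_nat n powr s :: complex) = real n powr Re s"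
  using norm_powr_real_powr[of "of_nat n" s] by simp

lemma summable_of_nat_add_powr: "a < -1 \<Longrightarrow> summable (\<lambda>n. real (n + k) powr a)"
  by (subst summable_iff_shift) (simp add: summable_real_powr_iff)

text \<open>The binomial coefficients of (1 - x)^(1 - s) are dominated by those of (1 - x)^(-R), a
  series with nonnegative terms and value 2^R at x = 1/2. Pulling (2 x)^(K + 1) out of the tail
  compares it with that value. The bound depends on s only through R, which makes the later
  convergence locally uniform.\<close>

lemma powr_one_minus_taylor_bound:
  fixes s :: complex
  assumes "norm (s - 1) \<le> R" "0 \<le> x" "x \<le> 1/2"
  shows "norm ((1 - of_real x) powr (1 - s) - (\<Sum>k\<le>K. pochhammer (s - 1) k / fact k * of_real x ^ k))
    \<le> 2 powr R * 2 ^ Suc K * x ^ Suc K"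
proof -
  let ?c = "\<lambda>k. pochhammer (s - 1) k / fact k"
  have sign: "(- 1) ^ k * (- y) ^ k = y ^ k" "(- 1) ^ k * (- u) ^ k = u ^ k" for k and y :: complex and u :: real
    by (simp_all flip: power_mult_distrib)
  have sums_c: "(\<lambda>k. ?c k * of_real x ^ k) sums (1 - of_real x) powr (1 - s)"
  proof -
    have "(\<lambda>k. ((1 - s) gchoose k) * (- of_real x) ^ k) sums (1 + (- of_real x)) powr (1 - s)"
      using assms by (intro gen_binomial_complex) (simp add: norm_mult)
    moreover have "((1 - s) gchoose k) * (- of_real x) ^ k = ?c k * of_real x ^ k" for k
      using sign(1)[of k "of_real x"] by (simp add: gbinomial_pochhammer mult_ac)
    ultimately show ?thesis by simp
  qed
  have major: "(\<lambda>k. pochhammer R k / fact k * (1/2) ^ k) sums 2 powr R"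
  proof -
    have "(\<lambda>k. ((- R) gchoose k) * (- 1/2) ^ k) sums (1 + (- 1/2)) powr (- R)"
      by (rule gen_binomial_real) simp
    moreover have "((- R) gchoose k) * (- 1/2) ^ k = pochhammer R k / fact k * (1/2) ^ k" for k
      using sign(2)[of k "1/2"] by (simp add: gbinomial_pochhammer mult_ac)
    moreover have "(1 + (- 1/2)) powr (- R) = 2 powr R"
      by (simp add: powr_minus powr_divide field_simps)
    ultimately show ?thesis by simp
  qed
  have R0: "0 \<le> R" using assms norm_ge_zero order_trans by blast
  then have poch: "0 \<le> pochhammer R k" for k
    by (auto simp: pochhammer_prod intro!: prod_nonneg)
  have c_le: "norm (?c k) \<le> pochhammer R k / fact k" for k
  proof -
    have "norm (pochhammer (s - 1) k) \<le> pochhammer R k"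
    proof (induction k)
      case (Suc k)
      have "norm (s - 1 + of_nat k) \<le> R + real k"
        using assms(1) norm_triangle_ineq[of "s - 1" "of_nat k"] by simp
      then show ?case
        using Suc R0 by (simp add: pochhammer_Suc norm_mult mult_mono poch)
    qed simp
    then show ?thesis by (simp add: norm_divide divide_right_mono)
  qed
  let ?t = "\<lambda>k. ?c (k + Suc K) * of_real x ^ (k + Suc K)"
  have tail: "?t sums ((1 - of_real x) powr (1 - s) - (\<Sum>k\<le>K. ?c k * of_real x ^ k))"
    using sums_split_initial_segment[OF sums_c, of "Suc K"] by (simp add: lessThan_Suc_atMost)
  let ?b = "\<lambda>k. pochhammer R (k + Suc K) / fact (k + Suc K) * (1/2) ^ (k + Suc K)"
  have sb: "summable ?b"
    using major by (subst summable_iff_shift) (rule sums_summable)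
  have b_le: "suminf ?b \<le> 2 powr R"
  proof -
    have "suminf ?b = 2 powr R - (\<Sum>k<Suc K. pochhammer R k / fact k * (1/2) ^ k)"
      using sums_split_initial_segment[OF major, of "Suc K"] by (simp add: sums_iff)
    moreover have "0 \<le> (\<Sum>k<Suc K. pochhammer R k / fact k * (1/2) ^ k)"
      using R0 by (intro sum_nonneg) (simp add: poch)
    ultimately show ?thesis by linarith
  qed
  have t_le: "norm (?t k) \<le> (2 ^ Suc K * x ^ Suc K) * ?b k" for k
  proof -
    have "norm (?t k) = norm (?c (k + Suc K)) * (x ^ k * x ^ Suc K)"
      using assms(2) by (simp only: norm_mult norm_power norm_of_real power_add abs_of_nonneg)
    also have "\<dots> \<le> (pochhammer R (k + Suc K) / fact (k + Suc K)) * (x ^ k * x ^ Suc K)"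
      using assms(2) by (intro mult_right_mono c_le) auto
    also have "\<dots> \<le> (pochhammer R (k + Suc K) / fact (k + Suc K)) * ((1/2) ^ k * x ^ Suc K)"
      using assms R0 by (intro mult_left_mono mult_right_mono power_mono divide_nonneg_nonneg poch) auto
    also have "\<dots> = (2 ^ Suc K * x ^ Suc K) * ?b k"
      by (simp add: power_add power_divide mult_ac)
    finally show ?thesis .
  qed
  have "norm (suminf ?t) \<le> (\<Sum>k. (2 ^ Suc K * x ^ Suc K) * ?b k)"
    by (intro norm_suminf_le t_le summable_mult sb)
  also have "\<dots> = (2 ^ Suc K * x ^ Suc K) * suminf ?b"
    by (rule suminf_mult[OF sb])
  also have "\<dots> \<le> (2 ^ Suc K * x ^ Suc K) * 2 powr R"
    using b_le assms by (intro mult_left_mono) auto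
  finally show ?thesis
    using tail by (simp add: sums_iff mult_ac)
qed

text \<open>The binomial expansion of \<open>(N - 1)\<^sup>1\<^sup>-\<^sup>s - N\<^sup>1\<^sup>-\<^sup>s\<close> in powers of \<open>N\<close>, summed over \<open>N \<ge> 2\<close>, expresses
  \<open>(s - 1) (\<zeta>(s) - 1)\<close> through the same function at \<open>s + 1, s + 2, \<dots>\<close> and a remainder that converges in a
  larger half plane.\<close>

definition zeta_tail :: "complex \<Rightarrow> complex" where
  "zeta_tail s = (\<Sum>n. of_nat (n + 2) powr (- s))"

text \<open>Since N = n + 2 is at least 2, the expansion variable 1 / N stays in the range [0, 1/2]
  of the Taylor bound. Removing the terms up to order K leaves O(N^(- Re s - K)), which is summable
  for Re s > 1 - K.\<close>

definition taylor_defect :: "nat \<Rightarrow> nat \<Rightarrow> complex \<Rightarrow> complex" where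
  "taylor_defect K n s = of_nat (n + 1) powr (1 - s)
     - of_nat (n + 2) powr (1 - s) * (\<Sum>k\<le>K. pochhammer (s - 1) k / fact k * inverse (of_nat (n + 2)) ^ k)"

lemma norm_taylor_defect_le:
  assumes "norm (s - 1) \<le> R"
  shows "norm (taylor_defect K n s) \<le> 2 powr R * 2 ^ Suc K * real (n + 2) powr (- Re s - real K)"
proof -
  define N where "N = real (n + 2)"
  have N: "N \<ge> 2" by (simp add: N_def)
  \<comment> \<open>(N - 1)^(1 - s) factors as N^(1 - s) (1 - 1/N)^(1 - s); for complex powers this
    is legitimate because both bases are nonnegative reals.\<close>
  have "complex_of_real (N * (1 - 1/N)) powr (1 - s)
      = complex_of_real N powr (1 - s) * complex_of_real (1 - 1/N) powr (1 - s)"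
    using N by (intro powr_times_real[of "of_real N" "of_real (1 - 1/N)", folded of_real_mult]) auto
  moreover have "N * (1 - 1/N) = real (n + 1)"
    using N by (simp add: right_diff_distrib) (simp add: N_def)
  ultimately have "taylor_defect K n s = of_nat (n + 2) powr (1 - s) *
     ((1 - of_real (1/N)) powr (1 - s) - (\<Sum>k\<le>K. pochhammer (s - 1) k / fact k * of_real (1/N) ^ k))"
    by (simp add: taylor_defect_def N_def algebra_simps inverse_eq_divide)
  moreover have "norm (of_nat (n + 2) powr (1 - s) :: complex) = N powr (1 - Re s)"
    unfolding N_def by (subst norm_of_nat_powr) auto
  ultimately have "norm (taylor_defect K n s) \<le> N powr (1 - Re s) * (2 powr R * 2 ^ Suc K * (1/N) ^ Suc K)"
    using N powr_one_minus_taylor_bound[OF assms, of "1/N" K]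
    by (simp only: norm_mult) (intro mult_left_mono, auto)
  also have "\<dots> = 2 powr R * 2 ^ Suc K * (N powr (1 - Re s) * N powr - real (Suc K))"
    using N by (simp add: powr_minus powr_realpow power_one_over field_simps del: power_Suc of_nat_Suc)
  also have "N powr (1 - Re s) * N powr - real (Suc K) = N powr (- Re s - real K)"
    by (simp flip: powr_add)
  finally show ?thesis by (simp add: N_def)
qed

lemma summable_zeta_tail: "Re s > 1 \<Longrightarrow> summable (\<lambda>n. of_nat (n + 2) powr (- s) :: complex)"
  by (rule summable_norm_cancel)
     (use summable_of_nat_add_powr[of "- Re s" 2] in \<open>simp add: norm_of_nat_powr del: of_nat_add of_nat_Suc\<close>)

lemma holomorphic_zeta_tail: "zeta_tail holomorphic_on {s. Re s > 1}"
  unfolding zeta_tail_def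
proof (rule holomorphic_on_suminf)
  show "(\<lambda>s. of_nat (n + 2) powr (- s) :: complex) holomorphic_on {s. Re s > 1}" for n
    by (intro holomorphic_intros)
  fix z :: complex assume z: "z \<in> {s. Re s > 1}"
  define d where "d = (Re z - 1) / 2"
  have "norm (of_nat (n + 2) powr (- w) :: complex) \<le> real (n + 2) powr (- 1 - d)" if "dist z w \<le> d" for n w
  proof -
    have "Re w \<ge> 1 + d"
      using that abs_Re_le_cmod[of "z - w"] by (simp add: dist_norm d_def field_simps)
    then show ?thesis
      by (subst norm_of_nat_powr) (auto intro!: powr_mono)
  qed
  moreover have "d > 0" using z by (simp add: d_def)
  ultimately show "\<exists>d>0. \<exists>M. summable M \<and> (\<forall>n. \<forall>w\<in>{s. Re s > 1}. dist z w \<le> d \<longrightarrow>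
      norm (of_nat (n + 2) powr (- w) :: complex) \<le> M n)"
    using summable_of_nat_add_powr[of "- 1 - d" 2] by (intro exI[of _ d] conjI exI[of _ "\<lambda>n. real (n + 2) powr (- 1 - d)"]) auto
qed (rule open_halfspace_Re_gt)

lemma summable_taylor_defect:
  assumes "Re s > 1 - real K"
  shows "summable (\<lambda>n. taylor_defect K n s)"
proof (rule summable_comparison_test')
  show "summable (\<lambda>n. 2 powr norm (s - 1) * 2 ^ Suc K * real (n + 2) powr (- Re s - real K))"
    using assms by (intro summable_mult summable_of_nat_add_powr) auto
qed (rule norm_taylor_defect_le[OF order_refl])

lemma holomorphic_taylor_defect:
  "(\<lambda>s. \<Sum>n. taylor_defect K n s) holomorphic_on {s. Re s > 1 - real K}"
proof (rule holomorphic_on_suminf)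
  show "taylor_defect K n holomorphic_on {s. Re s > 1 - real K}" for n
    unfolding taylor_defect_def pochhammer_prod by (intro holomorphic_intros) (auto simp: complex_eq_iff)
  fix z :: complex assume z: "z \<in> {s. Re s > 1 - real K}"
  define d where "d = (Re z - 1 + real K) / 2"
  define C where "C = 2 powr (norm (z - 1) + d) * 2 ^ Suc K"
  have "norm (taylor_defect K n w) \<le> C * real (n + 2) powr (- 1 - d)" if w: "dist z w \<le> d" for n w
  proof -
    have *: "Re w \<ge> 1 - real K + d"
      using w abs_Re_le_cmod[of "z - w"] by (simp add: dist_norm d_def field_simps)
    have "norm (w - 1) \<le> norm (z - 1) + d"
      using w norm_triangle_ineq4[of "z - 1" "z - w"] by (simp add: dist_norm)
    from norm_taylor_defect_le[OF this, of K n]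
    show ?thesis unfolding C_def
      by (rule order_trans, intro mult_left_mono powr_mono) (use * in auto)
  qed
  moreover have "d > 0" using z by (simp add: d_def)
  ultimately show "\<exists>d>0. \<exists>M. summable M \<and> (\<forall>n. \<forall>w\<in>{s. Re s > 1 - real K}. dist z w \<le> d \<longrightarrow>
      norm (taylor_defect K n w) \<le> M n)"
    by (intro exI[of _ d] conjI exI[of _ "\<lambda>n. C * real (n + 2) powr (- 1 - d)"] summable_mult summable_of_nat_add_powr) auto
qed (rule open_halfspace_Re_gt)

text \<open>The differences (N - 1)^(1 - s) - N^(1 - s) telescope to 1. In the expansion of each in
  powers of 1 / N the term k = 0 cancels against N^(1 - s), and the terms of order k sum to a
  multiple of \<open>zeta_tail\<close> at s + k - 1.\<close>

lemma zeta_tail_recursion: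
  assumes s: "Re s > 1"
  shows "(\<Sum>k=1..K. pochhammer (s - 1) k / fact k * zeta_tail (s + of_nat k - 1))
           + (\<Sum>n. taylor_defect K n s) = 1"
proof -
  let ?f = "\<lambda>n. of_nat (n + 1) powr (1 - s) :: complex"
  have "(\<lambda>n. norm (?f n)) \<longlonglongrightarrow> 0"
  proof -
    have "((\<lambda>x. x powr (1 - Re s)) \<longlongrightarrow> 0) at_top"
      using s by (intro tendsto_neg_powr filterlim_ident) auto
    moreover have "filterlim (\<lambda>n. real (n + 1)) at_top sequentially"
      by (rule filterlim_compose[OF filterlim_real_sequentially]) (simp add: filterlim_Suc)
    ultimately have "(\<lambda>n. real (n + 1) powr (1 - Re s)) \<longlonglongrightarrow> 0"
      by (rule filterlim_compose)
    then show ?thesis by (simp only: norm_of_nat_powr) (simp add: norm_of_nat_powr del: of_nat_add of_nat_Suc)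
  qed
  then have "?f \<longlonglongrightarrow> 0" by (rule tendsto_norm_zero_cancel)
  from telescope_sums'[OF this]
  have tele: "(\<lambda>n. ?f n - ?f (Suc n)) sums 1" by simp
  have step_eq: "?f n - ?f (Suc n) = (\<Sum>k=1..K. pochhammer (s - 1) k / fact k * of_nat (n + 2) powr (- (s + of_nat k - 1)))
      + taylor_defect K n s" for n
  proof -
    define N :: complex where "N = of_nat (n + 2)"
    have N0: "N \<noteq> 0" unfolding N_def of_nat_eq_0_iff by simp
    have pw: "N powr (1 - s) * inverse N ^ k = N powr (- (s + of_nat k - 1))" for k
    proof -
      have "N powr (- (s + of_nat k - 1)) = N powr (1 - s) / N powr of_nat k"
        by (simp add: powr_diff[symmetric] algebra_simps)
      also have "N powr of_nat k = N ^ k"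
        using N0 by (simp add: powr_nat')
      finally show ?thesis by (simp add: power_inverse field_simps)
    qed
    have "{..K} = insert 0 {1..K}" by auto
    then have "N powr (1 - s) * (\<Sum>k\<le>K. pochhammer (s - 1) k / fact k * inverse N ^ k)
        = N powr (1 - s) + (\<Sum>k=1..K. pochhammer (s - 1) k / fact k * (N powr (1 - s) * inverse N ^ k))"
      by (simp add: sum_distrib_left semiring_class.distrib_left mult_ac)
    then have "N powr (1 - s) * (\<Sum>k\<le>K. pochhammer (s - 1) k / fact k * inverse N ^ k)
        = N powr (1 - s) + (\<Sum>k=1..K. pochhammer (s - 1) k / fact k * N powr (- (s + of_nat k - 1)))"
      unfolding pw .
    moreover have "Suc n + 1 = n + 2" by simp
    moreover have "A - B = S + (A - (B + S))" for A B S :: complex by simp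
    ultimately show ?thesis
      unfolding taylor_defect_def N_def by (simp only:)
  qed
  have z: "(\<lambda>n. of_nat (n + 2) powr (- (s + of_nat k - 1))) sums zeta_tail (s + of_nat k - 1)" if "k \<in> {1..K}" for k
    unfolding zeta_tail_def using that s by (intro summable_sums summable_zeta_tail) auto
  have "(\<lambda>n. (\<Sum>k=1..K. pochhammer (s - 1) k / fact k * of_nat (n + 2) powr (- (s + of_nat k - 1)))
      + taylor_defect K n s) sums ((\<Sum>k=1..K. pochhammer (s - 1) k / fact k * zeta_tail (s + of_nat k - 1))
           + (\<Sum>n. taylor_defect K n s))"
    using s by (intro sums_add sums_sum sums_mult z summable_sums summable_taylor_defect) auto
  with tele show ?thesis
    unfolding step_eq by (rule sums_unique2[symmetric])
qed

text \<open>The recursion is solved for its term k = 1. Splitting the last factor off each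
  Pochhammer symbol turns the other terms into the same function (s - 1) \<open>zeta_tail\<close> s,
  evaluated at s + k + 1; this product, not \<open>zeta_tail\<close> itself, is what gets
  continued.\<close>

lemma zeta_tail_step:
  assumes s: "Re s > 1"
  shows "(s - 1) * zeta_tail s = 1
    - (\<Sum>k\<le>M. pochhammer (s - 1) (Suc k) / fact (k + 2) * ((s + of_nat k) * zeta_tail (s + of_nat k + 1)))
    - (\<Sum>n. taylor_defect (M + 2) n s)"
proof -
  have arith: "A = X + S \<Longrightarrow> A + R = 1 \<Longrightarrow> X = 1 - S - R" for A X S R :: complex
    by (simp add: algebra_simps)
  have "{1..M + 2} = insert 1 ((\<lambda>k. k + 2) ` {..M})"
  proof (intro equalityI subsetI)
    fix k assume "k \<in> {1..M + 2}"
    then have "k = 1 \<or> k = (k - 2) + 2 \<and> k - 2 \<in> {..M}" by auto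
    then show "k \<in> insert 1 ((\<lambda>k. k + 2) ` {..M})" by blast
  qed auto
  moreover have "sum f (insert 1 ((\<lambda>k. k + 2) ` {..M})) = f 1 + (\<Sum>k\<le>M. f (k + 2))" for f :: "nat \<Rightarrow> complex"
    by (subst sum.insert) (auto simp: sum.reindex inj_on_def)
  ultimately have "(\<Sum>k=1..M + 2. pochhammer (s - 1) k / fact k * zeta_tail (s + of_nat k - 1))
     = (s - 1) * zeta_tail s + (\<Sum>k\<le>M. pochhammer (s - 1) (k + 2) / fact (k + 2) * zeta_tail (s + of_nat (k + 2) - 1))"
    by (simp only:) simp
  also have "(\<Sum>k\<le>M. pochhammer (s - 1) (k + 2) / fact (k + 2) * zeta_tail (s + of_nat (k + 2) - 1))
     = (\<Sum>k\<le>M. pochhammer (s - 1) (Suc k) / fact (k + 2) * ((s + of_nat k) * zeta_tail (s + of_nat k + 1)))"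
    by (intro sum.cong HOL.refl) (simp add: pochhammer_Suc algebra_simps)
  finally show ?thesis
    by (rule arith) (rule zeta_tail_recursion[OF s])
qed

text \<open>Each induction step gains a strip of width 1, because the recursion only asks for
  arguments whose real part is larger by at least 1. At s = 1 all Pochhammer factors and the defect
  vanish, which leaves the value 1, the residue of the zeta function.\<close>

lemma zeta_tail_extends:
  "\<exists>E. E holomorphic_on {s. Re s > 1 - real M} \<and> (\<forall>s. Re s > 1 \<longrightarrow> E s = (s - 1) * zeta_tail s)
     \<and> (M > 0 \<longrightarrow> E 1 = 1)"
proof (induction M)
  case 0
  show ?case
    by (rule exI[of _ "\<lambda>s. (s - 1) * zeta_tail s"]) (use holomorphic_zeta_tail in \<open>auto intro!: holomorphic_intros\<close>)
next
  case (Suc M)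
  then obtain E where E: "E holomorphic_on {s. Re s > 1 - real M}"
    "\<And>s. Re s > 1 \<Longrightarrow> E s = (s - 1) * zeta_tail s" by auto
  define E' where "E' = (\<lambda>s. 1
    - (\<Sum>k\<le>M. pochhammer (s - 1) (Suc k) / fact (k + 2) * E (s + of_nat k + 1))
    - (\<Sum>n. taylor_defect (M + 2) n s))"
  have Ek: "(\<lambda>s. E (s + of_nat k + 1)) holomorphic_on {s. Re s > 1 - real (Suc M)}" for k
    by (rule holomorphic_on_compose_gen[OF _ E(1), unfolded o_def]) (auto intro!: holomorphic_intros)
  have T: "(\<lambda>s. \<Sum>n. taylor_defect (M + 2) n s) holomorphic_on {s. Re s > 1 - real (Suc M)}"
    by (rule holomorphic_on_subset[OF holomorphic_taylor_defect]) auto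
  have "E' holomorphic_on {s. Re s > 1 - real (Suc M)}"
    unfolding E'_def pochhammer_prod by (intro holomorphic_intros Ek T) auto
  moreover have "E' s = (s - 1) * zeta_tail s" if "Re s > 1" for s
  proof -
    have "E (s + of_nat k + 1) = (s + of_nat k) * zeta_tail (s + of_nat k + 1)" for k
      using E(2)[of "s + of_nat k + 1"] that by simp
    then show ?thesis
      unfolding E'_def by (simp only: zeta_tail_step[OF that, of M])
  qed
  moreover have "E' 1 = 1"
  proof -
    have "taylor_defect (M + 2) n 1 = 0" for n
    proof -
      have ne: "of_nat (n + 1) \<noteq> (0 :: complex)" "of_nat (n + 2) \<noteq> (0 :: complex)"
        unfolding of_nat_eq_0_iff by auto
      have "(\<Sum>k\<le>M+2. pochhammer 0 k / fact k * inverse (of_nat (n + 2)) ^ k) = (\<Sum>k\<in>{0::nat}. 1 :: complex)"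
        by (rule sum.mono_neutral_cong_right) (auto simp: pochhammer_0_left)
      then show ?thesis using ne by (simp only: taylor_defect_def diff_self powr_zero_eq_one) simp
    qed
    then show ?thesis by (simp add: E'_def pochhammer_0_left)
  qed
  ultimately show ?case by blast
qed

text \<open>E(s) is (s - 1) \<zeta>(s); that it is entire with value 1 at 1 encodes the simple pole
  of \<zeta>. The continuations to the various half planes agree by the identity theorem, since they
  coincide for Re s > 1, and so they glue.\<close>

lemma riemann_zeta_continuation:
  obtains E :: "complex \<Rightarrow> complex" where "E holomorphic_on UNIV" "E 1 = 1"
    "\<And>s. Re s > 1 \<Longrightarrow> (\<lambda>n. of_nat (Suc n) powr (- s)) sums (E s / (s - 1))"
proof -
  obtain F where F: "\<And>M. F M holomorphic_on {s. Re s > 1 - real M}"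
    "\<And>M s. Re s > 1 \<Longrightarrow> F M s = (s - 1) * zeta_tail s" "\<And>M. M > 0 \<Longrightarrow> F M 1 = 1"
    using zeta_tail_extends by metis
  \<comment> \<open>Chosen so that s lies in the open half plane Re > 1 -
    \<open>M s\<close>.\<close>
  define M where "M = (\<lambda>s::complex. Suc (nat \<lceil>1 - Re s\<rceil>))"
  define G where "G = (\<lambda>s. F (M s) s)"
  have agree: "F K s = F L s" if "K \<le> L" "Re s > 1 - real K" for K L s
    by (rule analytic_continuation_open[of "{s. Re s > 1}" "{s. Re s > 1 - real K}"])
       (use that in \<open>auto simp: F(2) open_halfspace_Re_gt connected_halfspace_Re_gt
          intro!: F(1) holomorphic_on_subset[OF F(1)[of L]] exI[of _ 2]\<close>)
  have G_eq: "G s = F K s" if "Re s > 1 - real K" for K s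
  proof -
    have "Re s > 1 - real (M s)" unfolding M_def by linarith
    with that show ?thesis unfolding G_def by (metis agree nat_le_linear)
  qed
  have "G holomorphic_on UNIV"
  proof -
    have "G field_differentiable (at s)" for s
    proof -
      let ?S = "{w. Re w > 1 - real (M s)}"
      have s: "s \<in> ?S" unfolding M_def mem_Collect_eq by linarith
      have "G holomorphic_on ?S"
        using F(1)[of "M s"] by (rule holomorphic_transform) (use G_eq[of "M s"] in auto)
      then show ?thesis
        using s holomorphic_on_imp_differentiable_at open_halfspace_Re_gt by blast
    qed
    then show ?thesis by (simp add: holomorphic_on_def field_differentiable_at_within)
  qed
  \<comment> \<open>Adding s - 1 restores the first term of the zeta series, which
    \<open>zeta_tail\<close> omits.\<close>
  then have "(\<lambda>s. G s + (s - 1)) holomorphic_on UNIV" by (intro holomorphic_intros)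
  moreover have "G 1 + (1 - 1) = 1" using G_eq[of 1 1] F(3)[of 1] by simp
  moreover have "(\<lambda>n. of_nat (Suc n) powr (- s)) sums ((G s + (s - 1)) / (s - 1))" if s: "Re s > 1" for s
  proof -
    have "(\<lambda>n. of_nat (Suc (Suc n)) powr (- s)) sums zeta_tail s"
      using summable_sums[OF summable_zeta_tail[OF s]] by (simp add: zeta_tail_def)
    then have "(\<lambda>n. of_nat (Suc n) powr (- s)) sums (zeta_tail s + 1)"
      by (subst (asm) sums_Suc_iff) simp
    moreover have "G s = (s - 1) * zeta_tail s"
      using G_eq[of 0 s] F(2)[of s 0] s by simp
    moreover have "s \<noteq> 1" using s by auto
    ultimately show ?thesis by (simp only: add_divide_distrib) simp
  qed
  ultimately show thesis using that by blast
qed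

section \<open>Exponentially small families\<close>

text \<open>The base r < 1 is existential, so it may grow as needed: to the maximum of two bases for
  sums and products, to its square root in order to absorb linear factors or to pass to square
  roots. With weight 0 the notion is boundedness.\<close>

definition expsmall :: "('a \<Rightarrow> nat) \<Rightarrow> ('a \<Rightarrow> 'b::real_normed_vector) \<Rightarrow> bool" where
  "expsmall w g \<longleftrightarrow> (\<exists>K r. 0 < r \<and> r < 1 \<and> (\<forall>x. norm (g x) \<le> K * r ^ w x))"

lemma expsmallI: "0 < r \<Longrightarrow> r < 1 \<Longrightarrow> (\<And>x. norm (g x) \<le> K * r ^ w x) \<Longrightarrow> expsmall w g"
  unfolding expsmall_def by blast

lemma expsmallE:
  assumes "expsmall w g"
  obtains K r where "0 < K" "0 < r" "r < 1" "\<And>x. norm (g x) \<le> K * r ^ w x"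
proof -
  obtain K r where *: "0 < r" "r < 1" "\<And>x. norm (g x) \<le> K * r ^ w x"
    using assms unfolding expsmall_def by blast
  have "norm (g x) \<le> (\<bar>K\<bar> + 1) * r ^ w x" for x
    using *(3)[of x] by (rule order_trans) (use *(1) in \<open>intro mult_right_mono, auto\<close>)
  then show thesis using *(1,2) by (intro that[of "\<bar>K\<bar> + 1" r]) auto
qed

lemma expsmall_boundedI: "(\<And>x. norm (g x) \<le> K) \<Longrightarrow> expsmall (\<lambda>_. 0) g"
  by (rule expsmallI[of "1/2" _ K]) auto

lemma power_shift_le:
  fixes r :: real
  assumes "0 < r" "r < 1" "n \<le> m + c"
  shows "r ^ m \<le> inverse r ^ c * r ^ n"
proof -
  have "r ^ c * r ^ m \<le> r ^ n"
    using assms by (simp add: power_decreasing flip: power_add add.commute)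
  then show ?thesis
    using assms by (simp add: power_inverse field_simps)
qed

text \<open>Losing at most c in the exponent costs only the constant factor r^(-c). The weights are
  compared only where h is nonzero, which lets a banded matrix exchange the weight of a row for that
  of a column.\<close>

lemma expsmall_transfer:
  assumes "expsmall w g" "\<And>x. norm (h x) \<le> C * norm (g (f x))"
    "\<And>x. h x \<noteq> 0 \<Longrightarrow> w' x \<le> w (f x) + c"
  shows "expsmall w' h"
proof -
  obtain K r where *: "0 < K" "0 < r" "r < 1" "\<And>x. norm (g x) \<le> K * r ^ w x"
    using assms(1) by (rule expsmallE) blast
  have "norm (h x) \<le> (\<bar>C\<bar> * K * inverse r ^ c) * r ^ w' x" for x
  proof (cases "h x = 0")
    case False
    have "norm (h x) \<le> \<bar>C\<bar> * norm (g (f x))"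
      using assms(2)[of x] by (rule order_trans) (intro mult_right_mono, auto)
    also have "\<dots> \<le> \<bar>C\<bar> * (K * r ^ w (f x))"
      by (intro mult_left_mono *(4)) auto
    also have "\<dots> \<le> \<bar>C\<bar> * (K * (inverse r ^ c * r ^ w' x))"
      using * assms(3)[OF False] by (intro mult_left_mono power_shift_le) auto
    finally show ?thesis by (simp add: mult_ac)
  qed (use * in auto)
  then show ?thesis using * by (intro expsmallI)
qed

lemma expsmall_reindex: "expsmall w g \<Longrightarrow> expsmall (\<lambda>x. w (f x)) (\<lambda>x. g (f x))"
  by (rule expsmall_transfer[of w g _ 1 f _ 0]) auto

lemma expsmall_weaken: "expsmall w g \<Longrightarrow> (\<And>x. g x \<noteq> 0 \<Longrightarrow> w' x \<le> w x + c) \<Longrightarrow> expsmall w' g"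
  by (rule expsmall_transfer[of w g _ 1 "\<lambda>x. x" _ c]) auto

lemma expsmall_add:
  assumes "expsmall w g" "expsmall w h"
  shows "expsmall w (\<lambda>x. g x + h x)"
proof -
  obtain K r where 1: "0 < K" "0 < r" "r < 1" "\<And>x. norm (g x) \<le> K * r ^ w x"
    using assms(1) by (rule expsmallE) blast
  obtain L s where 2: "0 < L" "0 < s" "s < 1" "\<And>x. norm (h x) \<le> L * s ^ w x"
    using assms(2) by (rule expsmallE) blast
  have "norm (g x + h x) \<le> (K + L) * max r s ^ w x" for x
  proof -
    have "norm (g x + h x) \<le> K * r ^ w x + L * s ^ w x"
      by (rule norm_triangle_le) (intro add_mono 1 2)
    also have "\<dots> \<le> K * max r s ^ w x + L * max r s ^ w x"
      using 1 2 by (intro add_mono mult_left_mono power_mono) auto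
    finally show ?thesis by (simp add: semiring_class.distrib_right)
  qed
  then show ?thesis using 1 2 by (intro expsmallI[of "max r s"]) auto
qed

lemma expsmall_le_add:
  assumes "expsmall w g" "expsmall w h" "\<And>x. norm (f x) \<le> norm (g x) + norm (h x)"
  shows "expsmall w f"
proof -
  have "expsmall w (\<lambda>x. norm (g x))" "expsmall w (\<lambda>x. norm (h x))"
    using assms(1,2) by (auto intro: expsmall_transfer[of w _ _ 1 "\<lambda>x. x" w 0])
  from expsmall_add[OF this] show ?thesis
    by (rule expsmall_transfer[of w _ _ 1 "\<lambda>x. x" w 0]) (use assms(3) in auto)
qed

lemma expsmall_mult:
  fixes g h :: "'a \<Rightarrow> 'b::real_normed_algebra"
  assumes "expsmall w g" "expsmall v h"
  shows "expsmall (\<lambda>x. w x + v x) (\<lambda>x. g x * h x)"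
proof -
  obtain K r where 1: "0 < K" "0 < r" "r < 1" "\<And>x. norm (g x) \<le> K * r ^ w x"
    using assms(1) by (rule expsmallE) blast
  obtain L s where 2: "0 < L" "0 < s" "s < 1" "\<And>x. norm (h x) \<le> L * s ^ v x"
    using assms(2) by (rule expsmallE) blast
  have "norm (g x * h x) \<le> (K * L) * max r s ^ (w x + v x)" for x
  proof -
    have "norm (g x * h x) \<le> (K * r ^ w x) * (L * s ^ v x)"
      by (rule norm_mult_ineq[THEN order_trans]) (use 1 2 in \<open>intro mult_mono 1 2, auto\<close>)
    also have "\<dots> \<le> (K * max r s ^ w x) * (L * max r s ^ v x)"
      using 1 2 by (intro mult_mono mult_left_mono power_mono) auto
    finally show ?thesis by (simp add: power_add mult_ac)
  qed
  then show ?thesis using 1 2 by (intro expsmallI[of "max r s"]) auto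
qed

lemma expsmall_bounded_mult:
  fixes g h :: "'a \<Rightarrow> 'b::real_normed_algebra"
  shows "expsmall (\<lambda>_. 0) g \<Longrightarrow> expsmall w h \<Longrightarrow> expsmall w (\<lambda>x. g x * h x)"
    and "expsmall w g \<Longrightarrow> expsmall (\<lambda>_. 0) h \<Longrightarrow> expsmall w (\<lambda>x. g x * h x)"
  using expsmall_mult[of "\<lambda>_. 0" g w h] expsmall_mult[of w g "\<lambda>_. 0" h] by simp_all

lemma expsmall_sum:
  assumes "expsmall w h" "\<And>x. card (A x) \<le> n"
    "\<And>x y. y \<in> A x \<Longrightarrow> h (x, y) \<noteq> 0 \<Longrightarrow> w' x \<le> w (x, y) + c"
  shows "expsmall w' (\<lambda>x. \<Sum>y\<in>A x. h (x, y))"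
proof -
  obtain K r where *: "0 < K" "0 < r" "r < 1" "\<And>x. norm (h x) \<le> K * r ^ w x"
    using assms(1) by (rule expsmallE) blast
  have "norm (\<Sum>y\<in>A x. h (x, y)) \<le> (n * K * inverse r ^ c) * r ^ w' x" for x
  proof -
    have "norm (h (x, y)) \<le> K * (inverse r ^ c * r ^ w' x)" if "y \<in> A x" for y
    proof (cases "h (x, y) = 0")
      case False
      have "norm (h (x, y)) \<le> K * r ^ w (x, y)" by (rule *)
      also have "\<dots> \<le> K * (inverse r ^ c * r ^ w' x)"
        using * assms(3)[OF that False] by (intro mult_left_mono power_shift_le) auto
      finally show ?thesis .
    qed (use * in auto)
    then have "norm (\<Sum>y\<in>A x. h (x, y)) \<le> (\<Sum>y\<in>A x. K * (inverse r ^ c * r ^ w' x))"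
      by (intro sum_norm_le) auto
    also have "\<dots> = card (A x) * (K * (inverse r ^ c * r ^ w' x))" by simp
    also have "\<dots> \<le> n * (K * (inverse r ^ c * r ^ w' x))"
      using * assms(2)[of x] by (intro mult_right_mono) auto
    finally show ?thesis by (simp add: mult_ac)
  qed
  then show ?thesis using * by (intro expsmallI)
qed

text \<open>The sequence (n + 1) (sqrt r)^n is bounded because its series converges, being the
  derivative of the geometric series. Half of the decay thus pays for the linear factor.\<close>

lemma linear_power_le:
  fixes r :: real
  assumes "0 < r" "r < 1"
  obtains C where "0 < C" "\<And>n. (real n + 1) * r ^ n \<le> C * sqrt r ^ n"
proof -
  have "summable (\<lambda>n. real (Suc n) * sqrt r ^ n)"
    using geometric_deriv_sums[of "sqrt r"] assms by (simp add: sums_iff)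
  then have "Bseq (\<lambda>n. real (Suc n) * sqrt r ^ n)"
    by (intro convergent_imp_Bseq) (meson convergentI summable_LIMSEQ_zero)
  then obtain C where C: "C > 0" "\<And>n. norm (real (Suc n) * sqrt r ^ n) \<le> C"
    by (auto simp: Bseq_def)
  have "(real n + 1) * r ^ n \<le> C * sqrt r ^ n" for n
  proof -
    have "(real n + 1) * r ^ n = (real (Suc n) * sqrt r ^ n) * sqrt r ^ n"
      using assms by (simp add: power_mult_distrib[symmetric] algebra_simps)
    also have "\<dots> \<le> C * sqrt r ^ n"
      using C(2)[of n] assms by (intro mult_right_mono) auto
    finally show ?thesis .
  qed
  with C(1) show thesis by (rule that)
qed

text \<open>Used with the eigenvalues of |D|, which grow linearly in j + d, and for powers of k + 1
  in Dirichlet series.\<close>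

lemma expsmall_linear:
  assumes "expsmall w g" "\<And>x. norm (h x) \<le> C * (real (w x) + 1) * norm (g x)" "0 \<le> C"
  shows "expsmall w h"
proof -
  obtain K r where *: "0 < K" "0 < r" "r < 1" "\<And>x. norm (g x) \<le> K * r ^ w x"
    using assms(1) by (rule expsmallE) blast
  obtain B where B: "0 < B" "\<And>n. (real n + 1) * r ^ n \<le> B * sqrt r ^ n"
    using linear_power_le[of r] * by blast
  have "norm (h x) \<le> (C * K * B) * sqrt r ^ w x" for x
  proof -
    have "norm (h x) \<le> C * (real (w x) + 1) * (K * r ^ w x)"
      using assms(3) by (intro order_trans[OF assms(2)] mult_left_mono *) auto
    also have "\<dots> = C * K * ((real (w x) + 1) * r ^ w x)" by (simp add: mult_ac)
    also have "\<dots> \<le> C * K * (B * sqrt r ^ w x)"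
      using assms(3) * by (intro mult_left_mono B) auto
    finally show ?thesis by (simp add: mult_ac)
  qed
  then show ?thesis using * by (intro expsmallI[of "sqrt r"]) auto
qed

lemma expsmall_sqrt:
  assumes "expsmall w g" "\<And>x. norm (h x) \<le> sqrt (norm (g x))"
  shows "expsmall w h"
proof -
  obtain K r where *: "0 < K" "0 < r" "r < 1" "\<And>x. norm (g x) \<le> K * r ^ w x"
    using assms(1) by (rule expsmallE) blast
  have "norm (h x) \<le> sqrt K * sqrt r ^ w x" for x
    using order_trans[OF assms(2) real_sqrt_le_mono[OF *(4)]]
    by (simp add: real_sqrt_mult real_sqrt_power)
  then show ?thesis using * by (intro expsmallI[of "sqrt r"]) auto
qed

section \<open>Matrices\<close>

text \<open>An index \<open>(j, d, s)\<close> stands for \<open>l = (j + d) / 2\<close>, \<open>m = (j - d) / 2\<close> and the sign \<open>s\<close> of \<open>N\<close>; it belongs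
  to a basis vector if and only if \<open>j + d\<close> is odd.\<close>

type_synonym idx = "nat \<times> nat \<times> bool"
type_synonym mat = "idx \<Rightarrow> idx \<Rightarrow> complex"

abbreviation jpos :: "idx \<Rightarrow> nat" where "jpos x \<equiv> fst x"
abbreviation dpos :: "idx \<Rightarrow> nat" where "dpos x \<equiv> fst (snd x)"

text \<open>The sign is ignored, so bands are unaffected by \<open>flip\<close>.\<close>

definition near :: "nat \<Rightarrow> idx \<Rightarrow> idx \<Rightarrow> bool" where
  "near W x y \<longleftrightarrow> jpos x \<le> jpos y + W \<and> jpos y \<le> jpos x + W \<and> dpos x \<le> dpos y + W \<and> dpos y \<le> dpos x + W"

definition nbhd :: "nat \<Rightarrow> idx \<Rightarrow> idx set" where "nbhd W x = {y. near W x y}"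

text \<open>Steps of 2 keep the parity of j + d, hence the set of indices of basis vectors; each
  raises l by 1.\<close>

definition dshift :: "idx \<Rightarrow> idx" where "dshift x = (jpos x, dpos x + 2, snd (snd x))"
definition jshift :: "idx \<Rightarrow> idx" where "jshift x = (jpos x + 2, dpos x, snd (snd x))"
definition flip :: "idx \<Rightarrow> idx" where "flip x = (jpos x, dpos x, \<not> snd (snd x))"

lemma shift_pos [simp]:
  "jpos (dshift x) = jpos x" "dpos (dshift x) = dpos x + 2"
  "jpos (jshift x) = jpos x + 2" "dpos (jshift x) = dpos x"
  "jpos (flip x) = jpos x" "dpos (flip x) = dpos x"
  by (simp_all add: dshift_def jshift_def flip_def)

lemma flip_flip [simp]: "flip (flip x) = x"
  by (cases x) (simp add: flip_def)

lemma near_shift [simp]: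
  "near W (dshift x) (dshift y) = near W x y" "near W (jshift x) (jshift y) = near W x y"
  "near W (flip x) y = near W x y" "near W x (flip y) = near W x y"
  by (auto simp: near_def)

lemma near_sym: "near W x y \<longleftrightarrow> near W y x"
  by (auto simp: near_def)

lemma near_mono: "near W x y \<Longrightarrow> W \<le> W' \<Longrightarrow> near W' x y"
  by (auto simp: near_def)

lemma near_trans: "near W x y \<Longrightarrow> near W' y z \<Longrightarrow> near (W + W') x z"
  by (auto simp: near_def)

lemma finite_card_nbhd: "finite (nbhd W x)" "card (nbhd W x) \<le> (2 * W + 1) * ((2 * W + 1) * 2)"
proof -
  let ?S = "{jpos x - W..jpos x + W} \<times> {dpos x - W..dpos x + W} \<times> (UNIV :: bool set)"
  have sub: "nbhd W x \<subseteq> ?S"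
    by (auto simp: nbhd_def near_def)
  then show "finite (nbhd W x)" by (rule finite_subset) auto
  have "card (nbhd W x) \<le> card ?S" by (rule card_mono[OF _ sub]) auto
  also have "\<dots> \<le> (2 * W + 1) * ((2 * W + 1) * 2)"
    by (simp only: card_cartesian_product) (intro mult_mono, auto)
  finally show "card (nbhd W x) \<le> (2 * W + 1) * ((2 * W + 1) * 2)" .
qed

section \<open>Banded matrices that are asymptotically invariant under shifts\<close>

definition banded :: "nat \<Rightarrow> mat \<Rightarrow> bool" where
  "banded W M \<longleftrightarrow> (\<forall>x' x. M x' x \<noteq> 0 \<longrightarrow> near W x x')"

lemma banded_mono: "banded W M \<Longrightarrow> W \<le> W' \<Longrightarrow> banded W' M"
  using near_mono by (fastforce simp: banded_def)

text \<open>Pairs are (target, source), and the weights are read off at the source.\<close>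

abbreviation wj :: "idx \<times> idx \<Rightarrow> nat" where "wj p \<equiv> jpos (snd p)"
abbreviation wjd :: "idx \<times> idx \<Rightarrow> nat" where "wjd p \<equiv> jpos (snd p) + dpos (snd p)"

definition offdiag :: "mat \<Rightarrow> mat" where
  "offdiag M x' x = (if dpos x' = dpos x then 0 else M x' x)"

text \<open>Dependence on j alone up to O(r^(j + d)) appears as near invariance under
  \<open>dshift\<close>, exponential convergence in j as near invariance under
  \<open>jshift\<close>. The differences sum to a limit along every ray, so the limit itself need
  not be part of the data.\<close>

definition tame :: "mat \<Rightarrow> bool" where
  "tame M \<longleftrightarrow> (\<exists>W. banded W M) \<and> expsmall (\<lambda>_. 0) (\<lambda>p. M (fst p) (snd p)) \<and>
     expsmall wj (\<lambda>p. offdiag M (fst p) (snd p)) \<and>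
     expsmall wjd (\<lambda>p. M (dshift (fst p)) (dshift (snd p)) - M (fst p) (snd p)) \<and>
     expsmall wj (\<lambda>p. M (jshift (fst p)) (jshift (snd p)) - M (fst p) (snd p))"

text \<open>These are the entries of F M - M F, where F exchanges the two signs; the Dirac operator
  is F |D|.\<close>

definition flip_tame :: "mat \<Rightarrow> bool" where
  "flip_tame M \<longleftrightarrow> expsmall wjd (\<lambda>p. M (flip (fst p)) (snd p) - M (fst p) (flip (snd p)))"

lemma tameI:
  assumes "banded W M" "expsmall (\<lambda>_. 0) (\<lambda>p. M (fst p) (snd p))"
    "expsmall wj (\<lambda>p. offdiag M (fst p) (snd p))"
    "expsmall wjd (\<lambda>p. M (dshift (fst p)) (dshift (snd p)) - M (fst p) (snd p))"
    "expsmall wj (\<lambda>p. M (jshift (fst p)) (jshift (snd p)) - M (fst p) (snd p))"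
  shows "tame M"
  using assms unfolding tame_def by blast

lemma tameE:
  assumes "tame M"
  obtains W where "banded W M" "expsmall (\<lambda>_. 0) (\<lambda>p. M (fst p) (snd p))"
    "expsmall wj (\<lambda>p. offdiag M (fst p) (snd p))"
    "expsmall wjd (\<lambda>p. M (dshift (fst p)) (dshift (snd p)) - M (fst p) (snd p))"
    "expsmall wj (\<lambda>p. M (jshift (fst p)) (jshift (snd p)) - M (fst p) (snd p))"
  using assms unfolding tame_def by blast

lemma tameD:
  assumes "tame M"
  shows "expsmall (\<lambda>_. 0) (\<lambda>p. M (fst p) (snd p))"
    "expsmall wj (\<lambda>p. offdiag M (fst p) (snd p))"
    "expsmall wjd (\<lambda>p. M (dshift (fst p)) (dshift (snd p)) - M (fst p) (snd p))"
    "expsmall wj (\<lambda>p. M (jshift (fst p)) (jshift (snd p)) - M (fst p) (snd p))"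
  using assms unfolding tame_def by blast+

lemma tame_add:
  assumes "tame M" "tame N"
  shows "tame (\<lambda>x' x. M x' x + N x' x)"
proof -
  obtain V where "banded V M"
    using assms(1) by (rule tameE)
  note M = this tameD[OF assms(1)]
  obtain W where "banded W N"
    using assms(2) by (rule tameE)
  note N = this tameD[OF assms(2)]
  show ?thesis
  proof (rule tameI[of "V + W"])
    show "banded (V + W) (\<lambda>x' x. M x' x + N x' x)"
      using M(1) N(1) unfolding banded_def by (metis add_0 le_add1 le_add2 near_mono)
    show "expsmall (\<lambda>_. 0) (\<lambda>p. M (fst p) (snd p) + N (fst p) (snd p))"
      by (rule expsmall_add[OF M(2) N(2)])
    show "expsmall wj (\<lambda>p. offdiag (\<lambda>x' x. M x' x + N x' x) (fst p) (snd p))"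
      using expsmall_add[OF M(3) N(3)] by (rule back_subst[of "expsmall _"]) (auto simp: offdiag_def)
    show "expsmall wjd (\<lambda>p. M (dshift (fst p)) (dshift (snd p)) + N (dshift (fst p)) (dshift (snd p))
        - (M (fst p) (snd p) + N (fst p) (snd p)))"
      using expsmall_add[OF M(4) N(4)] by (rule back_subst[of "expsmall _"]) auto
    show "expsmall wj (\<lambda>p. M (jshift (fst p)) (jshift (snd p)) + N (jshift (fst p)) (jshift (snd p))
        - (M (fst p) (snd p) + N (fst p) (snd p)))"
      using expsmall_add[OF M(5) N(5)] by (rule back_subst[of "expsmall _"]) auto
  qed
qed

lemma flip_tame_add: "flip_tame M \<Longrightarrow> flip_tame N \<Longrightarrow> flip_tame (\<lambda>x' x. M x' x + N x' x)"
  unfolding flip_tame_def by (drule (1) expsmall_add) (erule back_subst[of "expsmall _"], auto)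

text \<open>A factor invariant under both shifts multiplies the differences just as it multiplies
  the entries. Boundedness is asked on the band only, so that the difference of two eigenvalues of
  |D| qualifies.\<close>

lemma tame_shift_invariant_factor:
  assumes "tame M"
    and inv: "\<And>x' x. c (dshift x') (dshift x) = c x' x" "\<And>x' x. c (jshift x') (jshift x) = c x' x"
    and bd: "\<And>W. banded W M \<Longrightarrow> \<exists>C. \<forall>x' x. near W x x' \<longrightarrow> norm (c x' x) \<le> C"
  shows "tame (\<lambda>x' x. c x' x * M x' x)"
proof -
  obtain W where "banded W M"
    using assms(1) by (rule tameE)
  note M = this tameD[OF assms(1)]
  obtain C where C: "\<And>x' x. near W x x' \<Longrightarrow> norm (c x' x) \<le> C"
    using bd[OF M(1)] by blast
  have 1: "norm (c x' x * M x' x) \<le> C * norm (M x' x)" for x' x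
    using C[of x x'] M(1) unfolding banded_def norm_mult
    by (cases "M x' x = 0") (auto intro!: mult_right_mono)
  have 2: "norm (c x' x * (M (dshift x') (dshift x) - M x' x)) \<le> C * norm (M (dshift x') (dshift x) - M x' x)"
    "norm (c x' x * (M (jshift x') (jshift x) - M x' x)) \<le> C * norm (M (jshift x') (jshift x) - M x' x)" for x' x
  proof -
    have "near W x x'" if "M (dshift x') (dshift x) - M x' x \<noteq> 0 \<or> M (jshift x') (jshift x) - M x' x \<noteq> 0"
      using M(1) that unfolding banded_def by (metis diff_self near_shift(1,2))
    then show
      "norm (c x' x * (M (dshift x') (dshift x) - M x' x)) \<le> C * norm (M (dshift x') (dshift x) - M x' x)"
      "norm (c x' x * (M (jshift x') (jshift x) - M x' x)) \<le> C * norm (M (jshift x') (jshift x) - M x' x)"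
      using C[of x x'] unfolding norm_mult
      by (metis eq_iff mult_right_mono mult_zero_right norm_ge_zero norm_zero)+
  qed
  show ?thesis
  proof (rule tameI[of W])
    show "banded W (\<lambda>x' x. c x' x * M x' x)" using M(1) by (simp add: banded_def)
    show "expsmall (\<lambda>_. 0) (\<lambda>p. c (fst p) (snd p) * M (fst p) (snd p))"
      by (rule expsmall_transfer[OF M(2), of _ C "\<lambda>x. x" _ 0]) (auto intro: 1)
    show "expsmall wj (\<lambda>p. offdiag (\<lambda>x' x. c x' x * M x' x) (fst p) (snd p))"
      by (rule expsmall_transfer[OF M(3), of _ C "\<lambda>x. x" _ 0]) (auto simp: offdiag_def intro: 1)
    show "expsmall wjd (\<lambda>p. c (dshift (fst p)) (dshift (snd p)) * M (dshift (fst p)) (dshift (snd p)) - c (fst p) (snd p) * M (fst p) (snd p))"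
      by (rule expsmall_transfer[OF M(4), of _ C "\<lambda>x. x" _ 0])
         (use 2(1) in \<open>auto simp: inv simp flip: right_diff_distrib\<close>)
    show "expsmall wj (\<lambda>p. c (jshift (fst p)) (jshift (snd p)) * M (jshift (fst p)) (jshift (snd p)) - c (fst p) (snd p) * M (fst p) (snd p))"
      by (rule expsmall_transfer[OF M(5), of _ C "\<lambda>x. x" _ 0])
         (use 2(2) in \<open>auto simp: inv simp flip: right_diff_distrib\<close>)
  qed
qed

lemma tame_scale: "tame M \<Longrightarrow> tame (\<lambda>x' x. c * M x' x)"
  by (rule tame_shift_invariant_factor[of M "\<lambda>_ _. c"]) auto

lemma flip_tame_scale: "flip_tame M \<Longrightarrow> flip_tame (\<lambda>x' x. c * M x' x)"
  unfolding flip_tame_def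
  by (erule expsmall_transfer[of _ _ _ "norm c" "\<lambda>x. x" _ 0]) (auto simp: norm_mult simp flip: right_diff_distrib)

text \<open>The adjoint moves the weight from the column to the row; on the band the two weights
  differ by a bounded amount.\<close>

lemma tame_adj:
  assumes "tame M"
  shows "tame (\<lambda>x' x. cnj (M x x'))"
proof -
  obtain W where "banded W M"
    using assms by (rule tameE)
  note M = this tameD[OF assms]
  have near: "near W x x'" if "M x' x \<noteq> 0 \<or> M (dshift x') (dshift x) \<noteq> 0 \<or> M (jshift x') (jshift x) \<noteq> 0" for x x'
    using M(1) that unfolding banded_def by (metis near_shift(1,2))
  have cnj_norm: "norm (cnj a - cnj b) = norm (a - b)" for a b
    by (simp flip: complex_cnj_diff)
  show ?thesis
  proof (rule tameI[of W])
    show "banded W (\<lambda>x' x. cnj (M x x'))"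
      using M(1) near_sym unfolding banded_def by (metis complex_cnj_zero_iff)
    show "expsmall (\<lambda>_. 0) (\<lambda>p. cnj (M (snd p) (fst p)))"
      by (rule expsmall_transfer[OF M(2), of _ 1 prod.swap _ 0]) auto
    show "expsmall wj (\<lambda>p. offdiag (\<lambda>x' x. cnj (M x x')) (fst p) (snd p))"
      by (rule expsmall_transfer[OF M(3), of _ 1 prod.swap _ W])
         (auto dest!: near[OF disjI1] simp: near_def offdiag_def split: if_splits)
    show "expsmall wjd (\<lambda>p. cnj (M (dshift (snd p)) (dshift (fst p))) - cnj (M (snd p) (fst p)))"
    proof (rule expsmall_transfer[OF M(4), of _ 1 prod.swap _ "2 * W"])
      fix p :: "idx \<times> idx"
      assume "cnj (M (dshift (snd p)) (dshift (fst p))) - cnj (M (snd p) (fst p)) \<noteq> 0"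
      then have "near W (fst p) (snd p)" by (intro near) auto
      then show "wjd p \<le> wjd (prod.swap p) + 2 * W" by (auto simp: near_def)
    qed (simp add: cnj_norm)
    show "expsmall wj (\<lambda>p. cnj (M (jshift (snd p)) (jshift (fst p))) - cnj (M (snd p) (fst p)))"
    proof (rule expsmall_transfer[OF M(5), of _ 1 prod.swap _ "W"])
      fix p :: "idx \<times> idx"
      assume "cnj (M (jshift (snd p)) (jshift (fst p))) - cnj (M (snd p) (fst p)) \<noteq> 0"
      then have "near W (fst p) (snd p)" by (intro near) auto
      then show "wj p \<le> wj (prod.swap p) + W" by (auto simp: near_def)
    qed (simp add: cnj_norm)
  qed
qed

lemma flip_tame_adj:
  assumes "tame M" "flip_tame M"
  shows "flip_tame (\<lambda>x' x. cnj (M x x'))"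
proof -
  obtain W where M: "banded W M" using assms(1) by (rule tameE)
  show ?thesis unfolding flip_tame_def
  proof (rule expsmall_transfer[OF assms(2)[unfolded flip_tame_def], of _ 1 prod.swap _ "2 * W"])
    fix p :: "idx \<times> idx"
    show "norm (cnj (M (snd p) (flip (fst p))) - cnj (M (flip (snd p)) (fst p)))
      \<le> 1 * norm (M (flip (fst (prod.swap p))) (snd (prod.swap p)) - M (fst (prod.swap p)) (flip (snd (prod.swap p))))"
      by (simp add: norm_minus_commute flip: complex_cnj_diff)
    assume "cnj (M (snd p) (flip (fst p))) - cnj (M (flip (snd p)) (fst p)) \<noteq> 0"
    then have "M (snd p) (flip (fst p)) \<noteq> 0 \<or> M (flip (snd p)) (fst p) \<noteq> 0" by auto
    then have "near W (fst p) (snd p)"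
      using M unfolding banded_def by (metis near_shift(3,4))
    then show "wjd p \<le> wjd (prod.swap p) + 2 * W" by (auto simp: near_def)
  qed
qed

text \<open>Each difference is controlled by its two terms separately. Error terms of order r^(j +
  d) can therefore be added freely.\<close>

lemma tame_if_wjd:
  assumes "banded W M" and small: "expsmall wjd (\<lambda>p. M (fst p) (snd p))"
  shows "tame M"
proof (rule tameI[OF assms(1)])
  have j: "expsmall wj (\<lambda>p. M (fst p) (snd p))"
    using small by (rule expsmall_weaken[of _ _ _ 0]) auto
  show "expsmall (\<lambda>_. 0) (\<lambda>p. M (fst p) (snd p))"
    using small by (rule expsmall_weaken) auto
  show "expsmall wj (\<lambda>p. offdiag M (fst p) (snd p))"
    using j by (rule expsmall_transfer[of _ _ _ 1 "\<lambda>x. x" _ 0]) (auto simp: offdiag_def)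
  have minus: "expsmall w (\<lambda>p. - M (fst p) (snd p))" if "expsmall w (\<lambda>p. M (fst p) (snd p))" for w
    using that by (rule expsmall_transfer[of _ _ _ 1 "\<lambda>x. x" _ 0]) auto
  have "expsmall wjd (\<lambda>p. M (dshift (fst p)) (dshift (snd p)))"
    by (rule expsmall_transfer[OF small, of _ 1 "\<lambda>p. (dshift (fst p), dshift (snd p))" _ 0]) auto
  from expsmall_add[OF this minus[OF small]]
  show "expsmall wjd (\<lambda>p. M (dshift (fst p)) (dshift (snd p)) - M (fst p) (snd p))" by simp
  have "expsmall wj (\<lambda>p. M (jshift (fst p)) (jshift (snd p)))"
    by (rule expsmall_transfer[OF j, of _ 1 "\<lambda>p. (jshift (fst p), jshift (snd p))" _ 0]) auto
  from expsmall_add[OF this minus[OF j]]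
  show "expsmall wj (\<lambda>p. M (jshift (fst p)) (jshift (snd p)) - M (fst p) (snd p))" by simp
qed

section \<open>Products of tame matrices\<close>

text \<open>Summing over the support of a column of N avoids any choice of band width; for banded N
  every sufficiently large neighbourhood of the column gives the same sum.\<close>

definition mmult :: "mat \<Rightarrow> mat \<Rightarrow> mat" where
  "mmult M N x' x = (\<Sum>y | N y x \<noteq> 0. M x' y * N y x)"

lemma mmult_nbhd:
  assumes "banded W N" "W \<le> W'"
  shows "mmult M N x' x = (\<Sum>y\<in>nbhd W' x. M x' y * N y x)"
  unfolding mmult_def
  by (rule sum.mono_neutral_left)
     (use banded_mono[OF assms] finite_card_nbhd(1) in \<open>auto simp: nbhd_def banded_def simp del: split_paired_All\<close>)

text \<open>A discrete Leibniz rule: neighbours of S x in the range of S pair with the neighbours of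
  x, and those outside the range form the boundary term.\<close>

lemma mmult_shift_diff:
  assumes "banded W N" "inj S" and near: "\<And>x y. near W (S x) (S y) = near W x y"
  shows "mmult M N (S x') (S x) - mmult M N x' x =
    (\<Sum>y\<in>nbhd W x. (M (S x') (S y) - M x' y) * N (S y) (S x) + M x' y * (N (S y) (S x) - N y x))
    + (\<Sum>y\<in>nbhd W (S x) - range S. M (S x') y * N y (S x))"
proof -
  have split: "nbhd W (S x) = S ` nbhd W x \<union> (nbhd W (S x) - range S)"
    by (auto simp: nbhd_def near)
  have "mmult M N (S x') (S x) = (\<Sum>y\<in>nbhd W (S x). M (S x') y * N y (S x))"
    by (rule mmult_nbhd[OF assms(1)]) simp
  also have "\<dots> = (\<Sum>y\<in>S ` nbhd W x. M (S x') y * N y (S x))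
      + (\<Sum>y\<in>nbhd W (S x) - range S. M (S x') y * N y (S x))"
    by (subst split, rule sum.union_disjoint) (auto simp: finite_card_nbhd)
  also have "(\<Sum>y\<in>S ` nbhd W x. M (S x') y * N y (S x)) = (\<Sum>y\<in>nbhd W x. M (S x') (S y) * N (S y) (S x))"
    using assms(2) by (subst sum.reindex) (auto intro: inj_on_subset)
  finally show ?thesis
    using mmult_nbhd[OF assms(1) order_refl, of M x' x]
    by (simp add: algebra_simps sum.distrib sum_subtractf)
qed

lemma inj_shift: "inj dshift" "inj jshift"
  by (auto simp: inj_def dshift_def jshift_def prod_eq_iff)

lemma not_range_shift: "y \<notin> range dshift \<Longrightarrow> dpos y < 2" "y \<notin> range jshift \<Longrightarrow> jpos y < 2"
proof -
  show "dpos y < 2" if "y \<notin> range dshift"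
  proof (rule ccontr)
    assume "\<not> dpos y < 2"
    then have "y = dshift (jpos y, dpos y - 2, snd (snd y))" by (simp add: dshift_def prod_eq_iff)
    with that show False by blast
  qed
  show "jpos y < 2" if "y \<notin> range jshift"
  proof (rule ccontr)
    assume "\<not> jpos y < 2"
    then have "y = jshift (jpos y - 2, dpos y, snd (snd y))" by (simp add: jshift_def prod_eq_iff)
    with that show False by blast
  qed
qed

lemma banded_mmult:
  assumes "banded V M" "banded W N"
  shows "banded (V + W) (mmult M N)"
  unfolding banded_def
proof (intro allI impI)
  fix x' x assume "mmult M N x' x \<noteq> 0"
  then obtain y where "M x' y * N y x \<noteq> 0"
    unfolding mmult_def by (rule sum.not_neutral_contains_not_neutral)
  then have "near V y x'" "near W x y" using assms by (auto simp: banded_def simp del: split_paired_All)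
  then show "near (V + W) x x'" using near_trans[of W x y V x'] by (simp add: add.commute)
qed

text \<open>The shifted product has extra paths through the boundary of the quadrant. At \<open>dpos < 2\<close> they
  use an entry that changes \<open>dpos\<close>, which is why \<open>tame\<close> asks these entries to decay in \<open>jpos\<close>.\<close>

lemma tame_mmult:
  assumes "tame M" "tame N"
  shows "tame (mmult M N)"
proof -
  obtain V where "banded V M"
    using assms(1) by (rule tameE)
  note M = this tameD[OF assms(1)]
  obtain W where "banded W N"
    using assms(2) by (rule tameE)
  note N = this tameD[OF assms(2)]
  have re: "expsmall (\<lambda>q. w (f q)) (\<lambda>q. g (f q))" if "expsmall w g"
    for w :: "idx \<times> idx \<Rightarrow> nat" and g :: "idx \<times> idx \<Rightarrow> complex" and f :: "(idx \<times> idx) \<times> idx \<Rightarrow> idx \<times> idx"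
    by (rule expsmall_reindex[OF that])
  define n where "n = (2 * W + 1) * ((2 * W + 1) * 2)"
  have near_N: "near W x y" if "N y x \<noteq> 0 \<or> N (dshift y) (dshift x) \<noteq> 0 \<or> N (jshift y) (jshift x) \<noteq> 0" for x y
    using N(1) that unfolding banded_def by (metis near_shift(1,2))
  have card: "card (nbhd W x) \<le> n" "card (nbhd W x - A) \<le> n" for x A
    using finite_card_nbhd[of W x] card_mono[OF finite_card_nbhd(1), of "nbhd W x - A" W x]
    unfolding n_def by auto
  have inner: "expsmall v (\<lambda>p. \<Sum>y\<in>nbhd W (snd p). f (p, y))" if "expsmall (\<lambda>q. v (fst q)) f"
    for v and f :: "(idx \<times> idx) \<times> idx \<Rightarrow> complex"
    by (rule expsmall_sum[OF that card(1), of _ _ 0]) simp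
  note M2 = re[OF M(2), of "\<lambda>q. (fst (fst q), snd q)", simplified]
  note N2 = re[OF N(2), of "\<lambda>q. (snd q, snd (fst q))", simplified]
  show ?thesis
  proof (rule tameI)
    show "banded (V + W) (mmult M N)" by (rule banded_mmult[OF M(1) N(1)])
    have "expsmall (\<lambda>_. 0) (\<lambda>q. M (fst (fst q)) (snd q) * N (snd q) (snd (fst q)))"
      by (rule expsmall_bounded_mult(1)[OF M2 N2])
    from expsmall_sum[OF this, of "\<lambda>p. nbhd W (snd p)" n "\<lambda>_. 0" 0]
    show "expsmall (\<lambda>_. 0) (\<lambda>p. mmult M N (fst p) (snd p))"
      by (simp add: mmult_nbhd[OF N(1) order_refl] card)
    show "expsmall wj (\<lambda>p. offdiag (mmult M N) (fst p) (snd p))"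
    proof -
      have near: "jpos (snd (fst q)) \<le> jpos (snd q) + W" if "N (snd q) (snd (fst q)) \<noteq> 0" for q :: "(idx \<times> idx) \<times> idx"
        using N(1) that unfolding banded_def near_def by blast
      have 1: "expsmall (\<lambda>q. jpos (snd (fst q))) (\<lambda>q. offdiag M (fst (fst q)) (snd q) * N (snd q) (snd (fst q)))"
        using expsmall_bounded_mult(2)[OF re[OF M(3), of "\<lambda>q. (fst (fst q), snd q)", simplified] N2]
        by (rule expsmall_weaken[of _ _ _ W]) (use near in auto)
      have 2: "expsmall (\<lambda>q. jpos (snd (fst q))) (\<lambda>q. M (fst (fst q)) (snd q) * offdiag N (snd q) (snd (fst q)))"
        using expsmall_bounded_mult(1)[OF M2 re[OF N(3), of "\<lambda>q. (snd q, snd (fst q))", simplified]] .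
      \<comment> \<open>If d changes along a path of two steps, it changes in at least one of them,
        and the entry of that step is off the d-diagonal.\<close>
      have "expsmall (\<lambda>q. jpos (snd (fst q))) (\<lambda>q. if dpos (fst (fst q)) = dpos (snd (fst q)) then 0
          else M (fst (fst q)) (snd q) * N (snd q) (snd (fst q)))"
        by (rule expsmall_le_add[OF 1 2]) (auto simp: offdiag_def)
      from expsmall_sum[OF this, of "\<lambda>p. nbhd W (snd p)" n wj 0]
      have "expsmall wj (\<lambda>p. \<Sum>y\<in>nbhd W (snd p). if dpos (fst p) = dpos (snd p) then 0 else M (fst p) y * N y (snd p))"
        by (simp add: card cong: if_cong)
      then show ?thesis
        by (rule back_subst[of "expsmall _"]) (auto simp: offdiag_def mmult_nbhd[OF N(1) order_refl])
    qed
    show "expsmall wjd (\<lambda>p. mmult M N (dshift (fst p)) (dshift (snd p)) - mmult M N (fst p) (snd p))"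
    proof -
      have 1: "expsmall (\<lambda>q. wjd (fst q)) (\<lambda>q. (M (dshift (fst (fst q))) (dshift (snd q)) - M (fst (fst q)) (snd q))
          * N (dshift (snd q)) (dshift (snd (fst q))))"
        using expsmall_bounded_mult(2)[OF re[OF M(4), of "\<lambda>q. (fst (fst q), snd q)", simplified]
            re[OF N(2), of "\<lambda>q. (dshift (snd q), dshift (snd (fst q)))", simplified]]
        by (rule expsmall_weaken[of _ _ _ "2 * W"])
           (use near_N in \<open>force simp: near_def\<close>)
      have 2: "expsmall (\<lambda>q. wjd (fst q)) (\<lambda>q. M (fst (fst q)) (snd q)
          * (N (dshift (snd q)) (dshift (snd (fst q))) - N (snd q) (snd (fst q))))"
        using expsmall_bounded_mult(1)[OF M2 re[OF N(4), of "\<lambda>q. (snd q, snd (fst q))", simplified]] .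
      have 3: "expsmall (\<lambda>q. wj (fst q)) (\<lambda>q. M (dshift (fst (fst q))) (snd q) * offdiag N (snd q) (dshift (snd (fst q))))"
        using expsmall_bounded_mult(1)[OF re[OF M(2), of "\<lambda>q. (dshift (fst (fst q)), snd q)", simplified]
           re[OF N(3), of "\<lambda>q. (snd q, dshift (snd (fst q)))", simplified]] by simp
      have eq: "(\<Sum>y\<in>nbhd W (dshift x) - range dshift. M x' y * N y (dshift x))
         = (\<Sum>y\<in>nbhd W (dshift x) - range dshift. M x' y * offdiag N y (dshift x))" for x x'
        using not_range_shift(1) by (intro sum.cong HOL.refl) (fastforce simp: offdiag_def)
      \<comment> \<open>Such y has d < 2 and lies within W of the shifted column, so d is at most W
        at the column and decay in j already is decay in j + d.\<close>
      have boundary: "expsmall wjd (\<lambda>p. \<Sum>y\<in>nbhd W (dshift (snd p)) - range dshift. f (p, y))"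
        if "expsmall (\<lambda>q. wj (fst q)) f" for f :: "(idx \<times> idx) \<times> idx \<Rightarrow> complex"
      proof (rule expsmall_sum[OF that card(2)])
        fix p :: "idx \<times> idx" and y assume "y \<in> nbhd W (dshift (snd p)) - range dshift"
        then show "wjd p \<le> wj (fst (p, y)) + W"
          using not_range_shift(1)[of y] by (auto simp: nbhd_def near_def)
      qed
      show ?thesis
        unfolding mmult_shift_diff[OF N(1) inj_shift(1) near_shift(1)] eq
        using expsmall_add[OF inner[OF expsmall_add[OF 1 2]] boundary[OF 3]] by simp
    qed
    show "expsmall wj (\<lambda>p. mmult M N (jshift (fst p)) (jshift (snd p)) - mmult M N (fst p) (snd p))"
    proof -
      have 1: "expsmall (\<lambda>q. wj (fst q)) (\<lambda>q. (M (jshift (fst (fst q))) (jshift (snd q)) - M (fst (fst q)) (snd q))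
          * N (jshift (snd q)) (jshift (snd (fst q))))"
        using expsmall_bounded_mult(2)[OF re[OF M(5), of "\<lambda>q. (fst (fst q), snd q)", simplified]
            re[OF N(2), of "\<lambda>q. (jshift (snd q), jshift (snd (fst q)))", simplified]]
        by (rule expsmall_weaken[of _ _ _ "2 * W"])
           (use near_N in \<open>force simp: near_def\<close>)
      have 2: "expsmall (\<lambda>q. wj (fst q)) (\<lambda>q. M (fst (fst q)) (snd q)
          * (N (jshift (snd q)) (jshift (snd (fst q))) - N (snd q) (snd (fst q))))"
        using expsmall_bounded_mult(1)[OF M2 re[OF N(5), of "\<lambda>q. (snd q, snd (fst q))", simplified]] .
      have 3: "expsmall (\<lambda>q. 0) (\<lambda>q. M (jshift (fst (fst q))) (snd q) * N (snd q) (jshift (snd (fst q))))"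
        using expsmall_bounded_mult(1)[OF re[OF M(2), of "\<lambda>q. (jshift (fst (fst q)), snd q)", simplified]
           re[OF N(2), of "\<lambda>q. (snd q, jshift (snd (fst q)))", simplified]] by simp
      \<comment> \<open>Here j is at most W at the column, so a bounded family is already small in
        j.\<close>
      have boundary: "expsmall wj (\<lambda>p. \<Sum>y\<in>nbhd W (jshift (snd p)) - range jshift. f (p, y))"
        if "expsmall (\<lambda>_. 0) f" for f :: "(idx \<times> idx) \<times> idx \<Rightarrow> complex"
      proof (rule expsmall_sum[OF that card(2)])
        fix p :: "idx \<times> idx" and y assume "y \<in> nbhd W (jshift (snd p)) - range jshift"
        then show "wj p \<le> 0 + W"
          using not_range_shift(2)[of y] by (auto simp: nbhd_def near_def)
      qed
      show ?thesis
        unfolding mmult_shift_diff[OF N(1) inj_shift(2) near_shift(2)]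
        using expsmall_add[OF inner[OF expsmall_add[OF 1 2]] boundary[OF 3]] by simp
    qed
  qed
qed

text \<open>The Leibniz rule for commutators with F; replacing the summation index by its flip maps
  the neighbourhood of the flipped column onto that of the column.\<close>

lemma flip_tame_mmult:
  assumes "tame M" "tame N" "flip_tame M" "flip_tame N"
  shows "flip_tame (mmult M N)"
proof -
  have M: "expsmall (\<lambda>_. 0) (\<lambda>p. M (fst p) (snd p))"
    using assms(1) by (rule tameE)
  obtain W where "banded W N"
    using assms(2) by (rule tameE)
  note N = this tameD[OF assms(2)]
  have re: "expsmall (\<lambda>q. w (f q)) (\<lambda>q. g (f q))" if "expsmall w g"
    for w :: "idx \<times> idx \<Rightarrow> nat" and g :: "idx \<times> idx \<Rightarrow> complex" and f :: "(idx \<times> idx) \<times> idx \<Rightarrow> idx \<times> idx"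
    by (rule expsmall_reindex[OF that])
  have near_N: "near W x y" if "N y x \<noteq> 0" for x y
    using N(1) that unfolding banded_def by blast
  have nb: "nbhd W (flip x) = flip ` nbhd W x" for x
  proof (intro equalityI subsetI)
    fix y assume "y \<in> nbhd W (flip x)"
    then have "flip y \<in> nbhd W x" by (simp add: nbhd_def)
    then show "y \<in> flip ` nbhd W x" using flip_flip[of y] by (metis image_eqI)
  qed (auto simp: nbhd_def)
  have "mmult M N (flip x') x - mmult M N x' (flip x)
     = (\<Sum>y\<in>nbhd W x. (M (flip x') y - M x' (flip y)) * N y x + M x' (flip y) * (N (flip (flip y)) x - N (flip y) (flip x)))" for x' x
  proof -
    have "mmult M N x' (flip x) = (\<Sum>y\<in>nbhd W x. M x' (flip y) * N (flip y) (flip x))"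
      unfolding mmult_nbhd[OF N(1) order_refl] nb
      by (subst sum.reindex) (auto intro!: inj_on_inverseI[of _ flip])
    then show ?thesis
      by (simp add: mmult_nbhd[OF N(1) order_refl] algebra_simps sum.distrib sum_subtractf)
  qed
  note eq = this
  have 1: "expsmall (\<lambda>q. wjd (fst q)) (\<lambda>q. (M (flip (fst (fst q))) (snd q) - M (fst (fst q)) (flip (snd q))) * N (snd q) (snd (fst q)))"
    using expsmall_bounded_mult(2)[OF re[OF assms(3)[unfolded flip_tame_def], of "\<lambda>q. (fst (fst q), snd q)", simplified]
          re[OF N(2), of "\<lambda>q. (snd q, snd (fst q))", simplified]]
    by (rule expsmall_weaken[of _ _ _ "2 * W"]) (use near_N in \<open>force simp: near_def\<close>)
  have 2: "expsmall (\<lambda>q. wjd (fst q)) (\<lambda>q. M (fst (fst q)) (flip (snd q)) * (N (flip (flip (snd q))) (snd (fst q)) - N (flip (snd q)) (flip (snd (fst q)))))"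
    using expsmall_bounded_mult(1)[OF re[OF M, of "\<lambda>q. (fst (fst q), flip (snd q))", simplified]
        re[OF assms(4)[unfolded flip_tame_def], of "\<lambda>q. (flip (snd q), snd (fst q))", simplified]] by simp
  show ?thesis
    unfolding flip_tame_def eq
    using expsmall_sum[OF expsmall_add[OF 1 2], of "\<lambda>p. nbhd W (snd p)" "(2 * W + 1) * ((2 * W + 1) * 2)" wjd 0, OF finite_card_nbhd(2)]
    by simp
qed

section \<open>Matrices of commutators with |D| and D\<close>

text \<open>The eigenvalue l + 1/2 of |D|, as l = (j + d) / 2.\<close>

definition weight :: "idx \<Rightarrow> real" where "weight x = (real (jpos x + dpos x) + 1) / 2"

text \<open>The matrix of [|D|, a] if M is the matrix of a.\<close>

definition comm_weight :: "mat \<Rightarrow> mat" where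
  "comm_weight M x' x = of_real (weight x' - weight x) * M x' x"

text \<open>The matrix of [D, a] if M is the matrix of a: D multiplies by the eigenvalue of |D| and
  exchanges the signs.\<close>

definition comm_weight_flip :: "mat \<Rightarrow> mat" where
  "comm_weight_flip M x' x = of_real (weight x') * M (flip x') x - of_real (weight x) * M x' (flip x)"

lemma weight_near: "near W x x' \<Longrightarrow> \<bar>weight x' - weight x\<bar> \<le> real W"
  by (auto simp: near_def weight_def abs_le_iff field_simps)

lemma weight_simps [simp]:
  "weight (dshift x) = weight x + 1" "weight (jshift x) = weight x + 1" "weight (flip x) = weight x"
  by (simp_all add: weight_def)

text \<open>The difference of two eigenvalues of |D| is invariant under both shifts and bounded on
  the band.\<close>

lemma tame_comm_weight: "tame M \<Longrightarrow> tame (comm_weight M)"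
  unfolding comm_weight_def
  by (rule tame_shift_invariant_factor)
     (auto intro!: weight_near exI simp del: of_real_diff simp: norm_of_real)

lemma tame_flip:
  assumes "tame M"
  shows "tame (\<lambda>x' x. M (flip x') x)"
proof -
  obtain W where "banded W M"
    using assms by (rule tameE)
  note M = this tameD[OF assms]
  have comm: "flip (dshift x) = dshift (flip x)" "flip (jshift x) = jshift (flip x)" for x
    by (simp_all add: flip_def dshift_def jshift_def)
  have re: "expsmall w g \<Longrightarrow> expsmall (\<lambda>p. w (flip (fst p), snd p)) (\<lambda>p. g (flip (fst p), snd p))"
    for w :: "idx \<times> idx \<Rightarrow> nat" and g :: "idx \<times> idx \<Rightarrow> complex"
    by (rule expsmall_reindex)
  show ?thesis
  proof (rule tameI[of W])
    show "banded W (\<lambda>x' x. M (flip x') x)"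
      using M(1) unfolding banded_def by (metis near_shift(4))
  qed (use M(2-5)[THEN re] in \<open>simp_all add: comm offdiag_def cong: if_cong\<close>)
qed

text \<open>[D, a] = [|D|, F a] + [F, a] |D|. In the last term an entry of order r^(j + d) meets an
  eigenvalue linear in j + d, so the product is still exponentially small.\<close>

lemma tame_comm_weight_flip:
  assumes "tame M" "flip_tame M"
  shows "tame (comm_weight_flip M)"
proof -
  obtain W where M: "banded W M" using assms(1) by (rule tameE)
  let ?R = "\<lambda>x' x. of_real (weight x) * (M (flip x') x - M x' (flip x))"
  have "tame ?R"
  proof (rule tame_if_wjd)
    show "banded W ?R"
      using M unfolding banded_def by (metis diff_self mult_zero_right near_shift(3,4))
    show "expsmall wjd (\<lambda>p. of_real (weight (snd p)) * (M (flip (fst p)) (snd p) - M (fst p) (flip (snd p))))"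
      using assms(2) unfolding flip_tame_def
      by (rule expsmall_linear[of _ _ _ 1])
         (auto simp: norm_mult weight_def simp del: of_real_add of_real_divide intro!: mult_right_mono)
  qed
  from tame_add[OF tame_comm_weight[OF tame_flip[OF assms(1)]] this]
  show ?thesis
    unfolding comm_weight_def comm_weight_flip_def
    by (rule back_subst[of tame]) (auto simp: algebra_simps)
qed

section \<open>Traces over the eigenspaces of the Dirac operator\<close>

lemma expsmall_differences_imp_limit:
  fixes u :: "nat \<Rightarrow> complex"
  assumes "expsmall (\<lambda>k. k) (\<lambda>k. u (Suc k) - u k)"
  obtains L where "expsmall (\<lambda>k. k) (\<lambda>k. u k - L)"
proof -
  obtain K r where *: "0 < K" "0 < r" "r < 1" "\<And>k. norm (u (Suc k) - u k) \<le> K * r ^ k"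
    using assms by (rule expsmallE) blast
  have geo: "summable (\<lambda>i. K * r ^ i)"
    using * by (intro summable_mult summable_geometric) auto
  have sd: "summable (\<lambda>k. u (Suc k) - u k)"
    by (rule summable_comparison_test'[OF geo]) (rule *(4))
  define L where "L = u 0 + (\<Sum>k. u (Suc k) - u k)"
  have "(\<lambda>n. \<Sum>k<n. u (Suc k) - u k) \<longlonglongrightarrow> (\<Sum>k. u (Suc k) - u k)"
    using sd by (rule summable_LIMSEQ)
  then have "(\<lambda>n. u n - u 0) \<longlonglongrightarrow> L - u 0"
    by (simp add: L_def sum_lessThan_telescope)
  from tendsto_add[OF this tendsto_const[of "u 0"]] have lim: "u \<longlonglongrightarrow> L" by simp
  have "norm (u k - L) \<le> (K / (1 - r)) * r ^ k" for k
  proof -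
    have "(\<lambda>i. u (i + k)) \<longlonglongrightarrow> L" using lim by (rule LIMSEQ_ignore_initial_segment)
    from telescope_sums[OF this]
    have "(\<lambda>i. u (Suc i + k) - u (i + k)) sums (L - u k)" by simp
    moreover have "norm (\<Sum>i. u (Suc i + k) - u (i + k)) \<le> (\<Sum>i. K * r ^ (i + k))"
      by (intro norm_suminf_le) (use *(4)[of "_ + k"] summable_ignore_initial_segment[OF geo, of k] in auto)
    moreover have "(\<Sum>i. K * r ^ (i + k)) = (K / (1 - r)) * r ^ k"
    proof -
      have "(\<lambda>i. (K * r ^ k) * r ^ i) sums ((K * r ^ k) * (1 / (1 - r)))"
        using * by (intro sums_mult geometric_sums) auto
      then show ?thesis by (simp add: sums_iff power_add mult_ac)
    qed
    ultimately show ?thesis by (simp add: sums_iff norm_minus_commute)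
  qed
  from expsmallI[OF *(2,3) this] show thesis by (rule that)
qed

text \<open>Two summations of exponentially small second differences. The linear term is written
  with k + 1 because this is the eigenvalue of |D| that enters the Dirichlet series.\<close>

lemma expsmall_second_differences:
  fixes u :: "nat \<Rightarrow> complex"
  assumes "expsmall (\<lambda>k. k) (\<lambda>k. (u (Suc (Suc k)) - u (Suc k)) - (u (Suc k) - u k))"
  obtains \<alpha> \<beta> where "expsmall (\<lambda>k. k) (\<lambda>k. u k - (\<alpha> * of_nat (Suc k) + \<beta>))"
proof -
  obtain \<alpha> where "expsmall (\<lambda>k. k) (\<lambda>k. u (Suc k) - u k - \<alpha>)"
    using expsmall_differences_imp_limit[OF assms] by blast
  then have "expsmall (\<lambda>k. k) (\<lambda>k. (u (Suc k) - \<alpha> * of_nat (Suc (Suc k))) - (u k - \<alpha> * of_nat (Suc k)))"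
    by (simp add: algebra_simps)
  from expsmall_differences_imp_limit[OF this] obtain \<beta> where
    "expsmall (\<lambda>k. k) (\<lambda>k. u k - \<alpha> * of_nat (Suc k) - \<beta>)" by blast
  then show thesis by (intro that[of \<alpha> \<beta>]) (simp add: algebra_simps)
qed

text \<open>j + d = 2 k + 1 means l = k + 1/2, that is, eigenvalue k + 1 of |D|; the inner sum runs
  over the two signs.\<close>

definition shell_trace :: "mat \<Rightarrow> nat \<Rightarrow> complex" where
  "shell_trace M k = (\<Sum>j\<le>2 * k + 1. \<Sum>s\<in>UNIV. M (j, 2 * k + 1 - j, s) (j, 2 * k + 1 - j, s))"

text \<open>A step of 2 in d carries one shell onto the next except for the two positions with d = 1
  and d = 0. In the proof \<open>A\<close> collects the changes of the 2 k + 2 moved terms, each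
  O(r^(2 k + 1)), and \<open>B\<close> the two new terms, which converge because d is fixed and j
  grows. So the second differences of the shell traces are exponentially small.\<close>

lemma tame_shell_trace:
  assumes "tame M"
  obtains \<alpha> \<beta> where "expsmall (\<lambda>k. k) (\<lambda>k. shell_trace M k - (\<alpha> * of_nat (Suc k) + \<beta>))"
proof -
  have M: "expsmall wjd (\<lambda>p. M (dshift (fst p)) (dshift (snd p)) - M (fst p) (snd p))"
    "expsmall wj (\<lambda>p. M (jshift (fst p)) (jshift (snd p)) - M (fst p) (snd p))"
    using assms unfolding tame_def by blast+
  define t where "t = (\<lambda>j d. \<Sum>s\<in>UNIV. M (j, d, s) (j, d, s))"
  have D: "expsmall (\<lambda>(j, d). j + d) (\<lambda>(j, d). t j (d + 2) - t j d)"
  proof -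
    have "expsmall (\<lambda>(j, d). j + d) (\<lambda>(j, d). M (j, d + 2, s) (j, d + 2, s) - M (j, d, s) (j, d, s))" for s
      using expsmall_reindex[OF M(1), of "\<lambda>q. ((fst q, snd q, s), (fst q, snd q, s))"]
      by (simp add: dshift_def case_prod_unfold)
    from expsmall_add[OF this[of True] this[of False]] show ?thesis
      by (rule back_subst[of "expsmall _"]) (auto simp: t_def UNIV_bool)
  qed
  have J: "expsmall (\<lambda>(j, d). j) (\<lambda>(j, d). t (j + 2) d - t j d)"
  proof -
    have "expsmall (\<lambda>(j, d). j) (\<lambda>(j, d). M (j + 2, d, s) (j + 2, d, s) - M (j, d, s) (j, d, s))" for s
      using expsmall_reindex[OF M(2), of "\<lambda>q. ((fst q, snd q, s), (fst q, snd q, s))"]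
      by (simp add: jshift_def case_prod_unfold)
    from expsmall_add[OF this[of True] this[of False]] show ?thesis
      by (rule back_subst[of "expsmall _"]) (auto simp: t_def UNIV_bool)
  qed
  define A where "A = (\<lambda>k. \<Sum>j\<le>2 * k + 1. t j (2 * k + 1 - j + 2) - t j (2 * k + 1 - j))"
  define B where "B = (\<lambda>k. t (2 * k + 2) 1 + t (2 * k + 3) 0)"
  have diff: "shell_trace M (Suc k) - shell_trace M k = A k + B k" for k
  proof -
    have "shell_trace M (Suc k) = (\<Sum>j\<le>Suc (Suc (2 * k + 1)). t j (2 * k + 3 - j))"
      unfolding shell_trace_def t_def by (rule sum.cong) (auto simp: eval_nat_numeral)
    also have "\<dots> = (\<Sum>j\<le>2 * k + 1. t j (2 * k + 3 - j)) + B k"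
      unfolding sum.atMost_Suc by (simp add: B_def eval_nat_numeral)
    also have "(\<Sum>j\<le>2 * k + 1. t j (2 * k + 3 - j)) = (\<Sum>j\<le>2 * k + 1. t j (2 * k + 1 - j + 2))"
      by (intro sum.cong HOL.refl) (auto intro: arg_cong)
    finally have "shell_trace M (Suc k) = (\<Sum>j\<le>2 * k + 1. t j (2 * k + 1 - j + 2)) + B k" .
    moreover have "shell_trace M k = (\<Sum>j\<le>2 * k + 1. t j (2 * k + 1 - j))"
      by (simp only: shell_trace_def t_def)
    ultimately show ?thesis
      by (simp only: A_def sum_subtractf diff_add_eq)
  qed
  have "expsmall (\<lambda>k. k) A"
  proof -
    obtain K r where *: "0 < K" "0 < r" "r < 1" "\<And>q. norm ((\<lambda>(j, d). t j (d + 2) - t j d) q) \<le> K * r ^ (\<lambda>(j, d). j + d) q"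
      using D by (rule expsmallE) blast
    have "norm (A k) \<le> (4 * K * r) * (real k + 1) * norm (r ^ k)" for k
    proof -
      have "norm (A k) \<le> (\<Sum>j\<le>2 * k + 1. K * r ^ (2 * k + 1))"
        unfolding A_def
      proof (rule sum_norm_le)
        fix j assume "j \<in> {..2 * k + 1}"
        then show "norm (t j (2 * k + 1 - j + 2) - t j (2 * k + 1 - j)) \<le> K * r ^ (2 * k + 1)"
          using *(4)[of "(j, 2 * k + 1 - j)"] by simp
      qed
      also have "\<dots> = (2 * K * r) * (real k + 1) * r ^ (2 * k)" by (simp add: algebra_simps)
      also have "\<dots> \<le> (4 * K * r) * (real k + 1) * r ^ k"
        using * by (intro mult_mono power_decreasing) auto
      finally show ?thesis using * by simp
    qed
    note A_le = this
    have "expsmall (\<lambda>k. k) (\<lambda>k. r ^ k)"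
      by (rule expsmallI[of r _ 1]) (use * in auto)
    from expsmall_linear[OF this A_le] show ?thesis using * by simp
  qed
  then have A: "expsmall (\<lambda>k. k) (\<lambda>k. A (Suc k) - A k)"
  proof -
    assume A: "expsmall (\<lambda>k. k) A"
    have "expsmall (\<lambda>k. k) (\<lambda>k. A (Suc k))"
      by (rule expsmall_transfer[OF A, of _ 1 Suc _ 0]) auto
    then show ?thesis by (rule expsmall_le_add[OF _ A]) (rule norm_triangle_ineq4)
  qed
  have B: "expsmall (\<lambda>k. k) (\<lambda>k. B (Suc k) - B k)"
  proof -
    have 1: "expsmall (\<lambda>k. k) (\<lambda>k. t (2 * k + 2 + 2) 1 - t (2 * k + 2) 1)"
      by (rule expsmall_transfer[OF J, of _ 1 "\<lambda>k. (2 * k + 2, 1)" _ 0]) auto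
    have 2: "expsmall (\<lambda>k. k) (\<lambda>k. t (2 * k + 3 + 2) 0 - t (2 * k + 3) 0)"
      by (rule expsmall_transfer[OF J, of _ 1 "\<lambda>k. (2 * k + 3, 0)" _ 0]) auto
    from expsmall_add[OF 1 2] show ?thesis
      by (rule back_subst[of "expsmall _"]) (auto simp: B_def eval_nat_numeral)
  qed
  have "expsmall (\<lambda>k. k) (\<lambda>k. (A (Suc k) + B (Suc k)) - (A k + B k))"
    using expsmall_add[OF A B] by (rule back_subst[of "expsmall _"]) auto
  then show thesis
    using expsmall_second_differences[of "shell_trace M"] that unfolding diff[symmetric] by blast
qed

lemma expsmall_imp_tendsto_0:
  assumes "expsmall (\<lambda>k. k) (u :: nat \<Rightarrow> 'a::real_normed_vector)"
  shows "u \<longlonglongrightarrow> 0"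
proof -
  obtain K r where *: "0 < K" "0 < r" "r < 1" "\<And>k. norm (u k) \<le> K * r ^ k"
    using assms by (rule expsmallE) blast
  have "(\<lambda>k. K * r ^ k) \<longlonglongrightarrow> 0"
    using tendsto_mult[OF tendsto_const[of K] LIMSEQ_realpow_zero[of r]] * by simp
  then show ?thesis
    by (rule Lim_null_comparison[rotated]) (intro always_eventually allI *(4))
qed

text \<open>The shell traces are bounded by the geometric series 2 K / (1 - r), which excludes a
  linear term.\<close>

lemma shell_trace_bounded_limit:
  assumes "expsmall (\<lambda>k. k) (\<lambda>k. shell_trace M k - (\<alpha> * of_nat (Suc k) + \<beta>))"
    and small: "expsmall wj (\<lambda>p. M (fst p) (snd p))"
  shows "\<alpha> = 0" "shell_trace M \<longlonglongrightarrow> \<beta>"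
proof -
  obtain K r where *: "0 < K" "0 < r" "r < 1" "\<And>p. norm (M (fst p) (snd p)) \<le> K * r ^ wj p"
    using small by (rule expsmallE) blast
  have bound: "norm (shell_trace M k) \<le> 2 * K / (1 - r)" for k
  proof -
    have "norm (shell_trace M k) \<le> (\<Sum>j\<le>2 * k + 1. 2 * K * r ^ j)"
      unfolding shell_trace_def
    proof (rule sum_norm_le)
      fix j
      have "norm (\<Sum>s\<in>UNIV. M (j, 2 * k + 1 - j, s) (j, 2 * k + 1 - j, s)) \<le> (\<Sum>s\<in>(UNIV::bool set). K * r ^ j)"
        using *(4)[of "((j, 2 * k + 1 - j, _), (j, 2 * k + 1 - j, _))"] by (intro sum_norm_le) auto
      then show "norm (\<Sum>s\<in>UNIV. M (j, 2 * k + 1 - j, s) (j, 2 * k + 1 - j, s)) \<le> 2 * K * r ^ j" by simp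
    qed
    also have "\<dots> \<le> (\<Sum>j. 2 * K * r ^ j)"
      using * by (intro sum_le_suminf summable_mult summable_geometric) auto
    also have "\<dots> = 2 * K / (1 - r)"
      using * sums_mult[OF geometric_sums[of r], of "2 * K"] by (simp add: sums_iff)
    finally show ?thesis .
  qed
  have lim: "(\<lambda>k. shell_trace M k - (\<alpha> * of_nat (Suc k) + \<beta>)) \<longlonglongrightarrow> 0"
    by (rule expsmall_imp_tendsto_0[OF assms(1)])
  show "\<alpha> = 0"
  proof (rule ccontr)
    assume "\<alpha> \<noteq> 0"
    obtain B where B: "\<And>k. norm (shell_trace M k - (\<alpha> * of_nat (Suc k) + \<beta>)) \<le> B"
      using convergent_imp_Bseq[OF convergentI[OF lim]] by (auto simp: Bseq_def)
    have linear: "norm \<alpha> * real (Suc k) \<le> 2 * K / (1 - r) + norm \<beta> + B" for k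
    proof -
      have "norm (\<alpha> * of_nat (Suc k)) = norm (shell_trace M k - \<beta> - (shell_trace M k - (\<alpha> * of_nat (Suc k) + \<beta>)))"
        by (simp add: algebra_simps)
      also have "\<dots> \<le> norm (shell_trace M k) + norm \<beta> + norm (shell_trace M k - (\<alpha> * of_nat (Suc k) + \<beta>))"
        using norm_triangle_ineq4[of "shell_trace M k - \<beta>" "shell_trace M k - (\<alpha> * of_nat (Suc k) + \<beta>)"]
          norm_triangle_ineq4[of "shell_trace M k" \<beta>] by linarith
      finally show ?thesis
        using bound[of k] B[of k] by (simp add: norm_mult del: of_nat_Suc)
    qed
    obtain k where "(2 * K / (1 - r) + norm \<beta> + B) / norm \<alpha> < real k"
      using reals_Archimedean2 by blast
    then have "2 * K / (1 - r) + norm \<beta> + B < norm \<alpha> * real k"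
      using \<open>\<alpha> \<noteq> 0\<close> by (simp add: pos_divide_less_eq mult.commute)
    moreover have "norm \<alpha> * real k \<le> norm \<alpha> * real (Suc k)" by (intro mult_left_mono) auto
    ultimately show False using linear[of k] by linarith
  qed
  with lim have "(\<lambda>k. (shell_trace M k - \<beta>) + \<beta>) \<longlonglongrightarrow> 0 + \<beta>"
    by (intro tendsto_add tendsto_const) simp
  then show "shell_trace M \<longlonglongrightarrow> \<beta>" by simp
qed

section \<open>Dirichlet series with asymptotically linear coefficients\<close>

text \<open>Exponential decay beats every power of k + 1, so on each half plane Re z \<ge> - R a
  single geometric series dominates.\<close>

lemma entire_exponential_series:
  assumes "expsmall (\<lambda>k. k) (\<epsilon> :: nat \<Rightarrow> complex)"
  shows "summable (\<lambda>k. \<epsilon> k * of_nat (Suc k) powr (- z))"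
    and "(\<lambda>z. \<Sum>k. \<epsilon> k * of_nat (Suc k) powr (- z)) holomorphic_on UNIV"
proof -
  have pow: "expsmall (\<lambda>k. k) (\<lambda>k. of_nat (Suc k) ^ R * \<epsilon> k)" for R
  proof (induction R)
    case (Suc R)
    show ?case
      by (rule expsmall_linear[OF Suc, of _ 1]) (simp_all add: norm_mult norm_power mult_ac del: of_nat_Suc, simp add: add.commute)
  qed (use assms in simp)
  have bound: "\<exists>M. summable M \<and> (\<forall>k. \<forall>w. - Re w \<le> real R \<longrightarrow> norm (\<epsilon> k * of_nat (Suc k) powr (- w)) \<le> M k)" for R
  proof -
    obtain K r where *: "0 < K" "0 < r" "r < 1" "\<And>k. norm (of_nat (Suc k) ^ R * \<epsilon> k) \<le> K * r ^ k"
      using pow[of R] by (rule expsmallE) blast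
    have "norm (\<epsilon> k * of_nat (Suc k) powr (- w)) \<le> K * r ^ k" if "- Re w \<le> real R" for k w
    proof -
      have "real (Suc k) powr (- Re w) \<le> real (Suc k) powr real R"
        using that by (intro powr_mono) auto
      also have "\<dots> = real (Suc k) ^ R" by (rule powr_realpow) simp
      finally have "norm (\<epsilon> k) * real (Suc k) powr (- Re w) \<le> norm (\<epsilon> k) * real (Suc k) ^ R"
        by (intro mult_left_mono) auto
      also have "\<dots> \<le> K * r ^ k" using *(4)[of k] by (simp add: norm_mult norm_power mult_ac del: of_nat_Suc)
      finally show ?thesis by (simp add: norm_mult norm_of_nat_powr del: of_nat_Suc)
    qed
    then show ?thesis using * by (intro exI[of _ "\<lambda>k. K * r ^ k"]) auto
  qed
  show "summable (\<lambda>k. \<epsilon> k * of_nat (Suc k) powr (- z))"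
  proof -
    obtain R where R: "- Re z \<le> real R" using real_arch_simple by blast
    obtain M where M: "summable M" "\<And>k w. - Re w \<le> real R \<Longrightarrow> norm (\<epsilon> k * of_nat (Suc k) powr (- w)) \<le> M k"
      using bound[of R] by blast
    show ?thesis by (rule summable_comparison_test'[OF M(1) M(2)]) (rule R)
  qed
  show "(\<lambda>z. \<Sum>k. \<epsilon> k * of_nat (Suc k) powr (- z)) holomorphic_on UNIV"
  proof (rule holomorphic_on_suminf)
    show "(\<lambda>z. \<epsilon> k * of_nat (Suc k) powr (- z)) holomorphic_on UNIV" for k
      by (intro holomorphic_intros)
    fix z :: complex
    obtain R where R: "- Re z + 1 \<le> real R" using real_arch_simple by blast
    obtain M where "summable M" "\<And>k w. - Re w \<le> real R \<Longrightarrow> norm (\<epsilon> k * of_nat (Suc k) powr (- w)) \<le> M k"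
      using bound[of R] by blast
    moreover have "- Re w \<le> real R" if "dist z w \<le> 1" for w
      using R that abs_Re_le_cmod[of "z - w"] by (simp add: dist_norm)
    ultimately show "\<exists>d>0. \<exists>M. summable M \<and> (\<forall>k. \<forall>w\<in>UNIV. dist z w \<le> d \<longrightarrow> norm (\<epsilon> k * of_nat (Suc k) powr (- w)) \<le> M k)"
      by (intro exI[of _ 1]) auto
  qed simp
qed

lemma is_pole_simple_plus:
  assumes "open A" "p \<in> A" "g holomorphic_on A" "h holomorphic_on A" "g p \<noteq> 0"
  shows "is_pole (\<lambda>z. g z / (z - p) + h z) (p :: complex)"
proof -
  have "is_pole (\<lambda>z. (g z + (z - p) * h z) / (z - p) ^ 1) p"
    using assms by (intro is_pole_basic[of _ A]) (auto intro!: holomorphic_intros)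
  moreover have "\<forall>\<^sub>F z in at p. (g z + (z - p) * h z) / (z - p) ^ 1 = g z / (z - p) + h z"
    using eventually_neq_at_within[of p p UNIV] by eventually_elim (simp add: add_divide_distrib)
  ultimately show ?thesis by (subst is_pole_cong[OF _ HOL.refl]) (auto elim: eventually_mono)
qed

lemma asymptotically_linear_dirichlet_series:
  fixes u :: "nat \<Rightarrow> complex"
  assumes "expsmall (\<lambda>k. k) (\<lambda>k. u k - (\<alpha> * of_nat (Suc k) + \<beta>))"
  obtains f where "f meromorphic_on UNIV"
    "\<And>z. Re z > 2 \<Longrightarrow> (\<lambda>k. u k * of_nat (Suc k) powr (- z)) sums f z"
    "\<And>z. f analytic_on {z} \<or> z \<in> {1, 2} \<and> is_pole f z"
    "\<alpha> \<noteq> 0 \<Longrightarrow> is_pole f 2" "\<beta> \<noteq> 0 \<Longrightarrow> is_pole f 1"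
proof -
  obtain E :: "complex \<Rightarrow> complex" where E: "E holomorphic_on UNIV" "E 1 = 1"
    "\<And>s. Re s > 1 \<Longrightarrow> (\<lambda>n. of_nat (Suc n) powr (- s)) sums (E s / (s - 1))"
    by (rule riemann_zeta_continuation) blast
  define \<epsilon> where "\<epsilon> = (\<lambda>k. u k - (\<alpha> * of_nat (Suc k) + \<beta>))"
  define G where "G = (\<lambda>z. \<Sum>k. \<epsilon> k * of_nat (Suc k) powr (- z))"
  have \<epsilon>: "expsmall (\<lambda>k. k) \<epsilon>" using assms by (simp add: \<epsilon>_def)
  have G: "G holomorphic_on A" for A
    using entire_exponential_series(2)[OF \<epsilon>] unfolding G_def by (rule holomorphic_on_subset) simp
  have E': "E holomorphic_on A" for A using E(1) by (rule holomorphic_on_subset) simp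
  have E1: "(\<lambda>z. E (z - 1)) holomorphic_on A" for A
    by (rule holomorphic_on_compose[of "\<lambda>z. z - 1" A E, unfolded o_def]) (intro holomorphic_intros, rule E')
  define f where "f = (\<lambda>z. \<alpha> * E (z - 1) / (z - 2) + (\<beta> * E z / (z - 1) + G z))"
  have an: "g analytic_on A" if "\<And>B. g holomorphic_on B" for g :: "complex \<Rightarrow> complex" and A
    using that[of UNIV] analytic_on_subset[of g UNIV A] by (simp add: analytic_on_open)
  note anl = an[OF E'] an[OF E1] an[OF G]
  have sums: "(\<lambda>k. u k * of_nat (Suc k) powr (- z)) sums f z" if z: "Re z > 2" for z
  proof -
    have "(\<lambda>k. \<alpha> * of_nat (Suc k) powr (- (z - 1)) + (\<beta> * of_nat (Suc k) powr (- z) + \<epsilon> k * of_nat (Suc k) powr (- z)))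
       sums (\<alpha> * (E (z - 1) / (z - 1 - 1)) + (\<beta> * (E z / (z - 1)) + G z))"
      unfolding G_def using z
      by (intro sums_add sums_mult E(3) summable_sums entire_exponential_series(1)[OF \<epsilon>]) auto
    moreover have "of_nat (Suc k) powr (- (z - 1)) = of_nat (Suc k) * (of_nat (Suc k) powr (- z) :: complex)" for k
      using powr_add[of "of_nat (Suc k) :: complex" 1 "- z"] by (simp add: add.commute del: of_nat_Suc)
    ultimately show ?thesis by (simp add: \<epsilon>_def f_def algebra_simps)
  qed
  have p2: "is_pole f 2" if "\<alpha> \<noteq> 0"
    unfolding f_def
    by (rule is_pole_simple_plus[of "- {1}"]) (use that E(2) in \<open>auto intro!: holomorphic_intros E' E1 G\<close>)
  have p1: "is_pole f 1" if "\<beta> \<noteq> 0"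
  proof -
    have "is_pole (\<lambda>z. \<beta> * E z / (z - 1) + (\<alpha> * E (z - 1) / (z - 2) + G z)) 1"
      by (rule is_pole_simple_plus[of "- {2}"]) (use that E(2) in \<open>auto intro!: holomorphic_intros E' E1 G\<close>)
    then show ?thesis by (rule back_subst[of "\<lambda>f. is_pole f 1"]) (auto simp: f_def)
  qed
  show thesis
  proof (rule that[of f])
    show "f meromorphic_on UNIV"
      unfolding f_def by (intro meromorphic_intros analytic_on_imp_meromorphic_on anl)
    show "f analytic_on {z} \<or> z \<in> {1, 2} \<and> is_pole f z" for z
    proof -
      consider "z \<notin> {1, 2}" | "z = 1" "\<beta> \<noteq> 0" | "z = 2" "\<alpha> \<noteq> 0" | "z = 1" "\<beta> = 0" | "z = 2" "\<alpha> = 0"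
        by blast
      then show ?thesis
      proof cases
        case 1
        then show ?thesis unfolding f_def by (intro disjI1 analytic_intros anl) auto
      next
        \<comment> \<open>With \<beta> = 0 the whole quotient is 0, even at its centre, where
          division by zero yields 0; f therefore has no spurious value at that point.\<close>
        case 4
        then have "f = (\<lambda>z. \<alpha> * E (z - 1) / (z - 2) + G z)" by (simp add: f_def)
        with 4 show ?thesis by (intro disjI1) (auto intro!: analytic_intros anl)
      next
        case 5
        then have "f = (\<lambda>z. \<beta> * E z / (z - 1) + G z)" by (simp add: f_def)
        with 5 show ?thesis by (intro disjI1) (auto intro!: analytic_intros anl)
      qed (use p1 p2 in auto)
    qed
  qed (use sums p1 p2 in auto)
qed

section \<open>Operators and their matrices\<close>

definition lab :: "idx \<Rightarrow> real \<times> real \<times> real" where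
  "lab x = (real (jpos x + dpos x) / 2, (real (jpos x) - real (dpos x)) / 2, if snd (snd x) then 1/2 else - 1/2)"

definition valid :: "idx \<Rightarrow> bool" where "valid x \<longleftrightarrow> odd (jpos x + dpos x)"

definition ket :: "idx \<Rightarrow> spinor" where "ket x = (case lab x of (l, m, N) \<Rightarrow> bvec l m N)"

abbreviation cpt :: "spinor \<Rightarrow> idx \<Rightarrow> complex" where "cpt v x \<equiv> coord v (lab x)"

definition entry :: "(spinor \<Rightarrow> spinor) \<Rightarrow> mat" where "entry a x' x = cpt (a (ket x)) x'"

lemma inj_lab: "inj lab"
proof (rule injI)
  fix x y :: idx
  assume "lab x = lab y"
  then have "real (jpos x) + real (dpos x) = real (jpos y) + real (dpos y)"
    "real (jpos x) - real (dpos x) = real (jpos y) - real (dpos y)" "snd (snd x) = snd (snd y)"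
    by (auto simp: lab_def split: if_splits)
  then have "jpos x = jpos y \<and> dpos x = dpos y" by linarith
  with \<open>snd (snd x) = snd (snd y)\<close> show "x = y" by (simp add: prod_eq_iff)
qed

lemma lab_eq_iff [simp]: "lab x = lab y \<longleftrightarrow> x = y"
  using inj_lab by (auto dest: injD)

lemma labels_eq: "labels = lab ` {x. valid x}"
proof (intro equalityI subsetI)
  fix i assume "i \<in> labels"
  then obtain k j :: nat and N where i: "i = (real k + 1/2, - (real k + 1/2) + real j, N)" "j \<le> 2 * k + 1"
    "N = 1/2 \<or> N = -1/2"
    unfolding labels_def by blast
  define x :: idx where "x = (j, 2 * k + 1 - j, N = 1/2)"
  have "valid x" using i(2) by (simp add: valid_def x_def)
  moreover have "lab x = i" using i by (auto simp: lab_def x_def of_nat_diff field_simps)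
  ultimately show "i \<in> lab ` {x. valid x}" by blast
next
  fix i assume "i \<in> lab ` {x. valid x}"
  then obtain x where x: "valid x" "i = lab x" by auto
  then obtain k where k: "jpos x + dpos x = 2 * k + 1" unfolding valid_def by (metis oddE)
  have r: "real (jpos x) + real (dpos x) = 2 * real k + 1" using k by linarith
  have "real (jpos x + dpos x) / 2 = real k + 1/2" "(real (jpos x) - real (dpos x)) / 2 = - (real k + 1/2) + real (jpos x)"
    using r by (simp_all add: field_simps)
  then have "lab x = (real k + 1/2, - (real k + 1/2) + real (jpos x), if snd (snd x) then 1/2 else - 1/2)"
    by (simp only: lab_def)
  moreover have "jpos x \<le> 2 * k + 1" using k by simp
  ultimately show "i \<in> labels"
    unfolding labels_def x(2) by (auto intro!: exI[of _ k] exI[of _ "jpos x"])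
qed

lemma lab_in_labels [simp]: "lab x \<in> labels \<longleftrightarrow> valid x"
  unfolding labels_eq by auto

lemma cpt_invalid: "\<not> valid x \<Longrightarrow> cpt v x = 0"
  by (simp add: coord_outside)

lemma coord_ket: "coord (ket x) i = (if i = lab x \<and> valid x then 1 else 0)"
  unfolding ket_def by (cases "lab x") (metis bvec.rep_eq case_prod_conv lab_in_labels)

lemma cpt_ket [simp]: "cpt (ket x) y = (if y = x \<and> valid x then 1 else 0)"
  by (simp add: coord_ket)

lemma spinor_cpt_eqI: "(\<And>x. valid x \<Longrightarrow> cpt v x = cpt w x) \<Longrightarrow> v = w"
  by (rule spinor_eqI) (metis coord_outside imageE labels_eq mem_Collect_eq)

lemma ket_invalid: "\<not> valid x \<Longrightarrow> ket x = 0"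
  by (rule spinor_eqI) (simp add: coord_ket zero_spinor.rep_eq)

lemma coord_simps [simp]:
  "coord (v + w) i = coord v i + coord w i" "coord (v - w) i = coord v i - coord w i"
  "coord (scaleC c v) i = c * coord v i" "coord (0 :: spinor) i = 0" "coord (r *\<^sub>R v) i = of_real r * coord v i"
  unfolding minus_spinor_def scaleR_spinor_def
  by (simp_all add: plus_spinor.rep_eq uminus_spinor.rep_eq scaleC.rep_eq zero_spinor.rep_eq
      del: add_uminus_conv_diff)

lemma coord_sum [simp]: "coord (sum f F) i = (\<Sum>x\<in>F. coord (f x) i)"
  by (induction F rule: infinite_finite_induct) auto

lemma scaleC_simps: "scaleC c (v + w) = scaleC c v + scaleC c w" "scaleC c (v - w) = scaleC c v - scaleC c w"
  "scaleC c 0 = 0" "scaleC c (scaleC d v) = scaleC (c * d) v" "scaleC 1 v = v" "scaleC 0 v = 0"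
  "r *\<^sub>R scaleC c v = scaleC c (r *\<^sub>R v)"
  by (rule spinor_eqI, simp add: algebra_simps)+

lemma norm_has_sum: "((\<lambda>x. (cmod (cpt v x))\<^sup>2) has_sum (norm v)\<^sup>2) UNIV"
proof -
  have "inner v v = (\<Sum>\<^sub>\<infinity>i. (cmod (coord v i))\<^sup>2)"
    by (simp add: inner_spinor_def cinner_self)
  then have "((\<lambda>i. (cmod (coord v i))\<^sup>2) has_sum (norm v)\<^sup>2) UNIV"
    using has_sum_infsum[OF coord_summable[of v]] by (simp add: dot_square_norm)
  then have "((\<lambda>i. (cmod (coord v i))\<^sup>2) has_sum (norm v)\<^sup>2) (range lab)"
    by (rule has_sum_cong_neutral[THEN iffD1, rotated -1])
       (auto, metis coord_outside imageI labels_eq rangeI image_iff UNIV_I)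
  then show ?thesis
    by (subst (asm) has_sum_reindex) (auto simp: o_def inj_lab intro: inj_on_subset)
qed

lemma norm_le_if_finite_sums:
  assumes "\<And>F. finite F \<Longrightarrow> (\<Sum>x\<in>F. (cmod (cpt v x))\<^sup>2) \<le> B\<^sup>2" "0 \<le> B"
  shows "norm v \<le> B"
proof -
  have "(norm v)\<^sup>2 \<le> B\<^sup>2"
    by (rule has_sum_le_finite_sums[OF norm_has_sum]) (use assms in auto)
  then show ?thesis using assms(2) by (rule power2_le_imp_le)
qed

lemma cmod_cpt_le: "cmod (cpt v x) \<le> norm v"
proof -
  have "(\<Sum>x\<in>{x}. (cmod (cpt v x))\<^sup>2) \<le> (norm v)\<^sup>2"
    by (rule finite_sum_le_has_sum[OF norm_has_sum]) auto
  then have "(cmod (cpt v x))\<^sup>2 \<le> (norm v)\<^sup>2" by simp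
  then show ?thesis by (rule power2_le_imp_le) simp
qed

lemma bounded_linear_cpt: "bounded_linear (\<lambda>v. cpt v x)"
  by (rule bounded_linear_intro[of _ 1]) (auto simp: cmod_cpt_le scaleR_conv_of_real)

lemma norm_scaleC: "norm (scaleC c v) = cmod c * norm v"
proof -
  have "((\<lambda>x. (cmod c)\<^sup>2 * (cmod (cpt v x))\<^sup>2) has_sum (cmod c)\<^sup>2 * (norm v)\<^sup>2) UNIV"
    by (intro has_sum_cmult_right norm_has_sum)
  moreover have "((\<lambda>x. (cmod c)\<^sup>2 * (cmod (cpt v x))\<^sup>2) has_sum (norm (scaleC c v))\<^sup>2) UNIV"
    using norm_has_sum[of "scaleC c v"] by (simp add: norm_mult power_mult_distrib)
  ultimately have "(norm (scaleC c v))\<^sup>2 = (cmod c * norm v)\<^sup>2"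
    unfolding power_mult_distrib using has_sum_unique by blast
  then show ?thesis by (simp add: power2_eq_iff_nonneg)
qed

lemma bounded_linear_scaleC: "bounded_linear (scaleC c)"
  by (rule bounded_linear_intro[of _ "cmod c"]) (auto simp: scaleC_simps norm_scaleC)

lemma finite_support_approx:
  assumes "0 < e"
  obtains F where "finite F" "norm (v - (\<Sum>x\<in>F. scaleC (cpt v x) (ket x))) < e"
proof -
  obtain F where F: "finite F" "dist (\<Sum>x\<in>F. (cmod (cpt v x))\<^sup>2) ((norm v)\<^sup>2) \<le> e\<^sup>2 / 2"
    using has_sum_finite_approximation[OF norm_has_sum[of v], of "e\<^sup>2 / 2"] assms by auto
  define p where "p = (\<Sum>x\<in>F. scaleC (cpt v x) (ket x))"
  have p: "cpt p y = (if y \<in> F then cpt v y else 0)" for y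
  proof -
    have "cpt p y = (\<Sum>x\<in>F. if x = y then cpt v y else 0)"
      unfolding p_def coord_sum coord_simps
      by (intro sum.cong HOL.refl) (auto simp: cpt_invalid)
    then show ?thesis using F(1) by simp
  qed
  have "((\<lambda>x. if x \<in> F then (cmod (cpt v x))\<^sup>2 else 0) has_sum (\<Sum>x\<in>F. (cmod (cpt v x))\<^sup>2)) UNIV"
    by (rule has_sum_finite_neutralI[OF F(1)]) auto
  from has_sum_add[OF this norm_has_sum[of "v - p"]]
  have "((\<lambda>x. (cmod (cpt v x))\<^sup>2) has_sum ((\<Sum>x\<in>F. (cmod (cpt v x))\<^sup>2) + (norm (v - p))\<^sup>2)) UNIV"
    by (rule has_sum_cong[THEN iffD1, rotated]) (auto simp: p)
  then have "(norm v)\<^sup>2 = (\<Sum>x\<in>F. (cmod (cpt v x))\<^sup>2) + (norm (v - p))\<^sup>2"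
    using norm_has_sum has_sum_unique by blast
  with F(2) have "(norm (v - p))\<^sup>2 \<le> e\<^sup>2 / 2" by (simp add: dist_real_def)
  also have "\<dots> < e\<^sup>2" using assms by simp
  finally have "norm (v - p) < e" using assms by (simp add: power_less_imp_less_base)
  with F(1) show thesis by (intro that[of F]) (simp_all add: p_def)
qed

text \<open>Finite combinations of basis vectors are dense. As f is only real linear, it is tested
  on all complex multiples of them. The target space is arbitrary, so the lemma serves for
  operators, coordinates and inner products alike.\<close>

lemma bounded_linear_eq_0:
  assumes f: "bounded_linear f" and ket0: "\<And>c x. valid x \<Longrightarrow> f (scaleC c (ket x)) = 0"
  shows "f v = 0"
proof (rule ccontr)
  assume nz: "f v \<noteq> 0"
  interpret bounded_linear f by (rule f)
  obtain K where K: "K > 0" "\<And>x. norm (f x) \<le> norm x * K"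
    using pos_bounded by blast
  obtain F where F: "finite F" "norm (v - (\<Sum>x\<in>F. scaleC (cpt v x) (ket x))) < norm (f v) / K"
    using finite_support_approx[of "norm (f v) / K" v] nz K(1) by auto
  have "f (scaleC c (ket x)) = 0" for c x
    using ket0[of x c] by (cases "valid x") (simp_all add: ket_invalid scaleC_simps)
  then have "f v = f (v - (\<Sum>x\<in>F. scaleC (cpt v x) (ket x)))"
    by (simp add: diff sum)
  also have "norm \<dots> \<le> norm (v - (\<Sum>x\<in>F. scaleC (cpt v x) (ket x))) * K" by (rule K(2))
  also have "\<dots> < norm (f v)" using F(2) K(1) by (simp add: pos_less_divide_eq)
  finally show False by simp
qed

lemma bounded_opD: "bounded_op a \<Longrightarrow> bounded_linear a" "bounded_op a \<Longrightarrow> a (scaleC c v) = scaleC c (a v)"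
  unfolding bounded_op_def by auto

lemma bounded_op_ext:
  assumes "bounded_op a" "bounded_op b" "\<And>x. valid x \<Longrightarrow> a (ket x) = b (ket x)"
  shows "a = b"
proof
  fix v
  have "a v - b v = 0"
    by (rule bounded_linear_eq_0[of "\<lambda>v. a v - b v"])
       (use assms in \<open>auto simp: bounded_opD intro: bounded_linear_sub\<close>)
  then show "a v = b v" by simp
qed

lemma bounded_op_combine:
  "bounded_op id" "bounded_op (scaleC c)"
  "bounded_op a \<Longrightarrow> bounded_op b \<Longrightarrow> bounded_op (\<lambda>v. a v + b v)"
  "bounded_op a \<Longrightarrow> bounded_op (\<lambda>v. scaleC c (a v))"
  "bounded_op a \<Longrightarrow> bounded_op b \<Longrightarrow> bounded_op (a \<circ> b)"
  unfolding bounded_op_def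
  by (auto simp: scaleC_simps mult.commute id_def bounded_linear_ident bounded_linear_scaleC o_def
      intro: bounded_linear_add bounded_linear_compose[OF bounded_linear_scaleC] bounded_linear_compose)

lemma entry_invalid: "bounded_op a \<Longrightarrow> \<not> (valid x' \<and> valid x) \<Longrightarrow> entry a x' x = 0"
  using bounded_linear.linear[OF bounded_opD(1), of a]
  by (auto simp: entry_def cpt_invalid ket_invalid linear_0)

lemma nbhd_if_banded: "banded W M \<Longrightarrow> M x' x \<noteq> 0 \<Longrightarrow> x \<in> nbhd W x'" "banded W M \<Longrightarrow> M x' x \<noteq> 0 \<Longrightarrow> x' \<in> nbhd W x"
  unfolding banded_def nbhd_def using near_sym by blast+

text \<open>Both sides are bounded and linear in v, the right one because the band makes it a finite
  sum; so it is enough to compare them on multiples of basis vectors.\<close>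

lemma cpt_bounded_op:
  assumes a: "bounded_op a" and b: "banded W (entry a)"
  shows "cpt (a v) x' = (\<Sum>x\<in>nbhd W x'. entry a x' x * cpt v x)"
proof -
  have "cpt (a v) x' - (\<Sum>x\<in>nbhd W x'. entry a x' x * cpt v x) = 0"
  proof (rule bounded_linear_eq_0[of "\<lambda>v. cpt (a v) x' - (\<Sum>x\<in>nbhd W x'. entry a x' x * cpt v x)"])
    show "bounded_linear (\<lambda>v. cpt (a v) x' - (\<Sum>x\<in>nbhd W x'. entry a x' x * cpt v x))"
      by (intro bounded_linear_sub bounded_linear_sum bounded_linear_const_mult bounded_linear_cpt
          bounded_linear_compose[OF bounded_linear_cpt bounded_opD(1)[OF a]])
    fix c y assume y: "valid y"
    have "(\<Sum>x\<in>nbhd W x'. entry a x' x * cpt (scaleC c (ket y)) x) = (\<Sum>x\<in>nbhd W x'. if x = y then entry a x' y * c else 0)"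
      using y by (intro sum.cong) auto
    also have "\<dots> = c * entry a x' y"
      using nbhd_if_banded[OF b, of x' y] by (auto simp: finite_card_nbhd)
    finally show "cpt (a (scaleC c (ket y))) x' - (\<Sum>x\<in>nbhd W x'. entry a x' x * cpt (scaleC c (ket y)) x) = 0"
      using a by (simp add: bounded_opD entry_def)
  qed
  then show ?thesis by simp
qed

lemma entry_add: "entry (\<lambda>v. a v + b v) = (\<lambda>x' x. entry a x' x + entry b x' x)"
  and entry_scaleC: "entry (\<lambda>v. scaleC c (a v)) = (\<lambda>x' x. c * entry a x' x)"
  and entry_id: "entry id = (\<lambda>x' x. if x' = x \<and> valid x then 1 else 0)"
  by (auto simp: entry_def fun_eq_iff)

text \<open>The operator side sums over the band of a row of \<open>a\<close>, \<open>mmult\<close>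
  over the support of a column of \<open>b\<close>; both extend by zeros to the union of the two
  bands.\<close>

lemma entry_comp:
  assumes a: "bounded_op a" "banded V (entry a)" and b: "banded W (entry b)"
  shows "entry (a \<circ> b) = mmult (entry a) (entry b)"
proof (intro ext)
  fix x' x
  have off: "entry a x' y = 0" if "y \<notin> nbhd V x'" for y
    using nbhd_if_banded(1)[OF a(2)] that by blast
  have sub: "{y. entry b y x \<noteq> 0} \<subseteq> nbhd W x"
    using nbhd_if_banded(2)[OF b] by blast
  have "entry (a \<circ> b) x' x = (\<Sum>y\<in>nbhd V x'. entry a x' y * entry b y x)"
    by (simp add: entry_def[of "a \<circ> b"] cpt_bounded_op[OF a]) (simp add: entry_def)
  also have "\<dots> = (\<Sum>y\<in>nbhd V x' \<union> nbhd W x. entry a x' y * entry b y x)"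
    by (rule sum.mono_neutral_left) (auto simp: off finite_card_nbhd)
  also have "\<dots> = mmult (entry a) (entry b) x' x"
    unfolding mmult_def
    by (rule sum.mono_neutral_right) (use sub in \<open>auto simp: finite_card_nbhd\<close>)
  finally show "entry (a \<circ> b) x' x = mmult (entry a) (entry b) x' x" .
qed

lemma spinor_from_components:
  assumes "(\<lambda>x. (cmod (g x))\<^sup>2) summable_on UNIV" "\<And>x. \<not> valid x \<Longrightarrow> g x = 0"
  obtains v where "\<And>x. cpt v x = g x"
proof -
  define f where "f = (\<lambda>i. if i \<in> labels then g (inv lab i) else 0)"
  have fl: "f (lab x) = g x" for x using assms(2) by (simp add: f_def inj_lab)
  have "(\<lambda>i. (cmod (f i))\<^sup>2) summable_on range lab"
    using assms(1) by (subst summable_on_reindex) (auto simp: inj_lab o_def fl)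
  then have "(\<lambda>i. (cmod (f i))\<^sup>2) summable_on UNIV"
    by (rule summable_on_cong_neutral[THEN iffD1, rotated -1])
       (auto simp: f_def labels_eq)
  then have "coord (Abs_spinor f) = f"
    by (intro Abs_spinor_inverse) (auto simp: f_def)
  then show thesis using fl by (intro that[of "Abs_spinor f"]) simp
qed

section \<open>Operators given by banded matrices\<close>

text \<open>A row has at most n entries, so Cauchy-Schwarz costs one factor n; after exchanging the
  sums each x occurs in at most n rows, which costs the other. Only finite partial sums enter, since
  the image is not yet known to be a spinor.\<close>

lemma band_sum_bound:
  fixes M :: mat and X :: "idx \<Rightarrow> complex"
  assumes K: "\<And>x' x. cmod (M x' x) \<le> K" and F: "finite F"
    and X: "\<And>F. finite F \<Longrightarrow> (\<Sum>x\<in>F. (cmod (X x))\<^sup>2) \<le> B"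
    and n: "n = (2 * W + 1) * ((2 * W + 1) * 2)"
  shows "(\<Sum>x'\<in>F. (cmod (\<Sum>x\<in>nbhd W x'. M x' x * X x))\<^sup>2) \<le> real n * real n * K\<^sup>2 * B"
proof -
  define U where "U = (\<Union>x'\<in>F. nbhd W x')"
  have U: "finite U" using F by (simp add: U_def finite_card_nbhd)
  have pt: "(cmod (\<Sum>x\<in>nbhd W x'. M x' x * X x))\<^sup>2 \<le> K\<^sup>2 * (real n * (\<Sum>x\<in>nbhd W x'. (cmod (X x))\<^sup>2))" for x'
  proof -
    have "cmod (\<Sum>x\<in>nbhd W x'. M x' x * X x) \<le> (\<Sum>x\<in>nbhd W x'. K * cmod (X x))"
      by (rule sum_norm_le) (simp add: norm_mult mult_right_mono K)
    then have "(cmod (\<Sum>x\<in>nbhd W x'. M x' x * X x))\<^sup>2 \<le> (\<Sum>x\<in>nbhd W x'. K * cmod (X x))\<^sup>2"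
      by (rule power_mono) simp
    also have "\<dots> = K\<^sup>2 * (\<Sum>x\<in>nbhd W x'. cmod (X x))\<^sup>2"
      by (simp add: sum_distrib_left[symmetric] power_mult_distrib)
    also have "\<dots> \<le> K\<^sup>2 * ((\<Sum>x\<in>nbhd W x'. (cmod (X x))\<^sup>2) * real (card (nbhd W x')))"
      by (intro mult_left_mono sum_squared_le_sum_of_squares) auto
    also have "\<dots> \<le> K\<^sup>2 * ((\<Sum>x\<in>nbhd W x'. (cmod (X x))\<^sup>2) * real n)"
      unfolding n by (intro mult_left_mono of_nat_mono finite_card_nbhd sum_nonneg) auto
    finally show ?thesis by (simp add: mult_ac)
  qed
  have "(\<Sum>x'\<in>F. \<Sum>x\<in>nbhd W x'. (cmod (X x))\<^sup>2) = (\<Sum>x'\<in>F. \<Sum>x\<in>U. if near W x' x then (cmod (X x))\<^sup>2 else 0)"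
  proof (rule sum.cong[OF HOL.refl])
    fix x' assume "x' \<in> F"
    then have "nbhd W x' = {x \<in> U. near W x' x}" by (auto simp: U_def nbhd_def)
    then show "(\<Sum>x\<in>nbhd W x'. (cmod (X x))\<^sup>2) = (\<Sum>x\<in>U. if near W x' x then (cmod (X x))\<^sup>2 else 0)"
      using U by (simp add: sum.inter_filter)
  qed
  also have "\<dots> = (\<Sum>x\<in>U. \<Sum>x'\<in>F. if near W x' x then (cmod (X x))\<^sup>2 else 0)"
    by (rule sum.swap)
  also have "\<dots> \<le> (\<Sum>x\<in>U. real n * (cmod (X x))\<^sup>2)"
  proof (rule sum_mono)
    fix x
    have "(\<Sum>x'\<in>F. if near W x' x then (cmod (X x))\<^sup>2 else 0) = (\<Sum>x'\<in>{x'\<in>F. near W x' x}. (cmod (X x))\<^sup>2)"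
      by (rule sum.inter_filter[symmetric]) (rule F)
    also have "\<dots> = real (card {x'\<in>F. near W x' x}) * (cmod (X x))\<^sup>2" by simp
    also have "card {x'\<in>F. near W x' x} \<le> card (nbhd W x)"
      by (rule card_mono[OF finite_card_nbhd(1)]) (auto simp: nbhd_def intro: near_sym[THEN iffD1])
    then have "real (card {x'\<in>F. near W x' x}) * (cmod (X x))\<^sup>2 \<le> real n * (cmod (X x))\<^sup>2"
      using finite_card_nbhd(2)[of W x] unfolding n by (intro mult_right_mono of_nat_mono) auto
    finally show "(\<Sum>x'\<in>F. if near W x' x then (cmod (X x))\<^sup>2 else 0) \<le> real n * (cmod (X x))\<^sup>2" .
  qed
  also have "\<dots> \<le> real n * B"
    unfolding sum_distrib_left[symmetric] by (intro mult_left_mono X U) auto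
  finally have sw: "(\<Sum>x'\<in>F. \<Sum>x\<in>nbhd W x'. (cmod (X x))\<^sup>2) \<le> real n * B" .
  have "(\<Sum>x'\<in>F. (cmod (\<Sum>x\<in>nbhd W x'. M x' x * X x))\<^sup>2)
      \<le> (\<Sum>x'\<in>F. K\<^sup>2 * (real n * (\<Sum>x\<in>nbhd W x'. (cmod (X x))\<^sup>2)))"
    by (intro sum_mono pt)
  also have "\<dots> = K\<^sup>2 * (real n * (\<Sum>x'\<in>F. \<Sum>x\<in>nbhd W x'. (cmod (X x))\<^sup>2))"
    by (simp add: sum_distrib_left)
  also have "\<dots> \<le> K\<^sup>2 * (real n * (real n * B))"
    by (intro mult_left_mono sw) auto
  finally show ?thesis by (simp add: mult_ac)
qed

text \<open>The bound on finite sums first shows that the formal image is square summable, hence a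
  spinor, and then bounds its norm.\<close>

lemma matrix_operator:
  assumes M: "banded W M" "\<And>x' x. cmod (M x' x) \<le> K"
    and valid: "\<And>x' x. M x' x \<noteq> 0 \<Longrightarrow> valid x' \<and> valid x"
  obtains a where "bounded_op a" "entry a = M"
proof -
  define n where "n = (2 * W + 1) * ((2 * W + 1) * 2)"
  have K0: "0 \<le> K" using M(2)[of undefined undefined] norm_ge_zero order_trans by blast
  define g where "g = (\<lambda>v x'. \<Sum>x\<in>nbhd W x'. M x' x * cpt v x)"
  have bound: "(\<Sum>x'\<in>F. (cmod (g v x'))\<^sup>2) \<le> (real n * K * norm v)\<^sup>2" if "finite F" for F v
  proof -
    have "(\<Sum>x'\<in>F. (cmod (g v x'))\<^sup>2) \<le> real n * real n * K\<^sup>2 * (norm v)\<^sup>2"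
      unfolding g_def
      by (rule band_sum_bound[OF M(2) that _ n_def]) (auto intro: finite_sum_le_has_sum[OF norm_has_sum])
    then show ?thesis by (simp add: power2_eq_square mult_ac)
  qed
  have "\<exists>w. \<forall>x. cpt w x = g v x" for v
  proof -
    have "(\<lambda>x. (cmod (g v x))\<^sup>2) summable_on UNIV"
      by (rule nonneg_bdd_above_summable_on) (auto intro!: bdd_aboveI2[of _ _ "(real n * K * norm v)\<^sup>2"] bound)
    moreover have "g v x = 0" if "\<not> valid x" for x
      using valid[of x] that unfolding g_def by (intro sum.neutral) auto
    ultimately show ?thesis using spinor_from_components[of "g v"] by metis
  qed
  then obtain a where a: "\<And>v x. cpt (a v) x = g v x" by metis
  have "bounded_op a"
    unfolding bounded_op_def
  proof (intro conjI allI)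
    show "bounded_linear a"
    proof (rule bounded_linear_intro[of _ "real n * K"])
      show "a (v + w) = a v + a w" for v w
        by (rule spinor_cpt_eqI) (simp add: a g_def algebra_simps sum.distrib)
      show "a (r *\<^sub>R v) = r *\<^sub>R a v" for r v
        by (rule spinor_cpt_eqI) (simp add: a g_def sum_distrib_left mult_ac)
      show "norm (a v) \<le> norm v * (real n * K)" for v
        by (rule norm_le_if_finite_sums) (use bound[of _ v] K0 in \<open>auto simp: a mult_ac\<close>)
    qed
    show "a (scaleC c v) = scaleC c (a v)" for c v
      by (rule spinor_cpt_eqI) (simp add: a g_def sum_distrib_left mult_ac)
  qed
  moreover have "entry a = M"
  proof (intro ext)
    fix x' y
    show "entry a x' y = M x' y"
    proof (cases "valid y")
      case True
      have "entry a x' y = (\<Sum>x\<in>nbhd W x'. if x = y then M x' y else 0)"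
        unfolding entry_def a g_def using True by (intro sum.cong) auto
      also have "\<dots> = M x' y"
        using nbhd_if_banded[OF M(1), of x' y] by (auto simp: finite_card_nbhd)
      finally show ?thesis .
    next
      case False
      then have "entry a x' y = 0" unfolding entry_def a g_def by (simp add: ket_invalid)
      with False valid[of x' y] show ?thesis by auto
    qed
  qed
  ultimately show thesis by (rule that)
qed

lemma tame_bounded: "tame M \<Longrightarrow> \<exists>K. \<forall>x' x. cmod (M x' x) \<le> K"
proof -
  assume "tame M"
  then have "expsmall (\<lambda>_. 0) (\<lambda>p. M (fst p) (snd p))" by (rule tameE)
  then obtain K where "\<And>p. cmod (M (fst p) (snd p)) \<le> K" by (auto elim!: expsmallE)
  then show ?thesis by (metis fst_conv snd_conv)
qed

lemma tame_operator:
  assumes "tame M" "\<And>x' x. M x' x \<noteq> 0 \<Longrightarrow> valid x' \<and> valid x"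
  obtains a where "bounded_op a" "entry a = M"
proof -
  obtain W where "banded W M" using assms(1) by (rule tameE)
  moreover obtain K where "\<And>x' x. cmod (M x' x) \<le> K" using tame_bounded[OF assms(1)] by blast
  ultimately show thesis using matrix_operator assms(2) that by metis
qed

section \<open>Operators with tame matrices, and their adjoints\<close>

definition good :: "(spinor \<Rightarrow> spinor) \<Rightarrow> bool" where
  "good a \<longleftrightarrow> bounded_op a \<and> tame (entry a)"

lemma goodE:
  assumes "good a"
  obtains W where "bounded_op a" "banded W (entry a)" "tame (entry a)"
  using assms unfolding good_def by (metis tameE)

lemma cinner_def': "cinner v w = (\<Sum>\<^sub>\<infinity>x. cnj (cpt v x) * cpt w x)"
proof -
  have "cinner v w = (\<Sum>\<^sub>\<infinity>i\<in>range lab. cnj (coord v i) * coord w i)"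
    unfolding cinner_def by (rule infsum_cong_neutral) (auto, metis coord_outside imageI labels_eq rangeI image_iff UNIV_I)
  then show ?thesis by (simp add: infsum_reindex inj_lab o_def)
qed

lemma cinner_ket:
  "cinner (scaleC c (ket x)) v = cnj c * cpt v x"
  "cinner v (scaleC c (ket x)) = c * cnj (cpt v x)"
proof -
  have "cinner (scaleC c (ket x)) v = (\<Sum>\<^sub>\<infinity>y\<in>{x}. cnj c * cpt v x)"
    unfolding cinner_def' by (rule infsum_cong_neutral) (auto simp: cpt_invalid)
  then show "cinner (scaleC c (ket x)) v = cnj c * cpt v x" by simp
  have "cinner v (scaleC c (ket x)) = (\<Sum>\<^sub>\<infinity>y\<in>{x}. c * cnj (cpt v x))"
    unfolding cinner_def' by (rule infsum_cong_neutral) (auto simp: cpt_invalid)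
  then show "cinner v (scaleC c (ket x)) = c * cnj (cpt v x)" by simp
qed

lemma cinner_scaleC_right: "cinner v (scaleC c w) = c * cinner v w"
  unfolding cinner_def by (simp add: infsum_cmult_right'[symmetric] mult_ac)

text \<open>The imaginary part is the real inner product after multiplying the second argument by
  -i. This reduces adjoints to the real inner product, whose bounded linearity is available.\<close>

lemma cinner_eq_inner: "cinner v w = Complex (inner v w) (inner v (scaleC (- \<i>) w))"
  by (simp add: inner_spinor_def cinner_scaleC_right complex_eq_iff)

lemma cinner_eqI:
  assumes "\<And>v w. inner (a v) w = inner v (b w)" "bounded_op b"
  shows "cinner (a v) w = cinner v (b w)"
  using assms by (simp add: cinner_eq_inner bounded_opD)

lemma adjoint_op_unique:
  assumes "bounded_op b" "\<And>v w. cinner (a v) w = cinner v (b w)"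
  shows "adjoint_op a = b"
  unfolding adjoint_op_def
proof (rule the_equality)
  fix b' assume b': "bounded_op b' \<and> (\<forall>x y. cinner (a x) y = cinner x (b' y))"
  show "b' = b"
  proof
    fix w
    have "cinner v (b' w) = cinner v (b w)" for v using b' assms(2) by metis
    then have "inner (b' w - b w) (b' w) = inner (b' w - b w) (b w)"
      by (simp add: inner_spinor_def)
    then have "inner (b' w - b w) (b' w - b w) = 0" by (simp add: inner_diff_right)
    then show "b' w = b w" by simp
  qed
qed (use assms in auto)

text \<open>The conjugate transpose is again tame and so comes from some operator. The adjoint
  relation for that operator extends from basis vectors by density in each argument, and uniqueness
  identifies it with the definite description.\<close>

lemma good_adjoint:
  assumes "good a"
  shows "good (adjoint_op a)" "entry (adjoint_op a) = (\<lambda>x' x. cnj (entry a x x'))"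
proof -
  obtain W where a: "bounded_op a" "banded W (entry a)" "tame (entry a)" using assms by (rule goodE)
  have "valid x' \<and> valid x" if "cnj (entry a x x') \<noteq> 0" for x' x
    using that entry_invalid[OF a(1), of x x'] by auto
  then obtain b where b: "bounded_op b" "entry b = (\<lambda>x' x. cnj (entry a x x'))"
    using tame_operator[OF tame_adj[OF a(3)]] by metis
  have "inner (a v) w - inner v (b w) = 0" for v w
  proof (rule bounded_linear_eq_0[of "\<lambda>v. inner (a v) w - inner v (b w)"])
    show "bounded_linear (\<lambda>v. inner (a v) w - inner v (b w))"
      by (intro bounded_linear_sub bounded_linear_inner_left
          bounded_linear_compose[OF bounded_linear_inner_left bounded_opD(1)[OF a(1)]])
    fix c x
    show "inner (a (scaleC c (ket x))) w - inner (scaleC c (ket x)) (b w) = 0"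
    proof (rule bounded_linear_eq_0[of "\<lambda>w. inner (a (scaleC c (ket x))) w - inner (scaleC c (ket x)) (b w)"])
      show "bounded_linear (\<lambda>w. inner (a (scaleC c (ket x))) w - inner (scaleC c (ket x)) (b w))"
        by (intro bounded_linear_sub bounded_linear_inner_right
          bounded_linear_compose[OF bounded_linear_inner_right bounded_opD(1)[OF b(1)]])
      fix d y
      have "cinner (a (scaleC c (ket x))) (scaleC d (ket y)) = cinner (scaleC c (ket x)) (b (scaleC d (ket y)))"
        using fun_cong[OF fun_cong[OF b(2)], of x y]
        by (simp add: bounded_opD[OF a(1)] bounded_opD[OF b(1)] cinner_ket entry_def)
      then show "inner (a (scaleC c (ket x))) (scaleC d (ket y)) - inner (scaleC c (ket x)) (b (scaleC d (ket y))) = 0"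
        by (simp add: inner_spinor_def)
    qed
  qed
  then have "adjoint_op a = b"
    by (intro adjoint_op_unique b(1) cinner_eqI) auto
  with b tame_adj[OF a(3)] show "good (adjoint_op a)" "entry (adjoint_op a) = (\<lambda>x' x. cnj (entry a x x'))"
    by (simp_all add: good_def)
qed

lemma good_combine:
  "good id" "good (scaleC c)"
  "good a \<Longrightarrow> good b \<Longrightarrow> good (\<lambda>v. a v + b v)"
  "good a \<Longrightarrow> good (\<lambda>v. scaleC c (a v))"
  "good a \<Longrightarrow> good b \<Longrightarrow> good (a \<circ> b)"
proof -
  show id: "good id"
    unfolding good_def entry_id
  proof (intro conjI tameI[of 0])
    show "banded 0 (\<lambda>x' x. if x' = x \<and> valid x then 1 else 0)"
      by (auto simp: banded_def near_def)
    show "expsmall (\<lambda>_. 0) (\<lambda>p. if fst p = snd p \<and> valid (snd p) then 1 else 0 :: complex)"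
      by (rule expsmall_boundedI[of _ 1]) auto
    have z: "expsmall w (\<lambda>p. 0 :: complex)" for w :: "idx \<times> idx \<Rightarrow> nat" by (rule expsmallI[of "1/2" _ 0]) auto
    show "expsmall wj (\<lambda>p. offdiag (\<lambda>x' x. if x' = x \<and> valid x then 1 else 0) (fst p) (snd p))"
      using z by (rule back_subst[of "expsmall _"]) (auto simp: offdiag_def fun_eq_iff)
    have "valid (dshift x) = valid x" "valid (jshift x) = valid x" for x by (auto simp: valid_def)
    then have "(\<lambda>p. (if dshift (fst p) = dshift (snd p) \<and> valid (dshift (snd p)) then 1 else 0) -
        (if fst p = snd p \<and> valid (snd p) then 1 else 0)) = (\<lambda>p. 0 :: complex)"
      "(\<lambda>p. (if jshift (fst p) = jshift (snd p) \<and> valid (jshift (snd p)) then 1 else 0) -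
        (if fst p = snd p \<and> valid (snd p) then 1 else 0)) = (\<lambda>p. 0 :: complex)"
      by (auto simp: fun_eq_iff inj_eq[OF inj_shift(1)] inj_eq[OF inj_shift(2)])
    then show
      "expsmall wjd (\<lambda>p. (if dshift (fst p) = dshift (snd p) \<and> valid (dshift (snd p)) then 1 else 0 :: complex) -
        (if fst p = snd p \<and> valid (snd p) then 1 else 0))"
      "expsmall wj (\<lambda>p. (if jshift (fst p) = jshift (snd p) \<and> valid (jshift (snd p)) then 1 else 0 :: complex) -
        (if fst p = snd p \<and> valid (snd p) then 1 else 0))"
      using z by simp_all
  qed (rule bounded_op_combine)
  show "good a \<Longrightarrow> good b \<Longrightarrow> good (\<lambda>v. a v + b v)"
    by (simp add: good_def bounded_op_combine entry_add tame_add)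
  show scale: "good a \<Longrightarrow> good (\<lambda>v. scaleC c (a v))" for a
    by (simp add: good_def bounded_op_combine entry_scaleC tame_scale)
  from scale[OF id] show "good (scaleC c)" by simp
  show "good a \<Longrightarrow> good b \<Longrightarrow> good (a \<circ> b)"
    unfolding good_def using entry_comp tame_mmult bounded_op_combine(5) by (metis tameE)
qed

lemma flip_tame_id: "flip_tame (entry id)"
proof -
  have "flip x' = x \<longleftrightarrow> x' = flip x" "valid (flip x) = valid x" for x x'
    by (metis flip_flip) (simp add: valid_def)
  then have "(\<lambda>p. entry id (flip (fst p)) (snd p) - entry id (fst p) (flip (snd p))) = (\<lambda>p. 0)"
    by (simp add: entry_id)
  then show ?thesis unfolding flip_tame_def by (simp add: expsmallI[of "1/2" _ 0])
qed

text \<open>The operators that satisfy \<open>flip_good\<close> commute with the sign of \<open>D\<close> up to exponentially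
  small terms.\<close>

definition flip_good :: "(spinor \<Rightarrow> spinor) \<Rightarrow> bool" where
  "flip_good a \<longleftrightarrow> good a \<and> flip_tame (entry a)"

lemma flip_good_combine:
  "flip_good (scaleC c)"
  "flip_good a \<Longrightarrow> flip_good b \<Longrightarrow> flip_good (\<lambda>v. a v + b v)"
  "flip_good a \<Longrightarrow> flip_good b \<Longrightarrow> flip_good (a \<circ> b)"
  "flip_good a \<Longrightarrow> flip_good (adjoint_op a)"
proof -
  show "flip_good (scaleC c)"
    using flip_tame_scale[OF flip_tame_id, of c] good_combine(2) entry_scaleC[of c id]
    by (simp add: flip_good_def)
  show "flip_good a \<Longrightarrow> flip_good b \<Longrightarrow> flip_good (\<lambda>v. a v + b v)"
    by (simp add: flip_good_def good_combine entry_add flip_tame_add)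
  show "flip_good a \<Longrightarrow> flip_good b \<Longrightarrow> flip_good (a \<circ> b)"
    unfolding flip_good_def using good_combine(5) entry_comp flip_tame_mmult by (metis goodE)
  show "flip_good a \<Longrightarrow> flip_good (adjoint_op a)"
    unfolding flip_good_def using good_adjoint flip_tame_adj by (metis goodE)
qed

section \<open>Commutators with the Dirac operator\<close>

lemma weight_eq: "weight x = fst (lab x) + 1/2"
  by (simp add: weight_def lab_def add_divide_distrib)

lemma lab_flip: "lab (flip x) = (fst (lab x), fst (snd (lab x)), - snd (snd (lab x)))"
  by (simp add: lab_def flip_def)

lemma cpt_abs_dirac: "v \<in> dirac_domain \<Longrightarrow> cpt (abs_dirac v) x = of_real (weight x) * cpt v x"
  by (cases "lab x") (simp only: coord_abs_dirac weight_eq fst_conv)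

lemma cpt_dirac: "v \<in> dirac_domain \<Longrightarrow> cpt (dirac v) x = of_real (weight x) * cpt v (flip x)"
  by (cases "lab x") (simp only: coord_dirac weight_eq lab_flip fst_conv snd_conv)

lemma ket_in_domain: "ket x \<in> dirac_domain"
  unfolding ket_def by (cases "lab x") (simp add: bvec_in_domain)

text \<open>The spinor u plays the role of |D| v; its square summability is the condition that
  defines the domain.\<close>

lemma dirac_domainI:
  assumes "\<And>x. cpt u x = of_real (weight x) * cpt v x"
  shows "v \<in> dirac_domain"
proof -
  have "(cmod (coord u i))\<^sup>2 = (case i of (l, m, N) \<Rightarrow> (l + 1/2)\<^sup>2 * (cmod (coord v (l, m, N)))\<^sup>2)" for i
  proof (cases "i \<in> labels")
    case True
    then obtain x where "i = lab x" unfolding labels_eq by auto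
    then show ?thesis using assms[of x]
      by (cases "lab x") (simp add: norm_mult power_mult_distrib weight_eq del: of_real_add)
  qed (simp add: coord_outside case_prod_unfold)
  then show ?thesis unfolding dirac_domain_def using coord_summable[of u] by (simp add: case_prod_unfold)
qed

text \<open>The basis vectors lie in the domain and determine a bounded operator, so the definite
  description has at most one candidate.\<close>

lemma commutatorI:
  assumes "bounded_op a" "bounded_op b" "a ` dirac_domain \<subseteq> dirac_domain"
    "\<And>v. v \<in> dirac_domain \<Longrightarrow> b v = T (a v) - a (T v)"
  shows "a \<in> commutator_domain T" "commutator T a = b"
proof -
  show "a \<in> commutator_domain T" unfolding commutator_domain_def using assms by blast
  show "commutator T a = b"
    unfolding commutator_def
  proof (rule the_equality)
    fix b' assume "bounded_op b' \<and> (\<forall>x\<in>dirac_domain. b' x = T (a x) - a (T x))"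
    with assms(2,4) show "b' = b"
      by (intro bounded_op_ext) (auto simp: ket_in_domain)
  qed (use assms in auto)
qed

lemma good_commutator_abs_dirac:
  assumes "good a"
  shows "a \<in> commutator_domain abs_dirac" "good (\<delta> a)" "a ` dirac_domain \<subseteq> dirac_domain"
proof -
  obtain W where a: "bounded_op a" "banded W (entry a)" "tame (entry a)" using assms by (rule goodE)
  note t = tame_comm_weight[OF a(3)]
  have inv: "valid x' \<and> valid x" if "comm_weight (entry a) x' x \<noteq> 0" for x' x
    using that entry_invalid[OF a(1), of x' x] by (auto simp: comm_weight_def)
  obtain b where b: "bounded_op b" "entry b = comm_weight (entry a)"
    by (rule tame_operator[OF t inv]) auto
  have bb: "banded W (entry b)" using a(2) by (simp add: b(2) comm_weight_def banded_def)
  \<comment> \<open>The spinor a |D| v + b v has the components that |D| a v should have; this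
    proves that a v lies in the domain and gives the commutator at once.\<close>
  have key: "cpt (a (abs_dirac v) + b v) x' = of_real (weight x') * cpt (a v) x'" if "v \<in> dirac_domain" for v x'
    unfolding coord_simps cpt_bounded_op[OF a(1,2)] cpt_bounded_op[OF b(1) bb] b(2) comm_weight_def
      cpt_abs_dirac[OF that] sum_distrib_left sum.distrib[symmetric]
    by (intro sum.cong HOL.refl) (simp add: algebra_simps)
  show dom: "a ` dirac_domain \<subseteq> dirac_domain"
    using dirac_domainI[OF key] by auto
  have "b v = abs_dirac (a v) - a (abs_dirac v)" if "v \<in> dirac_domain" for v
    using key[OF that] dom that
    by (intro spinor_cpt_eqI) (simp add: cpt_abs_dirac image_subset_iff flip: key[OF that])
  note c = commutatorI[OF a(1) b(1) dom this]
  show "a \<in> commutator_domain abs_dirac" by (rule c)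
  show "good (\<delta> a)" using b t by (simp add: c(2) good_def)
qed

lemma flip_good_commutator_dirac:
  assumes "flip_good a"
  shows "a \<in> commutator_domain dirac" "good (commutator dirac a)"
proof -
  have ga: "good a" and fa: "flip_tame (entry a)" using assms by (auto simp: flip_good_def)
  obtain W where a: "bounded_op a" "banded W (entry a)" "tame (entry a)" using ga by (rule goodE)
  note t = tame_comm_weight_flip[OF a(3) fa]
  have vf: "valid (flip x) = valid x" for x by (simp add: valid_def)
  have inv: "valid x' \<and> valid x" if "comm_weight_flip (entry a) x' x \<noteq> 0" for x' x
  proof -
    have "entry a (flip x') x \<noteq> 0 \<or> entry a x' (flip x) \<noteq> 0"
      using that by (auto simp: comm_weight_flip_def)
    then show ?thesis using entry_invalid[OF a(1)] vf by metis
  qed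
  obtain b where b: "bounded_op b" "entry b = comm_weight_flip (entry a)"
    by (rule tame_operator[OF t inv]) auto
  have bb: "banded W (entry b)"
    unfolding b(2) banded_def
  proof (intro allI impI)
    fix x' x assume "comm_weight_flip (entry a) x' x \<noteq> 0"
    then have "entry a (flip x') x \<noteq> 0 \<or> entry a x' (flip x) \<noteq> 0"
      by (auto simp: comm_weight_flip_def)
    then show "near W x x'" using a(2) unfolding banded_def by (metis near_shift(3,4))
  qed
  have nb: "nbhd W (flip x) = nbhd W x" for x by (simp add: nbhd_def)
  have dom: "a ` dirac_domain \<subseteq> dirac_domain" by (rule good_commutator_abs_dirac(3)[OF ga])
  have key: "cpt (b v) x' = of_real (weight x') * cpt (a v) (flip x') - cpt (a (dirac v)) x'"
    if "v \<in> dirac_domain" for v x'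
  proof -
    \<comment> \<open>Neighbourhoods ignore the sign, so replacing x by its flip permutes the
      summation range.\<close>
    have img: "flip ` nbhd W x' = nbhd W x'"
    proof (intro equalityI subsetI)
      fix y assume "y \<in> nbhd W x'"
      then have "flip y \<in> nbhd W x'" by (simp add: nbhd_def)
      then show "y \<in> flip ` nbhd W x'" using flip_flip[of y] by (metis image_eqI)
    qed (auto simp: nbhd_def)
    have "cpt (a (dirac v)) x' = (\<Sum>x\<in>flip ` nbhd W x'. entry a x' x * (of_real (weight x) * cpt v (flip x)))"
      unfolding cpt_bounded_op[OF a(1,2)] cpt_dirac[OF that] img ..
    also have "\<dots> = (\<Sum>x\<in>nbhd W x'. entry a x' (flip x) * (of_real (weight x) * cpt v x))"
      by (subst sum.reindex) (auto intro!: inj_on_inverseI[of _ flip])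
    finally show ?thesis
      unfolding cpt_bounded_op[OF b(1) bb] cpt_bounded_op[OF a(1,2), of v] nb b(2) comm_weight_flip_def
      by (simp add: sum_distrib_left algebra_simps sum_subtractf)
  qed
  have "b v = dirac (a v) - a (dirac v)" if "v \<in> dirac_domain" for v
    using key[OF that] dom that
    by (intro spinor_cpt_eqI) (simp add: cpt_dirac image_subset_iff)
  note c = commutatorI[OF a(1) b(1) dom this]
  show "a \<in> commutator_domain dirac" by (rule c)
  show "good (commutator dirac a)" using b t by (simp add: c(2) good_def)
qed

lemma good_iterated_commutator: "good a \<Longrightarrow> good ((\<delta> ^^ n) a)"
  by (induction n) (auto intro: good_commutator_abs_dirac)

text \<open>\<open>flip_good\<close> pays for the single commutator with D; its result is
  \<open>good\<close>, and \<open>good\<close> is stable under \<delta>.\<close>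

lemma regular_triple_if_flip_good:
  assumes "\<And>a. a \<in> \<A> \<Longrightarrow> flip_good a"
  shows "regular_triple \<A>"
proof -
  have "(\<delta> ^^ n) a \<in> commutator_domain abs_dirac" if "a \<in> \<A> \<union> commutator dirac ` \<A>" for a n
    using that assms flip_good_commutator_dirac(2)
    by (intro good_commutator_abs_dirac(1) good_iterated_commutator) (auto simp: flip_good_def)
  with assms flip_good_commutator_dirac(1) show ?thesis unfolding regular_triple_def by blast
qed

lemma good_Psi0:
  assumes A: "\<And>a. a \<in> \<A> \<Longrightarrow> flip_good a" and "a \<in> Psi0 \<A>"
  shows "good a"
  using assms(2) unfolding Psi0_def
proof (induction rule: generated_algebra.induct)
  case (gen a)
  then obtain n b where b: "a = (\<delta> ^^ n) b" "b \<in> \<A> \<union> commutator dirac ` \<A>" by blast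
  have "good b" using b(2) A flip_good_commutator_dirac(2) by (auto simp: flip_good_def)
  then show ?case unfolding b(1) by (rule good_iterated_commutator)
qed (blast intro: good_combine)+

section \<open>Zeta functions\<close>

lemma abs_dirac_powr_ket: "abs_dirac_powr s (ket x) = scaleC (of_real (weight x) powr s) (ket x)"
proof -
  have "(\<lambda>(l, m, N). complex_of_real (l + 1/2) powr s * coord (ket x) (l, m, N))
      = coord (scaleC (of_real (weight x) powr s) (ket x))"
    by (auto simp: fun_eq_iff coord_ket weight_eq) (metis fst_conv)
  then show ?thesis unfolding abs_dirac_powr_def by (simp add: coord_inverse)
qed

text \<open>The trace is an unordered sum, and its grouping by shells rests on absolute convergence:
  a shell has 4 (k + 1) terms of order (k + 1)^(- Re z), hence the condition Re z > 2.\<close>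

lemma zeta_sums:
  assumes "good a" and z: "Re z > 2"
  shows "(\<lambda>k. shell_trace (entry a) k * of_nat (Suc k) powr (- z)) sums zeta a z"
proof -
  obtain W where a: "bounded_op a" "banded W (entry a)" "tame (entry a)" using assms(1) by (rule goodE)
  obtain K where K: "\<And>x' x. cmod (entry a x' x) \<le> K" using tame_bounded[OF a(3)] by blast
  define S where "S = (SIGMA k:(UNIV::nat set). {..2 * k + 1} \<times> (UNIV :: bool set))"
  define \<phi> :: "nat \<times> nat \<times> bool \<Rightarrow> idx" where "\<phi> = (\<lambda>(k, j, s). (j, 2 * k + 1 - j, s))"
  define f where "f = (\<lambda>x. entry a x x * of_real (weight x) powr (- z))"
  have bij: "bij_betw \<phi> S {x. valid x}"
  proof (rule bij_betwI[of _ _ _ "\<lambda>x. ((jpos x + dpos x - 1) div 2, jpos x, snd (snd x))"])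
    show "\<phi> \<in> S \<rightarrow> {x. valid x}" by (auto simp: \<phi>_def S_def valid_def)
    show "(\<lambda>x. ((jpos x + dpos x - 1) div 2, jpos x, snd (snd x))) \<in> {x. valid x} \<rightarrow> S"
      by (auto simp: S_def valid_def elim!: oddE)
    show "((jpos (\<phi> q) + dpos (\<phi> q) - 1) div 2, jpos (\<phi> q), snd (snd (\<phi> q))) = q" if "q \<in> S" for q
      using that by (auto simp: \<phi>_def S_def)
    show "\<phi> ((jpos y + dpos y - 1) div 2, jpos y, snd (snd y)) = y" if "y \<in> {x. valid x}" for y
    proof -
      have "odd (jpos y + dpos y)" using that by (simp add: valid_def)
      then obtain n where "jpos y + dpos y = 2 * n + 1" by (rule oddE)
      then show ?thesis by (simp add: \<phi>_def prod_eq_iff)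
    qed
  qed
  have f\<phi>: "f (\<phi> (k, p)) = entry a (\<phi> (k, p)) (\<phi> (k, p)) * of_nat (Suc k) powr (- z)" if "p \<in> {..2 * k + 1} \<times> UNIV" for k p
  proof -
    have "weight (\<phi> (k, p)) = real (Suc k)"
      using that by (auto simp: \<phi>_def weight_def field_simps)
    then show ?thesis by (simp only: f_def of_real_of_nat_eq)
  qed
  have nf: "norm (f (\<phi> (k, p))) \<le> K * real (Suc k) powr (- Re z)" if "p \<in> {..2 * k + 1} \<times> UNIV" for k p
    unfolding f\<phi>[OF that] norm_mult using norm_of_nat_powr[of "Suc k" "- z"] by (simp add: mult_right_mono K del: of_nat_Suc)
  have summ: "(\<lambda>q. f (\<phi> q)) summable_on S"
  proof -
    have le: "norm (\<Sum>\<^sub>\<infinity>p\<in>{..2 * k + 1} \<times> UNIV. norm (f (\<phi> (k, p)))) \<le> 4 * K * real (Suc k) powr (1 - Re z)" for k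
    proof -
      have "norm (\<Sum>\<^sub>\<infinity>p\<in>{..2 * k + 1} \<times> UNIV. norm (f (\<phi> (k, p)))) = (\<Sum>p\<in>{..2 * k + 1} \<times> UNIV. norm (f (\<phi> (k, p))))"
        by (simp add: sum_nonneg)
      also have "\<dots> \<le> (\<Sum>p\<in>{..2 * k + 1} \<times> (UNIV::bool set). K * real (Suc k) powr (- Re z))"
        by (intro sum_mono nf)
      also have "\<dots> = 4 * K * (real (Suc k) * real (Suc k) powr (- Re z))"
        by (simp add: card_cartesian_product algebra_simps)
      also have "real (Suc k) * real (Suc k) powr (- Re z) = real (Suc k) powr (1 - Re z)"
        using powr_add[of "real (Suc k)" 1 "- Re z"] by simp
      finally show ?thesis .
    qed
    have "summable (\<lambda>k. 4 * K * real (Suc k) powr (1 - Re z))"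
      using summable_of_nat_add_powr[of "1 - Re z" 1] z by (intro summable_mult) simp
    then have "summable (\<lambda>k. norm (\<Sum>\<^sub>\<infinity>p\<in>{..2 * k + 1} \<times> UNIV. norm (f (\<phi> (k, p)))))"
      by (rule summable_comparison_test'[of _ 0]) (use le in auto)
    then have "(\<lambda>k. norm (\<Sum>\<^sub>\<infinity>p\<in>{..2 * k + 1} \<times> UNIV. norm (f (\<phi> (k, p))))) summable_on UNIV"
      by (rule summable_nonneg_imp_summable_on) simp
    then have "(\<lambda>q. norm (f (\<phi> q))) summable_on S"
      unfolding S_def Infinite_Sum.abs_summable_on_Sigma_iff by simp
    then show ?thesis by (rule Infinite_Sum.abs_summable_summable)
  qed
  have "zeta a z = (\<Sum>\<^sub>\<infinity>i\<in>labels. cinner (bvec (fst i) (fst (snd i)) (snd (snd i))) ((a \<circ> abs_dirac_powr (- z)) (bvec (fst i) (fst (snd i)) (snd (snd i)))))"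
    by (simp add: zeta_def trace_def case_prod_unfold)
  also have "\<dots> = (\<Sum>\<^sub>\<infinity>x\<in>{x. valid x}. cinner (ket x) ((a \<circ> abs_dirac_powr (- z)) (ket x)))"
    unfolding labels_eq by (subst infsum_reindex) (auto simp: ket_def o_def case_prod_unfold intro: inj_on_subset[OF inj_lab])
  also have "\<dots> = (\<Sum>\<^sub>\<infinity>x\<in>{x. valid x}. f x)"
    using cinner_ket(1)[of 1]
    by (intro infsum_cong) (simp add: f_def abs_dirac_powr_ket bounded_opD(2)[OF a(1)] scaleC_simps entry_def)
  also have "\<dots> = (\<Sum>\<^sub>\<infinity>q\<in>S. f (\<phi> q))"
    by (rule infsum_reindex_bij_betw[OF bij, symmetric])
  finally have "((\<lambda>q. f (\<phi> q)) has_sum zeta a z) S"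
    using has_sum_infsum[OF summ] by simp
  then have "((\<lambda>k. \<Sum>p\<in>{..2 * k + 1} \<times> UNIV. f (\<phi> (k, p))) has_sum zeta a z) UNIV"
    unfolding S_def by (rule has_sum_SigmaD) (intro has_sum_finiteI, auto)
  then have "(\<lambda>k. \<Sum>p\<in>{..2 * k + 1} \<times> UNIV. f (\<phi> (k, p))) sums zeta a z"
    by (rule has_sum_imp_sums)
  moreover have "(\<Sum>p\<in>{..2 * k + 1} \<times> UNIV. f (\<phi> (k, p))) = shell_trace (entry a) k * of_nat (Suc k) powr (- z)" for k
  proof -
    have "(\<Sum>p\<in>{..2 * k + 1} \<times> UNIV. f (\<phi> (k, p)))
       = (\<Sum>p\<in>{..2 * k + 1} \<times> UNIV. entry a (\<phi> (k, p)) (\<phi> (k, p)) * of_nat (Suc k) powr (- z))"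
      by (intro sum.cong HOL.refl f\<phi>)
    also have "\<dots> = shell_trace (entry a) k * of_nat (Suc k) powr (- z)"
      unfolding shell_trace_def sum.cartesian_product sum_distrib_right by (simp add: \<phi>_def case_prod_unfold)
    finally show ?thesis .
  qed
  ultimately show ?thesis by simp
qed

lemma good_zeta_continuation:
  assumes "good a" "expsmall (\<lambda>k. k) (\<lambda>k. shell_trace (entry a) k - (\<alpha> * of_nat (Suc k) + \<beta>))"
  obtains f where "continues_zeta f a" "\<And>z. f analytic_on {z} \<or> z \<in> {1, 2} \<and> is_pole f z"
    "\<alpha> \<noteq> 0 \<Longrightarrow> is_pole f 2" "\<beta> \<noteq> 0 \<Longrightarrow> is_pole f 1"
proof -
  obtain f where f: "f meromorphic_on UNIV"
    "\<And>z. Re z > 2 \<Longrightarrow> (\<lambda>k. shell_trace (entry a) k * of_nat (Suc k) powr (- z)) sums f z"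
    "\<And>z. f analytic_on {z} \<or> z \<in> {1, 2} \<and> is_pole f z"
    "\<alpha> \<noteq> 0 \<Longrightarrow> is_pole f 2" "\<beta> \<noteq> 0 \<Longrightarrow> is_pole f 1"
    using asymptotically_linear_dirichlet_series[OF assms(2)] by blast
  have "continues_zeta f a"
    unfolding continues_zeta_def using f(1,2) zeta_sums[OF assms(1)] sums_unique2 by blast
  with f(3-5) that show thesis by blast
qed

lemma dimension_spectrum_if_flip_good:
  assumes A: "\<And>a. a \<in> \<A> \<Longrightarrow> flip_good a" and c: "c \<in> \<A>"
    and small: "expsmall wj (\<lambda>p. entry c (fst p) (snd p))"
    and nonzero: "\<not> shell_trace (entry c) \<longlonglongrightarrow> 0"
  shows "has_dimension_spectrum \<A> {1, 2}"
proof -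
  have reg: "regular_triple \<A>" by (rule regular_triple_if_flip_good[OF A])
  have cont: "\<exists>f. continues_zeta f a \<and> (\<forall>z. f analytic_on {z} \<or> z \<in> {1, 2} \<and> is_pole f z)" if "a \<in> Psi0 \<A>" for a
  proof -
    have a: "good a" using good_Psi0[OF A that] .
    then obtain \<alpha> \<beta> where "expsmall (\<lambda>k. k) (\<lambda>k. shell_trace (entry a) k - (\<alpha> * of_nat (Suc k) + \<beta>))"
      by (rule goodE) (erule tame_shell_trace, blast)
    from good_zeta_continuation[OF a this] show ?thesis by metis
  qed
  have pole2: "\<exists>a\<in>Psi0 \<A>. \<exists>f. continues_zeta f a \<and> is_pole f 2"
  proof -
    have "shell_trace (entry id) k = 4 * of_nat (Suc k) + 0" for k
    proof -
      have "shell_trace (entry id) k = (\<Sum>j\<le>2 * k + 1. \<Sum>s\<in>(UNIV::bool set). 1)"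
        unfolding shell_trace_def by (intro sum.cong HOL.refl) (simp add: entry_id valid_def)
      then show ?thesis by (simp add: algebra_simps)
    qed
    then have "expsmall (\<lambda>k. k) (\<lambda>k. shell_trace (entry id) k - (4 * of_nat (Suc k) + 0))"
      by (simp add: expsmallI[of "1/2" _ 0])
    from good_zeta_continuation[OF good_combine(1) this]
    obtain f where "continues_zeta f id" "is_pole f 2" by (metis zero_neq_numeral)
    moreover have "id \<in> Psi0 \<A>" unfolding Psi0_def by (rule generated_algebra.one)
    ultimately show ?thesis by blast
  qed
  have pole1: "\<exists>a\<in>Psi0 \<A>. \<exists>f. continues_zeta f a \<and> is_pole f 1"
  proof -
    have gc: "good c" using A[OF c] by (simp add: flip_good_def)
    then obtain \<alpha> \<beta> where e: "expsmall (\<lambda>k. k) (\<lambda>k. shell_trace (entry c) k - (\<alpha> * of_nat (Suc k) + \<beta>))"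
      by (rule goodE) (erule tame_shell_trace, blast)
    have "\<beta> \<noteq> 0" using shell_trace_bounded_limit(2)[OF e small] nonzero by auto
    with good_zeta_continuation[OF gc e] obtain f where "continues_zeta f c" "is_pole f 1" by metis
    moreover have "c \<in> Psi0 \<A>"
      unfolding Psi0_def using c by (intro generated_algebra.gen) (auto intro!: exI[of _ 0] exI[of _ c])
    ultimately show ?thesis by blast
  qed
  show ?thesis
    unfolding has_dimension_spectrum_def using reg cont pole1 pole2 by auto
qed

section \<open>The generators\<close>

definition econv :: "(nat \<Rightarrow> real) \<Rightarrow> real \<Rightarrow> bool" where
  "econv f L \<longleftrightarrow> expsmall (\<lambda>n. n) (\<lambda>n. f n - L)"

lemma expsmall_zero: "expsmall w (\<lambda>_. 0)"
  by (rule expsmallI[of "1/2" _ 0]) auto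

lemma econv_const: "econv (\<lambda>_. c) c"
  by (simp add: econv_def expsmall_zero)

lemma econv_bounded: "econv f L \<Longrightarrow> expsmall (\<lambda>_. 0) f"
proof -
  assume "econv f L"
  then have "expsmall (\<lambda>_. 0) (\<lambda>n. f n - L)"
    unfolding econv_def by (rule expsmall_weaken) auto
  from expsmall_add[OF this expsmall_boundedI[of "\<lambda>_. L" "\<bar>L\<bar>"]] show ?thesis by simp
qed

lemma econv_tendsto: "econv f L \<Longrightarrow> f \<longlonglongrightarrow> L"
  unfolding econv_def by (drule expsmall_imp_tendsto_0) (simp add: LIM_zero_iff)

lemma econv_add: "econv f L \<Longrightarrow> econv g M \<Longrightarrow> econv (\<lambda>n. f n + g n) (L + M)"
  unfolding econv_def by (drule (1) expsmall_add) (simp add: algebra_simps)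

lemma econv_mult:
  assumes "econv f L" "econv g M"
  shows "econv (\<lambda>n. f n * g n) (L * M)"
proof -
  have "expsmall (\<lambda>n. n) (\<lambda>n. (f n - L) * g n + L * (g n - M))"
    using assms unfolding econv_def
    by (intro expsmall_add expsmall_bounded_mult econv_bounded[of g M] expsmall_boundedI[of _ "\<bar>L\<bar>"]) (auto simp: econv_def)
  then show ?thesis unfolding econv_def by (rule back_subst[of "expsmall _"]) (auto simp: algebra_simps)
qed

lemma econv_shift: "econv f L \<Longrightarrow> econv (\<lambda>n. f (n + k)) L"
  unfolding econv_def by (erule expsmall_transfer[of _ _ _ 1 "\<lambda>n. n + k" _ 0]) auto

text \<open>Hoelder continuity of exponent 1/2, valid also at 0. This matters for t = 1, where the
  radicand in \<open>alpha_N\<close> tends to 0.\<close>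

lemma abs_sqrt_diff_le:
  assumes "0 \<le> x" "0 \<le> y"
  shows "\<bar>sqrt x - sqrt y\<bar> \<le> sqrt \<bar>x - y\<bar>"
proof -
  have "sqrt x - sqrt y \<le> sqrt (x - y)" if "0 \<le> y" "y \<le> x" for x y
    using sqrt_add_le_add_sqrt[of y "x - y"] that by simp
  then show ?thesis using assms by (cases "x \<le> y") (auto simp: abs_if not_le)
qed

lemma econv_sqrt:
  assumes "econv f L" "\<And>n. 0 \<le> f n" "0 \<le> L"
  shows "econv (\<lambda>n. sqrt (f n)) (sqrt L)"
  using assms(1) unfolding econv_def
  by (rule expsmall_sqrt) (use assms(2,3) abs_sqrt_diff_le in auto)

text \<open>Finitely many exceptional terms are absorbed into the constant through the sum
  \<open>S\<close> of their ratios to r^n.\<close>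

lemma expsmall_eventually:
  fixes h :: "nat \<Rightarrow> 'a::real_normed_vector"
  assumes g: "expsmall (\<lambda>n. n) g" and le: "eventually (\<lambda>n. norm (h n) \<le> C * norm (g n)) sequentially"
  shows "expsmall (\<lambda>n. n) h"
proof -
  obtain N where N: "\<And>n. n \<ge> N \<Longrightarrow> norm (h n) \<le> C * norm (g n)"
    using le by (auto simp: eventually_sequentially)
  obtain K r where *: "0 < K" "0 < r" "r < 1" "\<And>n. norm (g n) \<le> K * r ^ n"
    using g by (rule expsmallE) blast
  define S where "S = (\<Sum>n<N. norm (h n) / r ^ n)"
  have S0: "0 \<le> S" using * by (simp add: S_def sum_nonneg)
  have "norm (h n) \<le> (\<bar>C\<bar> * K + S) * r ^ n" for n
  proof (cases "n < N")
    case True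
    have "norm (h n) / r ^ n \<le> S"
      unfolding S_def using True * by (intro member_le_sum) auto
    then have "norm (h n) \<le> S * r ^ n" using * by (simp add: pos_divide_le_eq)
    also have "\<dots> \<le> (\<bar>C\<bar> * K + S) * r ^ n" using * by (intro mult_right_mono) auto
    finally show ?thesis .
  next
    case False
    then have "norm (h n) \<le> C * norm (g n)" using N by simp
    also have "\<dots> \<le> \<bar>C\<bar> * (K * r ^ n)"
      using * by (intro mult_mono) auto
    also have "\<dots> \<le> (\<bar>C\<bar> * K + S) * r ^ n" using * S0 by (simp add: semiring_class.distrib_right)
    finally show ?thesis .
  qed
  then show ?thesis using * by (intro expsmallI[of r])
qed

text \<open>The estimate concerns large n only, so f may vanish at finitely many n, where
  \<open>inverse\<close> gives 0. This occurs for \<open>V (real n)\<close> at n = 0.\<close>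

lemma econv_inverse:
  assumes "econv f L" "L \<noteq> 0"
  shows "econv (\<lambda>n. inverse (f n)) (inverse L)"
  unfolding econv_def
proof (rule expsmall_eventually[OF assms(1)[unfolded econv_def]])
  have "eventually (\<lambda>n. dist (f n) L < \<bar>L\<bar> / 2) sequentially"
    using tendstoD[OF econv_tendsto[OF assms(1)], of "\<bar>L\<bar> / 2"] assms(2) by simp
  then show "eventually (\<lambda>n. norm (inverse (f n) - inverse L) \<le> 2 / (\<bar>L\<bar> * \<bar>L\<bar>) * norm (f n - L)) sequentially"
  proof eventually_elim
    case (elim n)
    then have *: "\<bar>f n - L\<bar> < \<bar>L\<bar> / 2" by (simp only: dist_real_def)
    then have f: "\<bar>f n\<bar> \<ge> \<bar>L\<bar> / 2" "f n \<noteq> 0" by linarith+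
    have "inverse (f n) - inverse L = (L - f n) / (f n * L)"
      using f(2) assms(2) by (simp add: field_simps)
    then have "norm (inverse (f n) - inverse L) = \<bar>f n - L\<bar> / (\<bar>f n\<bar> * \<bar>L\<bar>)"
      by (simp add: abs_mult abs_minus_commute)
    also have "\<dots> \<le> \<bar>f n - L\<bar> / (\<bar>L\<bar> / 2 * \<bar>L\<bar>)"
      using f assms(2) by (intro divide_left_mono mult_right_mono mult_pos_pos) auto
    finally show ?case by (simp add: mult.commute)
  qed
qed

lemma econv_powr:
  assumes "0 < q" "q < 1" "0 < c"
  shows "econv (\<lambda>n. q powr (c * real n + e)) 0"
  unfolding econv_def
proof (rule expsmallI[of "q powr c" _ "q powr e"])
  show "0 < q powr c" "q powr c < 1" using assms powr_less_mono2[of c q 1] by auto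
  show "norm (q powr (c * real n + e) - 0) \<le> q powr e * (q powr c) ^ n" for n
    using assms by (simp add: powr_add powr_powr[symmetric] powr_realpow mult.commute)
qed

section \<open>Coefficient functions of a single step\<close>

text \<open>For a matrix with one step the middle two clauses become the shift conditions of
  \<open>tame\<close>, and the comparison of the two signs becomes \<open>flip_tame\<close>.\<close>

definition coef_ok :: "(bool \<Rightarrow> nat \<Rightarrow> nat \<Rightarrow> real) \<Rightarrow> bool" where
  "coef_ok c \<longleftrightarrow> expsmall (\<lambda>_. 0) (\<lambda>(s, j, d). c s j d) \<and>
     expsmall (\<lambda>(s, j, d). j + d) (\<lambda>(s, j, d). c s j (d + 2) - c s j d) \<and>
     expsmall (\<lambda>(s, j, d). j) (\<lambda>(s, j, d). c s (j + 2) d - c s j d) \<and>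
     expsmall (\<lambda>(j, d). j + d) (\<lambda>(j, d). c True j d - c False j d)"

definition coef_small :: "(bool \<Rightarrow> nat \<Rightarrow> nat \<Rightarrow> real) \<Rightarrow> bool" where
  "coef_small c \<longleftrightarrow> expsmall (\<lambda>(s, j, d). j) (\<lambda>(s, j, d). c s j d)"

lemma econv_diff: "econv f L \<Longrightarrow> expsmall (\<lambda>n. n) (\<lambda>n. f (n + 2) - f n)"
  using econv_shift[of f L 2] unfolding econv_def
  by (rule expsmall_le_add) (auto intro: order_trans[OF _ norm_triangle_ineq4])

lemma expsmall_bool:
  assumes "\<And>s. expsmall w (g s)"
  shows "expsmall (\<lambda>p. w (snd p)) (\<lambda>(s::bool, n). g s n)"
proof (rule expsmall_le_add)
  show "expsmall (\<lambda>p. w (snd p)) (\<lambda>p :: bool \<times> _. g True (snd p))"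
    "expsmall (\<lambda>p. w (snd p)) (\<lambda>p :: bool \<times> _. g False (snd p))"
    using assms by (auto intro: expsmall_reindex)
  show "norm (case p of (s, n) \<Rightarrow> g s n) \<le> norm (g True (snd p)) + norm (g False (snd p))" for p :: "bool \<times> _"
    by (cases p; cases "fst p") auto
qed

text \<open>Shifting d changes \<psi>(d) by O(r^d), which reaches the required O(r^(j + d)) if
  \<phi>(j) itself decays; hence L = 0 unless \<psi> has period 2. The factor h may depend on the
  sign, but both signs share the limit L2, so they differ by O(r^(j + d)).\<close>

lemma coef_ok_product:
  assumes \<phi>: "econv \<phi> L" and \<psi>: "econv \<psi> L1" and h: "\<And>s. econv (h s) L2"
    and small: "L = 0 \<or> (\<forall>d. \<psi> (d + 2) = \<psi> d)"
  shows "coef_ok (\<lambda>s j d. \<phi> j * \<psi> d * h s (j + d))"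
    and "L = 0 \<Longrightarrow> coef_small (\<lambda>s j d. \<phi> j * \<psi> d * h s (j + d))"
proof -
  let ?j = "\<lambda>p :: bool \<times> nat \<times> nat. fst (snd p)" and ?d = "\<lambda>p :: bool \<times> nat \<times> nat. snd (snd p)"
  have \<phi>b: "expsmall (\<lambda>_. 0) (\<lambda>p. \<phi> (?j p))" and \<phi>b2: "expsmall (\<lambda>_. 0) (\<lambda>p. \<phi> (?j p + 2))"
    and \<psi>b: "expsmall (\<lambda>_. 0) (\<lambda>p. \<psi> (?d p))" and \<psi>b2: "expsmall (\<lambda>_. 0) (\<lambda>p. \<psi> (?d p + 2))"
    using expsmall_reindex[OF econv_bounded[OF \<phi>]] expsmall_reindex[OF econv_bounded[OF \<psi>]] by simp_all
  have hbool: "expsmall (\<lambda>_. 0) (\<lambda>(s, n). h s n)"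
    by (rule expsmall_bool) (rule econv_bounded[OF h])
  have hb: "expsmall (\<lambda>_. 0) (\<lambda>p. h (fst p) (?j p + ?d p))" and hb2: "expsmall (\<lambda>_. 0) (\<lambda>p. h (fst p) (?j p + ?d p + 2))"
    using expsmall_reindex[OF hbool, of "\<lambda>p. (fst p, ?j p + ?d p)"]
      expsmall_reindex[OF hbool, of "\<lambda>p. (fst p, ?j p + ?d p + 2)"] by simp_all
  have \<phi>d: "expsmall ?j (\<lambda>p. \<phi> (?j p + 2) - \<phi> (?j p))"
    using expsmall_reindex[OF econv_diff[OF \<phi>], of ?j] .
  have \<psi>d: "expsmall ?d (\<lambda>p. \<psi> (?d p + 2) - \<psi> (?d p))"
    using expsmall_reindex[OF econv_diff[OF \<psi>], of ?d] .
  have hd: "expsmall (\<lambda>p. ?j p + ?d p) (\<lambda>p. h (fst p) (?j p + ?d p + 2) - h (fst p) (?j p + ?d p))"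
    using expsmall_reindex[OF expsmall_bool[OF econv_diff[OF h]], of "\<lambda>p. (fst p, ?j p + ?d p)"] by simp
  have hdj: "expsmall ?j (\<lambda>p. h (fst p) (?j p + ?d p + 2) - h (fst p) (?j p + ?d p))"
    using hd by (rule expsmall_weaken[of _ _ _ 0]) auto
  have \<phi>s: "expsmall ?j (\<lambda>p. \<phi> (?j p))" if "L = 0"
    using expsmall_reindex[OF \<phi>[unfolded econv_def], of ?j] that by simp
  have \<phi>\<psi>d: "expsmall (\<lambda>p. ?j p + ?d p) (\<lambda>p. \<phi> (?j p) * (\<psi> (?d p + 2) - \<psi> (?d p)))"
    using small
  proof
    assume "L = 0"
    from expsmall_mult[OF \<phi>s[OF this] \<psi>d] show ?thesis .
  qed (simp add: expsmall_zero)
  have hTF: "expsmall (\<lambda>n. n) (\<lambda>n. h True n - h False n)"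
    by (rule expsmall_le_add[OF h[of True, unfolded econv_def] h[of False, unfolded econv_def]])
       (auto intro: order_trans[OF _ norm_triangle_ineq4])
  show "coef_ok (\<lambda>s j d. \<phi> j * \<psi> d * h s (j + d))"
    unfolding coef_ok_def
  proof (intro conjI)
    show "expsmall (\<lambda>_. 0) (\<lambda>(s, j, d). \<phi> j * \<psi> d * h s (j + d))"
      using expsmall_bounded_mult(1)[OF expsmall_bounded_mult(1)[OF \<phi>b \<psi>b] hb] by (simp add: case_prod_unfold)
    show "expsmall (\<lambda>(s, j, d). j + d) (\<lambda>(s, j, d). \<phi> j * \<psi> (d + 2) * h s (j + (d + 2)) - \<phi> j * \<psi> d * h s (j + d))"
      using expsmall_add[OF expsmall_bounded_mult(2)[OF \<phi>\<psi>d hb2] expsmall_bounded_mult(1)[OF expsmall_bounded_mult(1)[OF \<phi>b \<psi>b] hd]]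
      by (simp add: case_prod_unfold algebra_simps)
    show "expsmall (\<lambda>(s, j, d). j) (\<lambda>(s, j, d). \<phi> (j + 2) * \<psi> d * h s (j + 2 + d) - \<phi> j * \<psi> d * h s (j + d))"
      using expsmall_add[OF expsmall_bounded_mult(2)[OF expsmall_bounded_mult(2)[OF \<phi>d \<psi>b] hb2]
          expsmall_bounded_mult(1)[OF expsmall_bounded_mult(1)[OF \<phi>b \<psi>b] hdj]]
      by (simp add: case_prod_unfold algebra_simps)
    have "expsmall (\<lambda>p. fst p + snd p) (\<lambda>p. (\<phi> (fst p) * \<psi> (snd p)) * (h True (fst p + snd p) - h False (fst p + snd p)))"
      by (rule expsmall_bounded_mult(1)[OF _ expsmall_reindex[OF hTF]])
         (rule expsmall_bounded_mult(1)[OF expsmall_reindex[OF econv_bounded[OF \<phi>]] expsmall_reindex[OF econv_bounded[OF \<psi>]]])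
    then show "expsmall (\<lambda>(j, d). j + d) (\<lambda>(j, d). \<phi> j * \<psi> d * h True (j + d) - \<phi> j * \<psi> d * h False (j + d))"
      by (simp add: case_prod_unfold algebra_simps)
  qed
  show "L = 0 \<Longrightarrow> coef_small (\<lambda>s j d. \<phi> j * \<psi> d * h s (j + d))"
    unfolding coef_small_def
    using expsmall_bounded_mult(2)[OF expsmall_bounded_mult(2)[OF \<phi>s \<psi>b] hb] by (simp add: case_prod_unfold)
qed

lemma coef_ok_add:
  assumes "coef_ok c" "coef_ok c'"
  shows "coef_ok (\<lambda>s j d. c s j d + c' s j d)"
proof -
  note * = assms[unfolded coef_ok_def case_prod_unfold]
  show ?thesis
    unfolding coef_ok_def case_prod_unfold
    using expsmall_add[OF *(1)[THEN conjunct1] *(2)[THEN conjunct1]]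
      expsmall_add[OF *(1)[THEN conjunct2, THEN conjunct1] *(2)[THEN conjunct2, THEN conjunct1]]
      expsmall_add[OF *(1)[THEN conjunct2, THEN conjunct2, THEN conjunct1] *(2)[THEN conjunct2, THEN conjunct2, THEN conjunct1]]
      expsmall_add[OF *(1)[THEN conjunct2, THEN conjunct2, THEN conjunct2] *(2)[THEN conjunct2, THEN conjunct2, THEN conjunct2]]
    by (simp add: algebra_simps)
qed

text \<open>The entries that move \<open>(j + a, d + b)\<close> to \<open>(j + a', d + b')\<close>. Only the cases \<open>a = 0 \<or> a' = 0\<close> and
  \<open>b = 0 \<or> b' = 0\<close> are of interest, where \<open>c s j d\<close> is needed exactly for \<open>j, d \<ge> 0\<close>.\<close>

definition step_matrix :: "nat \<Rightarrow> nat \<Rightarrow> nat \<Rightarrow> nat \<Rightarrow> (bool \<Rightarrow> nat \<Rightarrow> nat \<Rightarrow> real) \<Rightarrow> mat" where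
  "step_matrix a a' b b' c x' x =
     (if valid x \<and> jpos x + a' = jpos x' + a \<and> dpos x + b' = dpos x' + b \<and> snd (snd x') = snd (snd x)
      then of_real (c (snd (snd x)) (jpos x - a) (dpos x - b)) else 0)"

text \<open>As a or a' is 0, and b or b' is 0, matching positions have j \<ge> a and d \<ge> b, so
  the truncated subtractions in \<open>step_matrix\<close> are exact. The weight at which the
  coefficient is evaluated falls short of that of the source by at most a + b.\<close>

lemma step_matrix_tame:
  assumes c: "coef_ok c" and ab: "a = 0 \<or> a' = 0" "b = 0 \<or> b' = 0" and small: "b \<noteq> b' \<Longrightarrow> coef_small c"
  shows "tame (step_matrix a a' b b' c)" "flip_tame (step_matrix a a' b b' c)"
proof -
  let ?M = "step_matrix a a' b b' c"
  let ?f = "\<lambda>p :: idx \<times> idx. (snd (snd (snd p)), jpos (snd p) - a, dpos (snd p) - b)"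
  have le: "a \<le> jpos x" "b \<le> dpos x" if "?M x' x \<noteq> 0" for x' x
    using that ab unfolding step_matrix_def by (auto split: if_splits)
  have vs: "valid (dshift x) = valid x" "valid (jshift x) = valid x" "valid (flip x) = valid x" for x
    by (auto simp: valid_def)
  have sgn: "snd (snd (dshift x)) = snd (snd x)" "snd (snd (jshift x)) = snd (snd x)" "snd (snd (flip x)) = (\<not> snd (snd x))" for x
    by (simp_all add: dshift_def jshift_def flip_def)
  have c': "expsmall (\<lambda>_. 0) (\<lambda>(s, j, d). c s j d)"
     "expsmall (\<lambda>(s, j, d). j + d) (\<lambda>(s, j, d). c s j (d + 2) - c s j d)"
     "expsmall (\<lambda>(s, j, d). j) (\<lambda>(s, j, d). c s (j + 2) d - c s j d)"
     "expsmall (\<lambda>(j, d). j + d) (\<lambda>(j, d). c True j d - c False j d)"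
    using c unfolding coef_ok_def by blast+
  show "tame ?M"
  proof (rule tameI[of "a + a' + b + b'"])
    show "banded (a + a' + b + b') ?M"
      by (auto simp: banded_def step_matrix_def near_def)
    show "expsmall (\<lambda>_. 0) (\<lambda>p. ?M (fst p) (snd p))"
      by (rule expsmall_transfer[OF c'(1), of _ 1 ?f _ 0]) (auto simp: step_matrix_def)
    show "expsmall wj (\<lambda>p. offdiag ?M (fst p) (snd p))"
    proof (cases "b = b'")
      case True
      then have "offdiag ?M x' x = 0" for x' x by (auto simp: offdiag_def step_matrix_def)
      then show ?thesis by (simp add: expsmall_zero)
    next
      case False
      show ?thesis
        by (rule expsmall_transfer[OF small[OF False, unfolded coef_small_def], of _ 1 ?f _ a])
           (auto simp: step_matrix_def offdiag_def)
    qed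
    show "expsmall wjd (\<lambda>p. ?M (dshift (fst p)) (dshift (snd p)) - ?M (fst p) (snd p))"
    proof (rule expsmall_transfer[OF c'(2), of _ 1 ?f _ "a + b"])
      fix p :: "idx \<times> idx"
      obtain x' x where p: "p = (x', x)" by (cases p)
      have b: "b \<le> dpos x" if "dpos x + b' = dpos x' + b" using that ab(2) by auto
      show "norm (?M (dshift (fst p)) (dshift (snd p)) - ?M (fst p) (snd p))
         \<le> 1 * norm (case ?f p of (s, j, d) \<Rightarrow> c s j (d + 2) - c s j d)"
      proof (cases "dpos x + b' = dpos x' + b")
        case True
        then have "dpos x + 2 - b = dpos x - b + 2" using b by simp
        then show ?thesis unfolding p step_matrix_def vs sgn by (simp flip: of_real_diff)
      qed (simp add: p step_matrix_def vs sgn)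
    qed (simp add: le_diff_conv; linarith)
    show "expsmall wj (\<lambda>p. ?M (jshift (fst p)) (jshift (snd p)) - ?M (fst p) (snd p))"
    proof (rule expsmall_transfer[OF c'(3), of _ 1 ?f _ "a + b"])
      fix p :: "idx \<times> idx"
      obtain x' x where p: "p = (x', x)" by (cases p)
      have a: "a \<le> jpos x" if "jpos x + a' = jpos x' + a" using that ab(1) by auto
      show "norm (?M (jshift (fst p)) (jshift (snd p)) - ?M (fst p) (snd p))
         \<le> 1 * norm (case ?f p of (s, j, d) \<Rightarrow> c s (j + 2) d - c s j d)"
      proof (cases "jpos x + a' = jpos x' + a")
        case True
        then have "jpos x + 2 - a = jpos x - a + 2" using a by simp
        then show ?thesis unfolding p step_matrix_def vs sgn by (simp flip: of_real_diff)
      qed (simp add: p step_matrix_def vs sgn)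
    qed (simp add: le_diff_conv; linarith)
  qed
  show "flip_tame ?M"
    unfolding flip_tame_def
  proof (rule expsmall_transfer[OF c'(4), of _ 1 "\<lambda>p. snd (?f p)" _ "a + b"])
    fix p :: "idx \<times> idx"
    obtain x' x where p: "p = (x', x)" by (cases p)
    show "norm (?M (flip (fst p)) (snd p) - ?M (fst p) (flip (snd p)))
       \<le> 1 * norm (case snd (?f p) of (j, d) \<Rightarrow> c True j d - c False j d)"
      unfolding p step_matrix_def vs sgn
      by (cases "snd (snd x)"; cases "snd (snd x')") (auto simp: abs_minus_commute simp flip: of_real_diff)
  qed (simp add: le_diff_conv; linarith)
qed

text \<open>Decay is measured at the source, which the product shares with its right factor; so it
  survives multiplication from the left by a bounded matrix.\<close>

lemma tame_mmult_small:
  assumes "tame M" "banded W N" and small: "expsmall wj (\<lambda>p. N (fst p) (snd p))"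
  shows "expsmall wj (\<lambda>p. mmult M N (fst p) (snd p))"
proof -
  have M: "expsmall (\<lambda>_. 0) (\<lambda>p. M (fst p) (snd p))" using assms(1) by (rule tameE)
  have "expsmall (\<lambda>p. wj (fst p)) (\<lambda>q. M (fst (fst q)) (snd q) * N (snd q) (snd (fst q)))"
    using expsmall_bounded_mult(1)[OF expsmall_reindex[OF M, of "\<lambda>q. (fst (fst q), snd q)"]
        expsmall_reindex[OF small, of "\<lambda>q. (snd q, snd (fst q))"]] by simp
  from expsmall_sum[OF this, of "\<lambda>p. nbhd W (snd p)" "(2 * W + 1) * ((2 * W + 1) * 2)" wj 0, OF finite_card_nbhd(2)]
  show ?thesis by (simp add: mmult_nbhd[OF assms(2) order_refl])
qed

abbreviation sgn_half :: "bool \<Rightarrow> real" where "sgn_half s \<equiv> (if s then 1/2 else - 1/2)"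

lemma cpt_bvec: "cpt (bvec l m N) x = (if lab x = (l, m, N) \<and> valid x then 1 else 0)"
  using lab_in_labels[of x] by (simp add: bvec.rep_eq)

text \<open>A target that does not exist would need a negative j or d; then no index x' satisfies
  the equations of the step and both sides are 0. The parity condition makes the targets of valid
  indices valid.\<close>

lemma step_matrix_bvec:
  assumes x: "valid x" "lab x = (l, m, N)"
    and ab: "a = 0 \<or> a' = 0" "b = 0 \<or> b' = 0" "even (a + a' + b + b')"
    and p: "l' = l + (real a' - real a + real b' - real b) / 2" "m' = m + (real a' - real a - (real b' - real b)) / 2"
    and c: "\<And>j d l m. l = (real (j + a) + real (d + b)) / 2 \<Longrightarrow> m = (real (j + a) - real (d + b)) / 2 \<Longrightarrow>
      odd (j + a + (d + b)) \<Longrightarrow> A l m N = c (snd (snd x)) j d"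
  shows "step_matrix a a' b b' c x' x = of_real (A l m N) * cpt (bvec l' m' N) x'"
proof -
  have l: "l = (real (jpos x) + real (dpos x)) / 2" "m = (real (jpos x) - real (dpos x)) / 2"
    "N = sgn_half (snd (snd x))"
    using x(2) by (auto simp: lab_def)
  have "lab x' = (l', m', N) \<longleftrightarrow> real (jpos x') + real (dpos x') = 2 * l' \<and> real (jpos x') - real (dpos x') = 2 * m' \<and> snd (snd x') = snd (snd x)"
    by (auto simp: lab_def l(3) field_simps split: if_splits)
  also have "\<dots> \<longleftrightarrow> real (jpos x) + real a' = real (jpos x') + real a \<and> real (dpos x) + real b' = real (dpos x') + real b \<and> snd (snd x') = snd (snd x)"
    unfolding p l(1,2) by (auto simp: field_simps)
  also have "\<dots> \<longleftrightarrow> jpos x + a' = jpos x' + a \<and> dpos x + b' = dpos x' + b \<and> snd (snd x') = snd (snd x)"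
    by (simp only: of_nat_add[symmetric] of_nat_eq_iff)
  finally have step: "lab x' = (l', m', N) \<longleftrightarrow> jpos x + a' = jpos x' + a \<and> dpos x + b' = dpos x' + b \<and> snd (snd x') = snd (snd x)" .
  show ?thesis
  proof (cases "jpos x + a' = jpos x' + a \<and> dpos x + b' = dpos x' + b \<and> snd (snd x') = snd (snd x)")
    case True
    then have le: "a \<le> jpos x" "b \<le> dpos x" using ab by auto
    have "valid x'"
    proof -
      have "even (jpos x + a' + (dpos x + b')) = even (jpos x' + a + (dpos x' + b))" using True by simp
      then show ?thesis using x(1) ab(3) by (auto simp: valid_def)
    qed
    moreover have "A l m N = c (snd (snd x)) (jpos x - a) (dpos x - b)"
      by (rule c) (use le x(1) in \<open>simp_all add: l valid_def\<close>)
    ultimately show ?thesis using True x(1) by (simp add: step_matrix_def cpt_bvec step)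
  next
    case False
    have "step_matrix a a' b b' c x' x = 0"
      unfolding step_matrix_def by (rule if_not_P) (use False in blast)
    moreover have "cpt (bvec l' m' N) x' = 0"
      unfolding cpt_bvec step by (rule if_not_P) (use False in blast)
    ultimately show ?thesis by simp
  qed
qed

section \<open>q-numbers and the coefficients in the coordinates j and d\<close>

locale podles_parameters =
  fixes q t :: real
  assumes q: "0 < q" "q < 1" and t: "0 \<le> t" "t \<le> 1"
begin

text \<open>For x \<ge> 0 the q-number [x] is \<kappa>^2 q^(-x) V(x)^2. Thus V is what remains of
  its square root after the exponential factor; it tends to 1 for large x.\<close>

definition V :: "real \<Rightarrow> real" where "V x = sqrt (1 - q powr (2 * x))"

definition \<kappa> :: real where "\<kappa> = sqrt (1 / (inverse q - q))"

lemma inverse_q: "1 < inverse q"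
  using q by (simp add: one_less_inverse)

lemma kappa_pos: "0 < \<kappa>" and kappa_sq: "\<kappa> * \<kappa> = 1 / (inverse q - q)"
  using inverse_q q by (auto simp: \<kappa>_def)

lemma q_powr_le_1: "0 \<le> x \<Longrightarrow> q powr x \<le> 1" and q_powr_less_1: "0 < x \<Longrightarrow> q powr x < 1"
  using q powr_mono2[of x q 1] powr_less_mono2[of x q 1] by auto

lemma V_pos: "0 < x \<Longrightarrow> 0 < V x" and V_nonneg: "0 \<le> x \<Longrightarrow> 0 \<le> V x"
  and V_sq: "0 \<le> x \<Longrightarrow> V x * V x = 1 - q powr (2 * x)"
  by (simp_all add: V_def q_powr_le_1 q_powr_less_1)

lemma qnum_eq: "qnum q x = \<kappa> * \<kappa> * q powr (- x) * (1 - q powr (2 * x))"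
proof -
  have "q powr (- x) * q powr (2 * x) = q powr x" by (simp flip: powr_add)
  moreover have "(- u) / (- v) = u / v" for u v :: real by simp
  from this[of "q powr (- x) - q powr x" "inverse q - q"]
  have "qnum q x = (q powr (- x) - q powr x) / (inverse q - q)" by (simp add: qnum_def)
  ultimately show ?thesis
    by (simp add: kappa_sq right_diff_distrib diff_divide_distrib)
qed

text \<open>True for negative x as well, because the real square root of HOL is odd and
  multiplicative on all reals.\<close>

lemma sqrt_qnum: "sqrt (qnum q x) = \<kappa> * q powr (- x / 2) * V x"
proof -
  have "sqrt (q powr (- x)) = q powr (- x / 2)"
    using powr_half_sqrt[of "q powr (- x)"] by (simp add: powr_powr)
  then show ?thesis using kappa_pos by (simp add: qnum_eq real_sqrt_mult V_def)
qed

lemma qnum_V: "0 \<le> x \<Longrightarrow> qnum q x = \<kappa> * \<kappa> * q powr (- x) * (V x * V x)"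
  by (simp add: qnum_eq V_sq)

text \<open>With two roots above and two below, the factors \<kappa> cancel and all powers of q
  gather in one exponent.\<close>

lemma sqrt_qnum_quotient:
  assumes "E' = E + (x3 + x4 - x1 - x2) / 2"
  shows "q powr E * sqrt (qnum q x1) * sqrt (qnum q x2) / (sqrt (qnum q x3) * sqrt (qnum q x4))
    = q powr E' * (V x1 * V x2) / (V x3 * V x4)"
proof -
  let ?c = "\<kappa> * \<kappa> * (q powr (- x3 / 2) * q powr (- x4 / 2))"
  have "q powr E * q powr (- x1 / 2) * q powr (- x2 / 2) = q powr E' * (q powr (- x3 / 2) * q powr (- x4 / 2))"
    unfolding assms powr_add[symmetric] by (rule arg_cong[of _ _ "(powr) q"]) argo
  then have "\<kappa> * \<kappa> * (q powr E * q powr (- x1 / 2) * q powr (- x2 / 2)) * (V x1 * V x2) = ?c * (q powr E' * (V x1 * V x2))"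
    by (simp add: mult_ac)
  moreover have c0: "?c \<noteq> 0" using kappa_pos q by simp
  ultimately have "q powr E * sqrt (qnum q x1) * sqrt (qnum q x2) / (sqrt (qnum q x3) * sqrt (qnum q x4))
    = (?c * (q powr E' * (V x1 * V x2))) / (?c * (V x3 * V x4))"
    unfolding sqrt_qnum by (simp only: mult_ac)
  then show ?thesis by (simp only: mult_divide_mult_cancel_left[OF c0])
qed

lemma sqrt_qnum_quotient_factor:
  assumes "E' = E + (x3 + x4 - x1 - x2) / 2"
  shows "q powr E * sqrt (qnum q x1) * sqrt (qnum q x2) * w / (sqrt (qnum q x3) * sqrt (qnum q x4))
    = q powr E' * (V x1 * V x2) * w / (V x3 * V x4)"
  using sqrt_qnum_quotient[OF assms] by (metis (no_types, lifting) times_divide_eq_left)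

lemma sqrt_qnum_quotient_qnum:
  assumes "E' = E + (2 * x3 - x1 - x2) / 2" "0 \<le> x3"
  shows "q powr E * sqrt (qnum q x1) * sqrt (qnum q x2) * w / qnum q x3
    = q powr E' * (V x1 * V x2) * w / (V x3 * V x3)"
proof -
  have "0 \<le> qnum q x3" unfolding qnum_V[OF assms(2)] using kappa_pos by simp
  then have "qnum q x3 = sqrt (qnum q x3) * sqrt (qnum q x3)" by simp
  moreover have "E' = E + (x3 + x3 - x1 - x2) / 2" using assms(1) by simp
  ultimately show ?thesis using sqrt_qnum_quotient_factor[of E' E x3 x3 x1 x2 w] by simp
qed

text \<open>In J = l + m and D = l - m each coefficient factors as \<phi>(J) \<psi>(D) h(J + D), the
  form that \<open>coef_ok_product\<close> treats.\<close>

lemma alpha_plus_eqs: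
  assumes l: "l = (J + D) / 2" "m = (J - D) / 2"
  shows "alpha_plus q t Xp l m N = (V (J + 1) * V (J + 2)) * (alpha_N q t N (l + 1) / (V (J + D + 1) * V (J + D + 2)))" (is ?thesis1)
    and "alpha_plus q t X0 l m N = (q powr (J + 1/2) * V (J + 1) * sqrt (qnum q 2)) * V (D + 1) * (alpha_N q t N (l + 1) / (V (J + D + 1) * V (J + D + 2)))" (is ?thesis2)
    and "alpha_plus q t Xm l m N = q powr (2 * J) * (V (D + 1) * V (D + 2)) * (alpha_N q t N (l + 1) / (V (J + D + 1) * V (J + D + 2)))" (is ?thesis3)
proof -
  have lm: "l + m = J" "l - m = D" "2 * l = J + D" using l by (simp_all add: field_simps)
  have e: "0 = - l + m + (2 * l + 1 + (2 * l + 2) - (l + m + 1) - (l + m + 2)) / 2"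
    "J + 1/2 = m + (2 * l + 1 + (2 * l + 2) - (l - m + 1) - (l + m + 1)) / 2"
    "2 * J = l + m + (2 * l + 1 + (2 * l + 2) - (l - m + 1) - (l - m + 2)) / 2"
    using l by argo+
  show ?thesis1
    unfolding alpha_plus.simps sqrt_qnum_quotient[OF e(1)] unfolding lm using q by simp
  show ?thesis2
    unfolding alpha_plus.simps sqrt_qnum_quotient_factor[OF e(2)] unfolding lm by simp
  show ?thesis3
    unfolding alpha_plus.simps sqrt_qnum_quotient[OF e(3)] unfolding lm by simp
qed

lemma alpha_minus_eqs:
  assumes l: "l = (J + D) / 2" "m = (J - D) / 2"
  shows "alpha_minus q t Xp l m N = - (q powr (2 * J + 1)) * (V (D - 1) * V D) * (alpha_N q t N l / (V (J + D - 1) * V (J + D)))" (is ?thesis1)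
    and "alpha_minus q t X0 l m N = (q powr (J - 1/2) * V J * sqrt (qnum q 2)) * V D * (alpha_N q t N l / (V (J + D - 1) * V (J + D)))" (is ?thesis2)
    and "alpha_minus q t Xm l m N = - (q powr (- 1)) * (V (J - 1) * V J) * (alpha_N q t N l / (V (J + D - 1) * V (J + D)))" (is ?thesis3)
proof -
  have lm: "l + m = J" "l - m = D" "2 * l = J + D" using l by (simp_all add: field_simps)
  have e: "2 * J + 1 = l + m + 1 + (2 * l - 1 + 2 * l - (l - m - 1) - (l - m)) / 2"
    "J - 1/2 = m + (2 * l - 1 + 2 * l - (l - m) - (l + m)) / 2"
    "- 1 = - l + m - 1 + (2 * l - 1 + 2 * l - (l + m - 1) - (l + m)) / 2"
    using l by argo+
  show ?thesis1
    unfolding alpha_minus.simps minus_mult_left[symmetric] minus_divide_left[symmetric] sqrt_qnum_quotient[OF e(1)] unfolding lm by simp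
  show ?thesis2
    unfolding alpha_minus.simps sqrt_qnum_quotient_factor[OF e(2)] unfolding lm by simp
  show ?thesis3
    unfolding alpha_minus.simps minus_mult_left[symmetric] minus_divide_left[symmetric] sqrt_qnum_quotient[OF e(3)] unfolding lm by simp
qed

lemma alpha_zero_eqs:
  assumes l: "l = (J + D) / 2" "m = (J - D) / 2" and n: "0 < J + D"
  shows "alpha_zero q t Xp l m N = (- (q powr (J + 3/2)) * V (J + 1) * sqrt (qnum q 2)) * V D * (beta_N q t N l / (V (J + D) * V (J + D)))" (is ?thesis1)
    and "alpha_zero q t X0 l m N = (\<kappa> * \<kappa> / q * (1 - q powr 2 - (1 - q powr 4) * q powr (2 * J)) + \<kappa> * \<kappa> * (q - q powr 3) * q powr (2 * (J + D))) * (beta_N q t N l / (V (J + D) * V (J + D)))" (is ?thesis2)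
    and "alpha_zero q t Xm l m N = (q powr (J - 1/2) * V J * sqrt (qnum q 2)) * V (D + 1) * (beta_N q t N l / (V (J + D) * V (J + D)))" (is ?thesis3)
proof -
  have lm: "l + m = J" "l - m = D" "2 * l = J + D" using l by (simp_all add: field_simps)
  have n0: "0 \<le> 2 * l" using n lm by simp
  have e: "J + 3/2 = m + 2 + (2 * (2 * l) - (l - m) - (l + m + 1)) / 2"
    "J - 1/2 = m + (2 * (2 * l) - (l - m + 1) - (l + m)) / 2"
    using l by argo+
  show ?thesis1
    unfolding alpha_zero.simps minus_mult_left[symmetric] minus_divide_left[symmetric] sqrt_qnum_quotient_qnum[OF e(1) n0] unfolding lm by simp
  show ?thesis3
    unfolding alpha_zero.simps sqrt_qnum_quotient_qnum[OF e(2) n0] unfolding lm by simp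
  have one: "q powr x * q powr y = q powr z / q" if "x + y = z - 1" for x y z
    using powr_diff[of q z 1] powr_add[of q x y] that q by simp
  have two: "q powr 2 = q * q" using powr_add[of q 1 1] q by simp
  have pw: "q powr (- (D + 1)) * q powr (- J) = q powr (- (J + D)) / q" "q powr (- D) * q powr (- (J + 1)) = q powr (- (J + D)) / q"
    "q powr (2 * (D + 1)) = q * q * q powr (2 * D)" "q powr (2 * (J + 1)) = q * q * q powr (2 * J)"
    "q powr (2 * (J + D)) = q powr (2 * J) * q powr (2 * D)" "q powr 4 = q * q * (q * q)" "q powr 3 = q * q * q" "q\<^sup>2 = q * q"
    "q powr 2 = q * q"
    using two powr_add[of q 2 2] powr_add[of q 2 1] powr_add[of q 2 "2 * D"] powr_add[of q 2 "2 * J"] powr_add[of q "2 * J" "2 * D"] q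
    by (auto simp: power2_eq_square algebra_simps intro!: one)
  have "qnum q (D + 1) * qnum q J - q\<^sup>2 * qnum q D * qnum q (J + 1)
    = \<kappa> * \<kappa> * q powr (- (J + D)) * (\<kappa> * \<kappa> / q * (1 - q powr 2 - (1 - q powr 4) * q powr (2 * J)) + \<kappa> * \<kappa> * (q - q powr 3) * q powr (2 * (J + D)))"
  proof -
    have "qnum q (D + 1) * qnum q J = \<kappa> * \<kappa> * (\<kappa> * \<kappa>) * (q powr (- (D + 1)) * q powr (- J)) * ((1 - q powr (2 * (D + 1))) * (1 - q powr (2 * J)))"
      "qnum q D * qnum q (J + 1) = \<kappa> * \<kappa> * (\<kappa> * \<kappa>) * (q powr (- D) * q powr (- (J + 1))) * ((1 - q powr (2 * D)) * (1 - q powr (2 * (J + 1))))"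
      unfolding qnum_eq by (simp_all only: mult_ac)
    note products = this[unfolded pw]
    have lin: "X = K * A \<Longrightarrow> Y = K * B \<Longrightarrow> X - c * Y = K * (A - c * B)" for X Y K A B c :: real
      by (simp add: algebra_simps)
    have "qnum q (D + 1) * qnum q J - q * q * (qnum q D * qnum q (J + 1)) =
      \<kappa> * \<kappa> * (\<kappa> * \<kappa>) * (q powr (- (J + D)) / q) * ((1 - q * q * q powr (2 * D)) * (1 - q powr (2 * J)) - q * q * ((1 - q powr (2 * D)) * (1 - q * q * q powr (2 * J))))"
      by (rule lin[OF products])
    \<comment> \<open>The terms in q^(2 D) alone cancel, leaving a function of J plus a function of
      J + D. So the diagonal entries of x_0 fit the product form with a constant \<psi>, although
      they do not decay in J.\<close>
    also have "(1 - q * q * q powr (2 * D)) * (1 - q powr (2 * J)) - q * q * ((1 - q powr (2 * D)) * (1 - q * q * q powr (2 * J)))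
       = (1 - q * q - (1 - q * q * (q * q)) * q powr (2 * J)) + q * (q - q * q * q) * (q powr (2 * J) * q powr (2 * D))"
      by (simp add: algebra_simps)
    also have "\<kappa> * \<kappa> * (\<kappa> * \<kappa>) * (q powr (- (J + D)) / q) * \<dots> = \<kappa> * \<kappa> * q powr (- (J + D)) * (\<kappa> * \<kappa> / q * (1 - q * q - (1 - q * q * (q * q)) * q powr (2 * J)) + \<kappa> * \<kappa> * (q - q * q * q) * (q powr (2 * J) * q powr (2 * D)))"
      using q by (simp add: field_simps)
    finally show ?thesis unfolding pw by (simp only: mult.assoc)
  qed
  note numerator = this
  have denominator: "qnum q (J + D) = \<kappa> * \<kappa> * q powr (- (J + D)) * (V (J + D) * V (J + D))"
    by (rule qnum_V) (use n in simp)
  have c0: "\<kappa> * \<kappa> * q powr (- (J + D)) \<noteq> 0" using kappa_pos q by simp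
  have cancel: "c * X / (c * Y) * b = X * (b / Y)" if "c \<noteq> 0" for c X Y b :: real
    using that by simp
  show ?thesis2
    unfolding alpha_zero.simps lm numerator denominator by (rule cancel[OF c0])
qed

lemma V_econv:
  assumes "0 < c" "0 \<le> e"
  shows "econv (\<lambda>n. V (c * real n + e)) 1"
proof -
  have "econv (\<lambda>n. 1 + (- 1) * q powr ((2 * c) * real n + 2 * e)) (1 + (- 1) * 0)"
    by (intro econv_add econv_mult econv_const econv_powr q) (use assms in simp)
  then have "econv (\<lambda>n. sqrt (1 + (- 1) * q powr ((2 * c) * real n + 2 * e))) (sqrt (1 + (- 1) * 0))"
    by (rule econv_sqrt) (use assms q_powr_le_1 in auto)
  then show ?thesis by (simp add: V_def algebra_simps)
qed

lemma V_nat_econv: "econv (\<lambda>n. V (real n)) 1" "econv (\<lambda>n. V (real n + 1)) 1" "econv (\<lambda>n. V (real n + 2)) 1"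
  using V_econv[of 1 0] V_econv[of 1 1] V_econv[of 1 2] by simp_all

lemma q_powr_econv: "0 < c \<Longrightarrow> econv (\<lambda>n. q powr (c * real n + e)) 0"
  by (rule econv_powr[OF q])

section \<open>Limits of the coefficients for large l\<close>

text \<open>All exponential growth cancels except in [l] / [2 l], which is of order q^l. It
  multiplies the only term under the second root that involves N, so N disappears from the
  limit.\<close>

lemma alpha_N_eq:
  assumes "0 \<le> l"
  shows "alpha_N q t N l = sqrt (qnum q 2) * q powr (1/2) * (V (l + N) * V (l - N) * V (2 * l)) * inverse (V (2 * l + 1) * (V l * V l))
    * sqrt (1 - t + q powr (- 2 * N) * (t - 1 + q powr (2 * N))\<^sup>2 * (q powr l * (V l * V l) * inverse (V (2 * l) * V (2 * l)))\<^sup>2)"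
proof -
  have pref: "sqrt (qnum q 2) * sqrt (qnum q (l + N)) * sqrt (qnum q (l - N)) * sqrt (qnum q (2 * l)) / (sqrt (qnum q (2 * l + 1)) * qnum q l)
     = sqrt (qnum q 2) * q powr (1/2) * (V (l + N) * V (l - N) * V (2 * l)) * inverse (V (2 * l + 1) * (V l * V l))"
  proof -
    let ?c = "\<kappa> * \<kappa> * \<kappa> * (q powr (- (2 * l + 1) / 2) * q powr (- l))"
    have P: "q powr (- (l + N) / 2) * q powr (- (l - N) / 2) * q powr (- (2 * l) / 2) = q powr (1/2) * (q powr (- (2 * l + 1) / 2) * q powr (- l))"
      unfolding powr_add[symmetric] by (rule arg_cong[of _ _ "(powr) q"]) argo
    have "sqrt (qnum q (l + N)) * sqrt (qnum q (l - N)) * sqrt (qnum q (2 * l)) = \<kappa> * \<kappa> * \<kappa> * (q powr (- (l + N) / 2) * q powr (- (l - N) / 2) * q powr (- (2 * l) / 2)) * (V (l + N) * V (l - N) * V (2 * l))"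
      unfolding sqrt_qnum by (simp only: mult_ac)
    also have "\<dots> = ?c * (q powr (1/2) * (V (l + N) * V (l - N) * V (2 * l)))"
      unfolding P by (simp only: mult_ac)
    finally have num: "sqrt (qnum q (l + N)) * sqrt (qnum q (l - N)) * sqrt (qnum q (2 * l)) = ?c * (q powr (1/2) * (V (l + N) * V (l - N) * V (2 * l)))" .
    have den: "sqrt (qnum q (2 * l + 1)) * qnum q l = ?c * (V (2 * l + 1) * (V l * V l))"
      unfolding sqrt_qnum qnum_V[OF assms] by (simp only: mult_ac)
    have c0: "?c \<noteq> 0" using kappa_pos q by simp
    have "sqrt (qnum q 2) * sqrt (qnum q (l + N)) * sqrt (qnum q (l - N)) * sqrt (qnum q (2 * l)) / (sqrt (qnum q (2 * l + 1)) * qnum q l)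
      = sqrt (qnum q 2) * ((sqrt (qnum q (l + N)) * sqrt (qnum q (l - N)) * sqrt (qnum q (2 * l))) / (sqrt (qnum q (2 * l + 1)) * qnum q l))"
      by (simp add: mult_ac)
    also have "\<dots> = sqrt (qnum q 2) * ((q powr (1/2) * (V (l + N) * V (l - N) * V (2 * l))) / (V (2 * l + 1) * (V l * V l)))"
      unfolding num den mult_divide_mult_cancel_left[OF c0] ..
    finally show ?thesis by (simp only: divide_inverse mult_ac)
  qed
  have "qnum q l / qnum q (2 * l) = q powr l * (V l * V l) * inverse (V (2 * l) * V (2 * l))"
  proof -
    have "q powr (- l) = q powr (- (2 * l)) * q powr l" by (simp flip: powr_add)
    then have "qnum q l = (\<kappa> * \<kappa> * q powr (- (2 * l))) * (q powr l * (V l * V l))"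
      unfolding qnum_V[OF assms] by (simp only: mult_ac)
    moreover have "qnum q (2 * l) = (\<kappa> * \<kappa> * q powr (- (2 * l))) * (V (2 * l) * V (2 * l))"
      by (rule qnum_V) (use assms in simp)
    moreover have c0: "\<kappa> * \<kappa> * q powr (- (2 * l)) \<noteq> 0" using kappa_pos q by simp
    ultimately show ?thesis by (simp only: mult_divide_mult_cancel_left[OF c0]) (simp only: divide_inverse)
  qed
  note ratio = this
  have "q powr (- 2 * N) / (qnum q (2 * l))\<^sup>2 * (qnum q l)\<^sup>2 * (t - 1 + q powr (2 * N))\<^sup>2
     = q powr (- 2 * N) * (t - 1 + q powr (2 * N))\<^sup>2 * (q powr l * (V l * V l) * inverse (V (2 * l) * V (2 * l)))\<^sup>2"
    unfolding ratio[symmetric] by (simp add: power_divide)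
  then show ?thesis unfolding alpha_N_def pref by simp
qed

text \<open>The limit of \<open>alpha_N\<close>, common to both signs; it vanishes only for t =
  1.\<close>

definition alpha_limit :: real where
  "alpha_limit = sqrt (qnum q 2) * q powr (1/2) * sqrt (1 - t)"

lemma alpha_N_econv: "econv (\<lambda>n. alpha_N q t (sgn_half s) ((real n + 2) / 2)) alpha_limit"
proof -
  let ?N = "sgn_half s"
  have V1: "econv (\<lambda>n. V ((real n + 2) / 2 + ?N)) 1" "econv (\<lambda>n. V ((real n + 2) / 2 - ?N)) 1"
    "econv (\<lambda>n. V (2 * ((real n + 2) / 2))) 1" "econv (\<lambda>n. V (2 * ((real n + 2) / 2) + 1)) 1"
    "econv (\<lambda>n. V ((real n + 2) / 2)) 1" "econv (\<lambda>n. q powr ((real n + 2) / 2)) 0"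
  proof -
    have N: "0 \<le> 1 + ?N" "0 \<le> 1 - ?N" by (cases s; simp)+
    have arg: "(real n + 2) / 2 + M = 1/2 * real n + (1 + M)" "(real n + 2) / 2 - M = 1/2 * real n + (1 - M)"
      "2 * ((real n + 2) / 2) = 1 * real n + 2" "2 * ((real n + 2) / 2) + 1 = 1 * real n + 3" "(real n + 2) / 2 = 1/2 * real n + 1" for n M
      by (simp_all add: field_simps)
    show "econv (\<lambda>n. V ((real n + 2) / 2 + ?N)) 1" unfolding arg(1) by (rule V_econv) (use N in simp_all)
    show "econv (\<lambda>n. V ((real n + 2) / 2 - ?N)) 1" unfolding arg(2) by (rule V_econv) (use N in simp_all)
    show "econv (\<lambda>n. V (2 * ((real n + 2) / 2))) 1" unfolding arg(3) by (rule V_econv) simp_all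
    show "econv (\<lambda>n. V (2 * ((real n + 2) / 2) + 1)) 1" unfolding arg(4) by (rule V_econv) simp_all
    show "econv (\<lambda>n. V ((real n + 2) / 2)) 1" unfolding arg(5) by (rule V_econv) simp_all
    show "econv (\<lambda>n. q powr ((real n + 2) / 2)) 0" unfolding arg(5) by (rule q_powr_econv) simp
  qed
  have "econv (\<lambda>n. alpha_N q t ?N ((real n + 2) / 2))
     (sqrt (qnum q 2) * q powr (1/2) * (1 * 1 * 1) * inverse (1 * (1 * 1))
       * sqrt (1 - t + q powr (- 2 * ?N) * (t - 1 + q powr (2 * ?N))\<^sup>2 * ((0 * (1 * 1) * inverse (1 * 1)) * (0 * (1 * 1) * inverse (1 * 1)))))"
    by (subst alpha_N_eq, simp, unfold power2_eq_square[of "_ * inverse _"])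
       (intro econv_mult econv_add econv_const econv_inverse econv_sqrt V1; use t in simp)
  then show ?thesis by (simp add: alpha_limit_def)
qed

text \<open>Of the numerator only - t (q - 1/q) [l] [l + 1] grows as fast as the denominator q
  [2 l + 2]; the limit of their quotient is t because 1/q - q = 1 / \<kappa>^2. The constant
  \<open>C\<close>, which carries the sign, is divided by a growing q-number.\<close>

lemma beta_N_econv: "econv (\<lambda>n. beta_N q t (sgn_half s) (real n / 2)) t"
proof -
  let ?N = "sgn_half s"
  define C where "C = sgn ?N * qnum q (2 * \<bar>?N\<bar>) * (inverse q + q - q powr (sgn ?N) * t)
    + t * (q - inverse q) * (qnum q \<bar>?N\<bar> * qnum q (\<bar>?N\<bar> + 1))"
  have k: "q - inverse q = - inverse (\<kappa> * \<kappa>)" by (simp add: kappa_sq)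
  have k0: "\<kappa> * \<kappa> \<noteq> 0" using kappa_pos by simp
  have eq: "beta_N q t ?N (real n / 2) = C * inverse (q * (\<kappa> * \<kappa>)) * q powr (1 * real n + 2) * inverse (V (real n + 2) * V (real n + 2))
     + t * ((V (1/2 * real n + 0) * V (1/2 * real n + 0)) * (V (1/2 * real n + 1) * V (1/2 * real n + 1))) * inverse (V (real n + 2) * V (real n + 2))" for n
  proof -
    define W where "W = V (real n + 2) * V (real n + 2)"
    have W: "W \<noteq> 0" using V_pos[of "real n + 2"] by (simp add: W_def)
    have n2: "qnum q (2 * (real n / 2) + 2) = \<kappa> * \<kappa> * q powr (- (real n + 2)) * W"
      using qnum_V[of "real n + 2"] by (simp add: W_def)
    have ll: "qnum q (real n / 2) * qnum q (real n / 2 + 1) = (\<kappa> * \<kappa> * q powr (- (real n + 2)) * (q * (\<kappa> * \<kappa>)))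
       * ((V (1/2 * real n + 0) * V (1/2 * real n + 0)) * (V (1/2 * real n + 1) * V (1/2 * real n + 1)))"
    proof -
      have "q powr (- (real n / 2)) * q powr (- (real n / 2 + 1)) = q powr (- (real n + 2)) * q powr 1"
        unfolding powr_add[symmetric] by (rule arg_cong[of _ _ "(powr) q"]) argo
      then have p: "q powr (- (real n / 2)) * q powr (- (real n / 2 + 1)) = q powr (- (real n + 2)) * q" using q by simp
      have "qnum q (real n / 2) * qnum q (real n / 2 + 1) = \<kappa> * \<kappa> * (\<kappa> * \<kappa>) * (q powr (- (real n / 2)) * q powr (- (real n / 2 + 1)))
         * ((V (real n / 2) * V (real n / 2)) * (V (real n / 2 + 1) * V (real n / 2 + 1)))"
        by (subst (1 2) qnum_V) (simp_all add: mult_ac)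
      then show ?thesis unfolding p by (simp add: mult_ac)
    qed
    have "beta_N q t ?N (real n / 2) = (C + t * inverse (\<kappa> * \<kappa>) * (qnum q (real n / 2) * qnum q (real n / 2 + 1))) / (q * qnum q (2 * (real n / 2) + 2))"
      unfolding beta_N_def C_def k by (simp add: algebra_simps)
    also have "\<dots> = C / (q * (\<kappa> * \<kappa> * q powr (- (real n + 2)) * W))
        + t * inverse (\<kappa> * \<kappa>) * ((\<kappa> * \<kappa> * q powr (- (real n + 2)) * (q * (\<kappa> * \<kappa>)))
       * ((V (1/2 * real n + 0) * V (1/2 * real n + 0)) * (V (1/2 * real n + 1) * V (1/2 * real n + 1)))) / (q * (\<kappa> * \<kappa> * q powr (- (real n + 2)) * W))"
      unfolding n2 ll by (rule add_divide_distrib)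
    also have "C / (q * (\<kappa> * \<kappa> * q powr (- (real n + 2)) * W)) = C * inverse (q * (\<kappa> * \<kappa>)) * q powr (1 * real n + 2) * inverse W"
    proof -
      have "C / (q * (\<kappa> * \<kappa> * inverse P * W)) = C * inverse (q * (\<kappa> * \<kappa>)) * P * inverse W" for P
        by (simp add: divide_inverse mult_ac)
      then show ?thesis by (simp only: powr_minus mult_1)
    qed
    also have "t * inverse (\<kappa> * \<kappa>) * ((\<kappa> * \<kappa> * P * (q * (\<kappa> * \<kappa>))) * X) / (q * (\<kappa> * \<kappa> * P * W)) = t * X * inverse W" if "P \<noteq> 0" for P X
      using that k0 q W by (simp add: field_simps)
    finally show ?thesis using q unfolding W_def by simp
  qed
  have "econv (\<lambda>n. beta_N q t ?N (real n / 2)) (C * inverse (q * (\<kappa> * \<kappa>)) * 0 * inverse (1 * 1)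
     + t * ((1 * 1) * (1 * 1)) * inverse (1 * 1))"
    unfolding eq
    by (intro econv_mult econv_add econv_const econv_inverse V_econv V_nat_econv q_powr_econv; simp)
  then show ?thesis by simp
qed

text \<open>One function serves both directions: raising l from n / 2 and lowering it from (n + 2) /
  2 involve the same \<open>alpha_N\<close> and the same denominators.\<close>

definition hA :: "bool \<Rightarrow> nat \<Rightarrow> real" where
  "hA s n = alpha_N q t (sgn_half s) ((real n + 2) / 2) / (V (real n + 1) * V (real n + 2))"

text \<open>Here n = 2 l, which is odd for every basis vector; at n = 0 the denominator is 0 and so
  is the value.\<close>

definition hB :: "bool \<Rightarrow> nat \<Rightarrow> real" where
  "hB s n = beta_N q t (sgn_half s) (real n / 2) / (V (real n) * V (real n))"

lemma hA_econv: "econv (hA s) alpha_limit"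
proof -
  have "econv (\<lambda>n. alpha_N q t (sgn_half s) ((real n + 2) / 2) * inverse (V (real n + 1) * V (real n + 2))) (alpha_limit * inverse (1 * 1))"
    by (intro econv_mult alpha_N_econv econv_inverse V_nat_econv) simp
  moreover have "hA s = (\<lambda>n. alpha_N q t (sgn_half s) ((real n + 2) / 2) * inverse (V (real n + 1) * V (real n + 2)))"
    by (rule ext) (simp only: hA_def divide_inverse)
  ultimately show ?thesis by (simp only: mult_1 inverse_1 mult_1_right)
qed

lemma hB_econv: "econv (hB s) t"
proof -
  have "econv (\<lambda>n. beta_N q t (sgn_half s) (real n / 2) * inverse (V (real n) * V (real n))) (t * inverse (1 * 1))"
    by (intro econv_mult beta_N_econv econv_inverse V_nat_econv) simp
  moreover have "hB s = (\<lambda>n. beta_N q t (sgn_half s) (real n / 2) * inverse (V (real n) * V (real n)))"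
    by (rule ext) (simp only: hB_def divide_inverse)
  ultimately show ?thesis by (simp only: mult_1 inverse_1 mult_1_right)
qed

lemma hB_Suc_econv: "econv (\<lambda>n. hB s (n + 1)) t"
  by (rule econv_shift[OF hB_econv])

section \<open>The generators as tame matrices\<close>

text \<open>The arguments j and d are the smaller of the positions before and after the step, as in
  \<open>step_matrix\<close>; hence the offsets against \<open>alpha_minus_eqs\<close>. A factor 1
  or a summand 0 in an exponent keeps the shape c n + e of the convergence lemmas.\<close>

fun cminus :: "generator \<Rightarrow> bool \<Rightarrow> nat \<Rightarrow> nat \<Rightarrow> real" where
  "cminus Xp s j d = - (q powr (2 * real j + 1)) * (V (real d + 1) * V (real d + 2)) * hA s (j + d)"
| "cminus X0 s j d = (q powr (1 * real j + 1/2) * V (real j + 1) * sqrt (qnum q 2)) * V (real d + 1) * hA s (j + d)"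
| "cminus Xm s j d = - (q powr (- 1)) * (V (real j + 1) * V (real j + 2)) * hA s (j + d)"

fun czero :: "generator \<Rightarrow> bool \<Rightarrow> nat \<Rightarrow> nat \<Rightarrow> real" where
  "czero Xp s j d = (- (q powr (1 * real j + 3/2)) * V (real j + 1) * sqrt (qnum q 2)) * V (real d + 1) * hB s (j + d + 1)"
| "czero X0 s j d = (\<kappa> * \<kappa> / q * (1 - q powr 2 - (1 - q powr 4) * q powr (2 * real j))
     + \<kappa> * \<kappa> * (q - q powr 3) * q powr (2 * real (j + d))) * hB s (j + d)"
| "czero Xm s j d = (q powr (1 * real j + 1/2) * V (real j + 1) * sqrt (qnum q 2)) * V (real d + 1) * hB s (j + d + 1)"

fun cplus :: "generator \<Rightarrow> bool \<Rightarrow> nat \<Rightarrow> nat \<Rightarrow> real" where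
  "cplus Xp s j d = (V (real j + 1) * V (real j + 2)) * hA s (j + d)"
| "cplus X0 s j d = (q powr (1 * real j + 1/2) * V (real j + 1) * sqrt (qnum q 2)) * V (real d + 1) * hA s (j + d)"
| "cplus Xm s j d = q powr (2 * real j + 0) * (V (real d + 1) * V (real d + 2)) * hA s (j + d)"

lemma VV_econv: "econv (\<lambda>n. V (real n + 1) * V (real n + 2)) 1"
  using econv_mult[OF V_nat_econv(2,3)] by simp

lemma decay_econv:
  "econv (\<lambda>j. q powr (1 * real j + e) * V (real j + 1) * w) 0" "econv (\<lambda>j. - (q powr (1 * real j + e)) * V (real j + 1) * w) 0"
  "econv (\<lambda>j. - (q powr (2 * real j + e))) 0"
  using econv_mult[OF econv_mult[OF q_powr_econv[of 1 e] V_nat_econv(2)] econv_const[of w]]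
    econv_mult[OF econv_mult[OF econv_mult[OF econv_const[of "- 1"] q_powr_econv[of 1 e]] V_nat_econv(2)] econv_const[of w]]
    econv_mult[OF econv_const[of "- 1"] q_powr_econv[of 2 e]]
  by simp_all

lemma czero_X0_split:
  "czero X0 = (\<lambda>s j d. (\<kappa> * \<kappa> / q * (1 - q powr 2 - (1 - q powr 4) * q powr (2 * real j + 0))) * 1 * hB s (j + d)
     + 1 * 1 * (\<kappa> * \<kappa> * (q - q powr 3) * q powr (2 * real (j + d) + 0) * hB s (j + d)))"
  by (simp add: fun_eq_iff algebra_simps)

text \<open>\<kappa>^2 (1 - q^2) / q = 1, so the diagonal entries of x_0 tend to t, the limit of
  \<open>hB\<close>. This is why t is the number to subtract from x_0.\<close>

lemma czero_X0_econv:
  "econv (\<lambda>j. \<kappa> * \<kappa> / q * (1 - q powr 2 - (1 - q powr 4) * q powr (2 * real j + 0))) 1"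
  "econv (\<lambda>n. \<kappa> * \<kappa> * (q - q powr 3) * q powr (2 * real n + 0) * hB s n) 0"
proof -
  have lim: "\<kappa> * \<kappa> / q * (1 + (- (q powr 2)) + (- (1 - q powr 4)) * 0) = 1"
  proof -
    have "q powr 2 = q * q" using powr_add[of q 1 1] q by simp
    moreover have "q * q < 1" using mult_strict_mono[of q 1 q 1] q by simp
    ultimately show ?thesis using q by (simp add: kappa_sq field_simps)
  qed
  have "econv (\<lambda>j. \<kappa> * \<kappa> / q * (1 + (- (q powr 2)) + (- (1 - q powr 4)) * q powr (2 * real j + 0)))
     (\<kappa> * \<kappa> / q * (1 + (- (q powr 2)) + (- (1 - q powr 4)) * 0))"
    by (intro econv_mult econv_add econv_const q_powr_econv) simp
  then show "econv (\<lambda>j. \<kappa> * \<kappa> / q * (1 - q powr 2 - (1 - q powr 4) * q powr (2 * real j + 0))) 1"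
    unfolding lim by (rule back_subst[of "\<lambda>f. econv f 1"]) (simp add: fun_eq_iff algebra_simps)
  have "econv (\<lambda>n. \<kappa> * \<kappa> * (q - q powr 3) * q powr (2 * real n + 0) * hB s n) (\<kappa> * \<kappa> * (q - q powr 3) * 0 * t)"
    by (intro econv_mult econv_const q_powr_econv hB_econv) simp
  then show "econv (\<lambda>n. \<kappa> * \<kappa> * (q - q powr 3) * q powr (2 * real n + 0) * hB s n) 0" by simp
qed

lemma coefs_ok: "coef_ok (cminus g)" "coef_ok (czero g)" "coef_ok (cplus g)"
proof -
  have one: "econv (\<lambda>_. 1) 1" by (rule econv_const)
  have cm: "econv (\<lambda>j. - (q powr - 1) * (V (real j + 1) * V (real j + 2))) (- (q powr - 1))"
    using econv_mult[OF econv_const[of "- (q powr - 1)"] VV_econv] by simp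
  show "coef_ok (cminus g)"
    using coef_ok_product(1)[OF decay_econv(3) VV_econv hA_econv, of 1] coef_ok_product(1)[OF decay_econv(1) V_nat_econv(2) hA_econv]
      coef_ok_product(1)[OF cm one hA_econv]
    by (cases g) (simp_all add: cminus.simps[abs_def])
  show "coef_ok (cplus g)"
    using coef_ok_product(1)[OF q_powr_econv[of 2 0] VV_econv hA_econv] coef_ok_product(1)[OF decay_econv(1) V_nat_econv(2) hA_econv]
      coef_ok_product(1)[OF VV_econv one hA_econv]
    by (cases g) (simp_all add: cplus.simps[abs_def])
  have "coef_ok (czero X0)"
    unfolding czero_X0_split
    by (rule coef_ok_add[OF coef_ok_product(1)[OF czero_X0_econv(1) one hB_econv]
        coef_ok_product(1)[OF one one czero_X0_econv(2)]]) auto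
  then show "coef_ok (czero g)"
    using coef_ok_product(1)[OF decay_econv(2) V_nat_econv(2) hB_Suc_econv] coef_ok_product(1)[OF decay_econv(1) V_nat_econv(2) hB_Suc_econv]
    by (cases g) (simp_all add: czero.simps[abs_def])
qed

text \<open>The three excluded steps are those that keep d; all others carry a factor q^j or q^(2
  j).\<close>

lemma coefs_small: "g \<noteq> Xm \<Longrightarrow> coef_small (cminus g)" "g \<noteq> X0 \<Longrightarrow> coef_small (czero g)" "g \<noteq> Xp \<Longrightarrow> coef_small (cplus g)"
proof -
  show "coef_small (cminus g)" if "g \<noteq> Xm"
    using that coef_ok_product(2)[OF decay_econv(3) VV_econv hA_econv, of 1] coef_ok_product(2)[OF decay_econv(1) V_nat_econv(2) hA_econv]
    by (cases g) (simp_all add: cminus.simps[abs_def])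
  show "coef_small (cplus g)" if "g \<noteq> Xp"
    using that coef_ok_product(2)[OF q_powr_econv[of 2 0] VV_econv hA_econv] coef_ok_product(2)[OF decay_econv(1) V_nat_econv(2) hA_econv]
    by (cases g) (simp_all add: cplus.simps[abs_def])
  show "coef_small (czero g)" if "g \<noteq> X0"
    using that coef_ok_product(2)[OF decay_econv(2) V_nat_econv(2) hB_Suc_econv] coef_ok_product(2)[OF decay_econv(1) V_nat_econv(2) hB_Suc_econv]
    by (cases g) (simp_all add: czero.simps[abs_def])
qed

fun mminus :: "generator \<Rightarrow> mat" where
  "mminus Xp = step_matrix 0 0 2 0 (cminus Xp)"
| "mminus X0 = step_matrix 1 0 1 0 (cminus X0)"
| "mminus Xm = step_matrix 2 0 0 0 (cminus Xm)"

fun mzero :: "generator \<Rightarrow> mat" where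
  "mzero Xp = step_matrix 0 1 1 0 (czero Xp)"
| "mzero X0 = step_matrix 0 0 0 0 (czero X0)"
| "mzero Xm = step_matrix 1 0 0 1 (czero Xm)"

fun mplus :: "generator \<Rightarrow> mat" where
  "mplus Xp = step_matrix 0 2 0 0 (cplus Xp)"
| "mplus X0 = step_matrix 0 1 0 1 (cplus X0)"
| "mplus Xm = step_matrix 0 0 0 2 (cplus Xm)"

lemma m_tame: "tame (mminus g)" "tame (mzero g)" "tame (mplus g)"
  and m_flip_tame: "flip_tame (mminus g)" "flip_tame (mzero g)" "flip_tame (mplus g)"
  by (cases g; simp add: step_matrix_tame coefs_ok coefs_small)+

definition gen_matrix :: "generator \<Rightarrow> mat" where
  "gen_matrix g x' x = mminus g x' x + mzero g x' x + mplus g x' x"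

lemma gen_matrix_tame: "tame (gen_matrix g)" and gen_matrix_flip_tame: "flip_tame (gen_matrix g)"
  using tame_add[OF tame_add[OF m_tame(1,2)] m_tame(3)] flip_tame_add[OF flip_tame_add[OF m_flip_tame(1,2)] m_flip_tame(3)]
  by (simp_all add: gen_matrix_def[abs_def])

lemma alpha_minus_eq_cminus:
  assumes N: "N = sgn_half s"
  shows "l = (real (j + 0) + real (d + 2)) / 2 \<Longrightarrow> m = (real (j + 0) - real (d + 2)) / 2 \<Longrightarrow> odd (j + 0 + (d + 2)) \<Longrightarrow> alpha_minus q t Xp l m N = cminus Xp s j d" (is "_ \<Longrightarrow> _ \<Longrightarrow> _ \<Longrightarrow> ?thesis1")
    and "l = (real (j + 1) + real (d + 1)) / 2 \<Longrightarrow> m = (real (j + 1) - real (d + 1)) / 2 \<Longrightarrow> odd (j + 1 + (d + 1)) \<Longrightarrow> alpha_minus q t X0 l m N = cminus X0 s j d" (is "_ \<Longrightarrow> _ \<Longrightarrow> _ \<Longrightarrow> ?thesis2")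
    and "l = (real (j + 2) + real (d + 0)) / 2 \<Longrightarrow> m = (real (j + 2) - real (d + 0)) / 2 \<Longrightarrow> odd (j + 2 + (d + 0)) \<Longrightarrow> alpha_minus q t Xm l m N = cminus Xm s j d" (is "_ \<Longrightarrow> _ \<Longrightarrow> _ \<Longrightarrow> ?thesis3")
proof -
  show ?thesis1
    if l: "l = (real (j + 0) + real (d + 2)) / 2" and m: "m = (real (j + 0) - real (d + 2)) / 2" and "odd (j + 0 + (d + 2))"
    unfolding alpha_minus_eqs(1)[OF l m] unfolding cminus.simps hA_def N l by (simp add: algebra_simps)
  show ?thesis2
    if l: "l = (real (j + 1) + real (d + 1)) / 2" and m: "m = (real (j + 1) - real (d + 1)) / 2" and "odd (j + 1 + (d + 1))"
    unfolding alpha_minus_eqs(2)[OF l m] unfolding cminus.simps hA_def N l by (simp add: algebra_simps)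
  show ?thesis3
    if l: "l = (real (j + 2) + real (d + 0)) / 2" and m: "m = (real (j + 2) - real (d + 0)) / 2" and "odd (j + 2 + (d + 0))"
    unfolding alpha_minus_eqs(3)[OF l m] unfolding cminus.simps hA_def N l by (simp add: algebra_simps)
qed

lemma alpha_zero_eq_czero:
  assumes N: "N = sgn_half s"
  shows "l = (real (j + 0) + real (d + 1)) / 2 \<Longrightarrow> m = (real (j + 0) - real (d + 1)) / 2 \<Longrightarrow> odd (j + 0 + (d + 1)) \<Longrightarrow> alpha_zero q t Xp l m N = czero Xp s j d" (is "_ \<Longrightarrow> _ \<Longrightarrow> _ \<Longrightarrow> ?thesis1")
    and "l = (real (j + 0) + real (d + 0)) / 2 \<Longrightarrow> m = (real (j + 0) - real (d + 0)) / 2 \<Longrightarrow> odd (j + 0 + (d + 0)) \<Longrightarrow> alpha_zero q t X0 l m N = czero X0 s j d" (is "_ \<Longrightarrow> _ \<Longrightarrow> _ \<Longrightarrow> ?thesis2")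
    and "l = (real (j + 1) + real (d + 0)) / 2 \<Longrightarrow> m = (real (j + 1) - real (d + 0)) / 2 \<Longrightarrow> odd (j + 1 + (d + 0)) \<Longrightarrow> alpha_zero q t Xm l m N = czero Xm s j d" (is "_ \<Longrightarrow> _ \<Longrightarrow> _ \<Longrightarrow> ?thesis3")
proof -
  show ?thesis1
    if l: "l = (real (j + 0) + real (d + 1)) / 2" and m: "m = (real (j + 0) - real (d + 1)) / 2" and "odd (j + 0 + (d + 1))"
  proof -
    have n: "0 < real (j + 0) + real (d + 1)" using that(3) by (cases "j + 0 + (d + 1)") (auto simp flip: of_nat_add)
    show ?thesis unfolding alpha_zero_eqs(1)[OF l m n] unfolding czero.simps hB_def N l by (simp add: algebra_simps)
  qed
  show ?thesis2
    if l: "l = (real (j + 0) + real (d + 0)) / 2" and m: "m = (real (j + 0) - real (d + 0)) / 2" and "odd (j + 0 + (d + 0))"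
  proof -
    have n: "0 < real (j + 0) + real (d + 0)" using that(3) by (cases "j + 0 + (d + 0)") (auto simp flip: of_nat_add)
    show ?thesis unfolding alpha_zero_eqs(2)[OF l m n] unfolding czero.simps hB_def N l by (simp add: algebra_simps)
  qed
  show ?thesis3
    if l: "l = (real (j + 1) + real (d + 0)) / 2" and m: "m = (real (j + 1) - real (d + 0)) / 2" and "odd (j + 1 + (d + 0))"
  proof -
    have n: "0 < real (j + 1) + real (d + 0)" using that(3) by (cases "j + 1 + (d + 0)") (auto simp flip: of_nat_add)
    show ?thesis unfolding alpha_zero_eqs(3)[OF l m n] unfolding czero.simps hB_def N l by (simp add: algebra_simps)
  qed
qed

lemma alpha_plus_eq_cplus:
  assumes N: "N = sgn_half s"
  shows "l = (real (j + 0) + real (d + 0)) / 2 \<Longrightarrow> m = (real (j + 0) - real (d + 0)) / 2 \<Longrightarrow> odd (j + 0 + (d + 0)) \<Longrightarrow> alpha_plus q t Xp l m N = cplus Xp s j d" (is "_ \<Longrightarrow> _ \<Longrightarrow> _ \<Longrightarrow> ?thesis1")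
    and "l = (real (j + 0) + real (d + 0)) / 2 \<Longrightarrow> m = (real (j + 0) - real (d + 0)) / 2 \<Longrightarrow> odd (j + 0 + (d + 0)) \<Longrightarrow> alpha_plus q t X0 l m N = cplus X0 s j d" (is "_ \<Longrightarrow> _ \<Longrightarrow> _ \<Longrightarrow> ?thesis2")
    and "l = (real (j + 0) + real (d + 0)) / 2 \<Longrightarrow> m = (real (j + 0) - real (d + 0)) / 2 \<Longrightarrow> odd (j + 0 + (d + 0)) \<Longrightarrow> alpha_plus q t Xm l m N = cplus Xm s j d" (is "_ \<Longrightarrow> _ \<Longrightarrow> _ \<Longrightarrow> ?thesis3")
proof -
  show ?thesis1
    if l: "l = (real (j + 0) + real (d + 0)) / 2" and m: "m = (real (j + 0) - real (d + 0)) / 2" and "odd (j + 0 + (d + 0))"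
    unfolding alpha_plus_eqs(1)[OF l m] unfolding cplus.simps hA_def N l by (simp add: algebra_simps add_divide_distrib)
  show ?thesis2
    if l: "l = (real (j + 0) + real (d + 0)) / 2" and m: "m = (real (j + 0) - real (d + 0)) / 2" and "odd (j + 0 + (d + 0))"
    unfolding alpha_plus_eqs(2)[OF l m] unfolding cplus.simps hA_def N l by (simp add: algebra_simps add_divide_distrib)
  show ?thesis3
    if l: "l = (real (j + 0) + real (d + 0)) / 2" and m: "m = (real (j + 0) - real (d + 0)) / 2" and "odd (j + 0 + (d + 0))"
    unfolding alpha_plus_eqs(3)[OF l m] unfolding cplus.simps hA_def N l by (simp add: algebra_simps add_divide_distrib)
qed

lemma m_bvec:
  assumes x: "valid x" "lab x = (l, m, N)"
  shows "mminus g x' x = of_real (alpha_minus q t g l m N) * cpt (bvec (l - 1) (m + shift g) N) x'" (is ?thesis1)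
    and "mzero g x' x = of_real (alpha_zero q t g l m N) * cpt (bvec (l) (m + shift g) N) x'" (is ?thesis2)
    and "mplus g x' x = of_real (alpha_plus q t g l m N) * cpt (bvec (l + 1) (m + shift g) N) x'" (is ?thesis3)
proof -
  have N: "N = sgn_half (snd (snd x))" using x(2) by (simp add: lab_def)
  show ?thesis1
  proof (cases g)
    case Xm
    have "step_matrix 2 0 0 0 (cminus Xm) x' x = of_real (alpha_minus q t Xm l m N) * cpt (bvec (l - 1) (m + shift Xm) N) x'"
      by (rule step_matrix_bvec[where A = "alpha_minus q t Xm", OF x]) ((rule alpha_minus_eq_cminus(3)[OF N]; assumption) | simp)+
    with Xm show ?thesis by simp
  next
    case X0
    have "step_matrix 1 0 1 0 (cminus X0) x' x = of_real (alpha_minus q t X0 l m N) * cpt (bvec (l - 1) (m + shift X0) N) x'"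
      by (rule step_matrix_bvec[where A = "alpha_minus q t X0", OF x]) ((rule alpha_minus_eq_cminus(2)[OF N]; assumption) | simp)+
    with X0 show ?thesis by simp
  next
    case Xp
    have "step_matrix 0 0 2 0 (cminus Xp) x' x = of_real (alpha_minus q t Xp l m N) * cpt (bvec (l - 1) (m + shift Xp) N) x'"
      by (rule step_matrix_bvec[where A = "alpha_minus q t Xp", OF x]) ((rule alpha_minus_eq_cminus(1)[OF N]; assumption) | simp)+
    with Xp show ?thesis by simp
  qed
  show ?thesis2
  proof (cases g)
    case Xm
    have "step_matrix 1 0 0 1 (czero Xm) x' x = of_real (alpha_zero q t Xm l m N) * cpt (bvec (l) (m + shift Xm) N) x'"
      by (rule step_matrix_bvec[where A = "alpha_zero q t Xm", OF x]) ((rule alpha_zero_eq_czero(3)[OF N]; assumption) | simp)+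
    with Xm show ?thesis by simp
  next
    case X0
    have "step_matrix 0 0 0 0 (czero X0) x' x = of_real (alpha_zero q t X0 l m N) * cpt (bvec (l) (m + shift X0) N) x'"
      by (rule step_matrix_bvec[where A = "alpha_zero q t X0", OF x]) ((rule alpha_zero_eq_czero(2)[OF N]; assumption) | simp)+
    with X0 show ?thesis by simp
  next
    case Xp
    have "step_matrix 0 1 1 0 (czero Xp) x' x = of_real (alpha_zero q t Xp l m N) * cpt (bvec (l) (m + shift Xp) N) x'"
      by (rule step_matrix_bvec[where A = "alpha_zero q t Xp", OF x]) ((rule alpha_zero_eq_czero(1)[OF N]; assumption) | simp)+
    with Xp show ?thesis by simp
  qed
  show ?thesis3
  proof (cases g)
    case Xm
    have "step_matrix 0 0 0 2 (cplus Xm) x' x = of_real (alpha_plus q t Xm l m N) * cpt (bvec (l + 1) (m + shift Xm) N) x'"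
      by (rule step_matrix_bvec[where A = "alpha_plus q t Xm", OF x]) ((rule alpha_plus_eq_cplus(3)[OF N]; assumption) | simp)+
    with Xm show ?thesis by simp
  next
    case X0
    have "step_matrix 0 1 0 1 (cplus X0) x' x = of_real (alpha_plus q t X0 l m N) * cpt (bvec (l + 1) (m + shift X0) N) x'"
      by (rule step_matrix_bvec[where A = "alpha_plus q t X0", OF x]) ((rule alpha_plus_eq_cplus(2)[OF N]; assumption) | simp)+
    with X0 show ?thesis by simp
  next
    case Xp
    have "step_matrix 0 2 0 0 (cplus Xp) x' x = of_real (alpha_plus q t Xp l m N) * cpt (bvec (l + 1) (m + shift Xp) N) x'"
      by (rule step_matrix_bvec[where A = "alpha_plus q t Xp", OF x]) ((rule alpha_plus_eq_cplus(1)[OF N]; assumption) | simp)+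
    with Xp show ?thesis by simp
  qed
qed

lemma gen_matrix_valid: "gen_matrix g x' x \<noteq> 0 \<Longrightarrow> valid x' \<and> valid x"
proof -
  assume nz: "gen_matrix g x' x \<noteq> 0"
  have "valid x"
    using nz by (cases g) (auto simp: gen_matrix_def step_matrix_def split: if_splits)
  moreover have "valid x'"
  proof (rule ccontr)
    assume "\<not> valid x'"
    then have "gen_matrix g x' x = 0"
      unfolding gen_matrix_def using m_bvec[OF \<open>valid x\<close>, of _ _ _ g x'] by (cases "lab x") (simp add: cpt_invalid)
    with nz show False by simp
  qed
  ultimately show ?thesis by simp
qed

abbreviation generator_image :: "generator \<Rightarrow> real \<Rightarrow> real \<Rightarrow> real \<Rightarrow> spinor" where
  "generator_image g l m N \<equiv> scaleC (of_real (alpha_minus q t g l m N)) (bvec (l - 1) (m + shift g) N)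
      + scaleC (of_real (alpha_zero q t g l m N)) (bvec l (m + shift g) N)
      + scaleC (of_real (alpha_plus q t g l m N)) (bvec (l + 1) (m + shift g) N)"

text \<open>The definite description has a solution because \<open>gen_matrix\<close> belongs to a
  bounded operator, and only one because bounded operators are determined on basis vectors.\<close>

lemma generator_op_entry: "bounded_op (generator_op q t g)" "entry (generator_op q t g) = gen_matrix g"
proof -
  obtain a where a: "bounded_op a" "entry a = gen_matrix g"
    by (rule tame_operator[OF gen_matrix_tame gen_matrix_valid]) auto
  let ?P = "\<lambda>a. bounded_op a \<and> (\<forall>(l, m, N) \<in> labels. a (bvec l m N) = generator_image g l m N)"
  have "?P a"
  proof (intro conjI a(1) ballI)
    fix i assume "i \<in> labels"
    then obtain x where x: "valid x" "i = lab x" unfolding labels_eq by auto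
    obtain l m N where lab: "lab x = (l, m, N)" by (cases "lab x")
    have "a (bvec l m N) = generator_image g l m N"
    proof (rule spinor_cpt_eqI)
      fix x'
      have "cpt (a (bvec l m N)) x' = gen_matrix g x' x"
        unfolding a(2)[symmetric] entry_def ket_def lab by simp
      then show "cpt (a (bvec l m N)) x' = cpt (generator_image g l m N) x'"
        by (simp add: gen_matrix_def m_bvec[OF x(1) lab])
    qed
    then show "case i of (l, m, N) \<Rightarrow> a (bvec l m N) = generator_image g l m N"
      by (simp add: x lab)
  qed
  moreover have "b = a" if b: "?P b" for b
  proof (rule bounded_op_ext)
    show "bounded_op b" using b by blast
    show "b (ket x) = a (ket x)" if "valid x" for x
    proof -
      obtain l m N where lab: "lab x = (l, m, N)" by (cases "lab x")
      then have "(l, m, N) \<in> labels" using that lab_in_labels[of x] by simp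
      then have "b (bvec l m N) = a (bvec l m N)" using b \<open>?P a\<close> by fastforce
      then show ?thesis by (simp add: ket_def lab)
    qed
  qed (rule a)
  ultimately have "generator_op q t g = a"
    unfolding generator_op_def by (intro the_equality) blast+
  with a show "bounded_op (generator_op q t g)" "entry (generator_op q t g) = gen_matrix g" by simp_all
qed

lemma flip_good_podles_rep: "flip_good (podles_rep q t e)"
proof (induction e)
  case (Gen g)
  then show ?case
    by (simp add: flip_good_def good_def generator_op_entry gen_matrix_tame gen_matrix_flip_tame)
qed (simp_all add: flip_good_combine flip_good_combine(3)[unfolded o_def] o_def)

text \<open>Every expression lies in its own class, so the classes exhaust all expressions.\<close>

lemma podles_image_eq: "podles_image q t = range (podles_rep q t)"
proof -
  have "\<Union>(podles_algebra q t) = UNIV"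
    unfolding podles_algebra_def quotient_def by (auto intro: podles_eq.refl)
  then show ?thesis by (simp only: podles_image_def flip: image_Union)
qed

end

section \<open>The element y^* y and its trace over the shells\<close>

lemma coef_small_add: "coef_small c \<Longrightarrow> coef_small c' \<Longrightarrow> coef_small (\<lambda>s j d. c s j d + c' s j d)"
  unfolding coef_small_def case_prod_unfold by (rule expsmall_add)

lemma step_matrix_small:
  assumes "coef_small c"
  shows "expsmall wj (\<lambda>p. step_matrix a a' b b' c (fst p) (snd p))"
  by (rule expsmall_transfer[OF assms[unfolded coef_small_def], of _ 1 "\<lambda>p. (snd (snd (snd p)), jpos (snd p) - a, dpos (snd p) - b)" _ a])
     (auto simp: step_matrix_def)

lemma step_matrix_diagonal: "step_matrix 0 0 0 0 c x' x = (if x' = x \<and> valid x then of_real (c (snd (snd x)) (jpos x) (dpos x)) else 0)"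
  by (auto simp: step_matrix_def prod_eq_iff)

context podles_parameters
begin

definition shifted_x0 :: expr where "shifted_x0 = Plus (Gen X0) (RConst (- t))"

abbreviation "Y \<equiv> entry (podles_rep q t shifted_x0)"

lemma Y_eq: "Y x' x = mminus X0 x' x + mplus X0 x' x + step_matrix 0 0 0 0 (\<lambda>s j d. czero X0 s j d - t) x' x"
proof -
  have "podles_rep q t shifted_x0 = (\<lambda>v. generator_op q t X0 v + scaleC (of_real (- t)) (id v))"
    by (simp add: shifted_x0_def)
  then have "Y x' x = gen_matrix X0 x' x + of_real (- t) * entry id x' x"
    by (simp only: entry_add entry_scaleC generator_op_entry)
  also have "\<dots> = mminus X0 x' x + mplus X0 x' x + (mzero X0 x' x + of_real (- t) * entry id x' x)"
    by (simp add: gen_matrix_def)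
  also have "mzero X0 x' x + of_real (- t) * entry id x' x = step_matrix 0 0 0 0 (\<lambda>s j d. czero X0 s j d - t) x' x"
    by (simp add: step_matrix_diagonal entry_id)
  finally show ?thesis .
qed

text \<open>With h for \<open>hB\<close>, the coefficient splits into (\<phi>(j) - 1) h, h - t and a
  term of order q^(2 (j + d)). The first decays in j, the others in j + d and therefore in
  j.\<close>

lemma czero_X0_small: "coef_small (\<lambda>s j d. czero X0 s j d - t)"
proof -
  let ?\<phi> = "\<lambda>j. \<kappa> * \<kappa> / q * (1 - q powr 2 - (1 - q powr 4) * q powr (2 * real j + 0))"
  have h0: "econv (\<lambda>n. hB s n + (- t)) 0" for s
    using econv_add[OF hB_econv econv_const[of "- t"]] by simp
  have "econv (\<lambda>j. ?\<phi> j + (- 1)) 0"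
    using econv_add[OF czero_X0_econv(1) econv_const[of "- 1"]] by simp
  then have 1: "coef_small (\<lambda>s j d. (?\<phi> j + (- 1)) * 1 * hB s (j + d))"
    by (rule coef_ok_product(2)[OF _ econv_const hB_econv]) auto
  have tail: "coef_small (\<lambda>s j d. h s (j + d))" if "\<And>s. econv (h s) 0" for h
  proof -
    have "expsmall (\<lambda>p. snd p) (\<lambda>(s, n). h s n)"
      by (rule expsmall_bool) (use that in \<open>simp add: econv_def\<close>)
    then have "expsmall (\<lambda>p. fst (snd p)) (\<lambda>p. h (fst p) (fst (snd p) + snd (snd p)))"
      by (rule expsmall_transfer[of _ _ _ 1 "\<lambda>p. (fst p, fst (snd p) + snd (snd p))" _ 0]) auto
    then show ?thesis by (simp add: coef_small_def case_prod_unfold)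
  qed
  from coef_small_add[OF coef_small_add[OF 1 tail[of "\<lambda>s n. hB s n + (- t)", OF h0]]
      tail[of "\<lambda>s n. \<kappa> * \<kappa> * (q - q powr 3) * q powr (2 * real n + 0) * hB s n", OF czero_X0_econv(2)]]
  show ?thesis
    by (rule back_subst[of coef_small]) (simp add: fun_eq_iff algebra_simps)
qed

lemma Y_small: "expsmall wj (\<lambda>p. Y (fst p) (snd p))"
  unfolding Y_eq using coefs_small(1)[of X0] coefs_small(3)[of X0] czero_X0_small
  by (intro expsmall_add) (simp_all add: step_matrix_small)

text \<open>A positive element: its diagonal entries are sums of squares, so no cancellation can
  occur in the trace.\<close>

definition square_x0 :: "spinor \<Rightarrow> spinor" where
  "square_x0 = podles_rep q t (Times (Star shifted_x0) shifted_x0)"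

lemma square_x0_entry: "entry square_x0 = mmult (\<lambda>x' x. cnj (Y x x')) Y"
  and square_x0_small: "expsmall wj (\<lambda>p. entry square_x0 (fst p) (snd p))"
proof -
  have g: "good (podles_rep q t shifted_x0)" using flip_good_podles_rep by (simp add: flip_good_def)
  then obtain W where W: "banded W Y" by (rule goodE)
  obtain V where V: "bounded_op (adjoint_op (podles_rep q t shifted_x0))" "banded V (entry (adjoint_op (podles_rep q t shifted_x0)))"
    "tame (entry (adjoint_op (podles_rep q t shifted_x0)))"
    using good_adjoint(1)[OF g] by (rule goodE)
  show eq: "entry square_x0 = mmult (\<lambda>x' x. cnj (Y x x')) Y"
    using entry_comp[OF V(1,2) W] by (simp add: square_x0_def good_adjoint(2)[OF g])
  show "expsmall wj (\<lambda>p. entry square_x0 (fst p) (snd p))"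
    unfolding eq using V(3) by (intro tame_mmult_small[OF _ W Y_small]) (simp add: good_adjoint(2)[OF g])
qed

lemma square_x0_diagonal: "entry square_x0 x x = of_real (\<Sum>y | Y y x \<noteq> 0. (cmod (Y y x))\<^sup>2)"
  unfolding square_x0_entry mmult_def
  by (simp add: complex_norm_square mult.commute del: of_real_power)

lemma square_x0_ge: "(cmod (Y y x))\<^sup>2 \<le> Re (entry square_x0 x x)" and square_x0_nonneg: "0 \<le> Re (entry square_x0 x x)"
proof -
  have "good (podles_rep q t shifted_x0)" using flip_good_podles_rep by (simp add: flip_good_def)
  then obtain W where W: "banded W Y" by (rule goodE)
  have fin: "finite {y. Y y x \<noteq> 0}"
    by (rule finite_subset[OF _ finite_card_nbhd(1)[of W x]]) (use nbhd_if_banded(2)[OF W] in blast)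
  show "0 \<le> Re (entry square_x0 x x)" unfolding square_x0_diagonal by (simp add: sum_nonneg)
  show "(cmod (Y y x))\<^sup>2 \<le> Re (entry square_x0 x x)"
  proof (cases "Y y x = 0")
    case True
    then show ?thesis unfolding square_x0_diagonal by (simp add: sum_nonneg)
  next
    case False
    then show ?thesis
      unfolding square_x0_diagonal Re_complex_of_real by (intro member_le_sum fin) auto
  qed
qed

text \<open>The trace of y^* y dominates the square of every single entry of y on the shell. The
  column j = 0 is taken because it meets every shell and the entries along it have explicit
  limits.\<close>

lemma Y_tendsto_0:
  assumes "shell_trace (entry square_x0) \<longlonglongrightarrow> 0"
  shows "(\<lambda>k. Y (y k) (0, 2 * k + 1, True)) \<longlonglongrightarrow> 0"
proof -
  have le: "(cmod (Y (y k) (0, 2 * k + 1, True)))\<^sup>2 \<le> cmod (shell_trace (entry square_x0) k)" for k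
  proof -
    let ?e = "\<lambda>j s. Re (entry square_x0 (j, 2 * k + 1 - j, s) (j, 2 * k + 1 - j, s))"
    have "(cmod (Y (y k) (0, 2 * k + 1, True)))\<^sup>2 \<le> ?e 0 True"
      using square_x0_ge[of "y k" "(0, 2 * k + 1, True)"] by simp
    also have "\<dots> \<le> (\<Sum>s\<in>UNIV. ?e 0 s)"
      by (rule member_le_sum[of True UNIV "?e 0"]) (auto intro: square_x0_nonneg)
    also have "\<dots> \<le> (\<Sum>j\<le>2 * k + 1. \<Sum>s\<in>UNIV. ?e j s)"
      by (rule member_le_sum[of 0 "{..2 * k + 1}" "\<lambda>j. \<Sum>s\<in>UNIV. ?e j s"]) (auto intro!: sum_nonneg square_x0_nonneg)
    also have "\<dots> = Re (shell_trace (entry square_x0) k)" by (simp only: shell_trace_def Re_sum)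
    also have "\<dots> \<le> cmod (shell_trace (entry square_x0) k)" by (rule complex_Re_le_cmod)
    finally show ?thesis .
  qed
  have "(\<lambda>k. (cmod (Y (y k) (0, 2 * k + 1, True)))\<^sup>2) \<longlonglongrightarrow> 0"
    by (rule Lim_null_comparison[OF _ tendsto_norm_zero[OF assms]]) (use le in \<open>auto intro!: always_eventually\<close>)
  then have "(\<lambda>k. sqrt ((cmod (Y (y k) (0, 2 * k + 1, True)))\<^sup>2)) \<longlonglongrightarrow> sqrt 0"
    by (rule tendsto_real_sqrt)
  then have "(\<lambda>k. cmod (Y (y k) (0, 2 * k + 1, True))) \<longlonglongrightarrow> 0" by simp
  then show ?thesis by (rule tendsto_norm_zero_cancel)
qed

lemma shell_trace_square_x0_nonzero: "\<not> shell_trace (entry square_x0) \<longlonglongrightarrow> 0"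
proof
  assume lim: "shell_trace (entry square_x0) \<longlonglongrightarrow> 0"
  have sub: "(\<lambda>k. f (2 * k + 1)) \<longlonglongrightarrow> L" if "econv f L" for f L
    using LIMSEQ_subseq_LIMSEQ[OF econv_tendsto[OF that], of "\<lambda>k. 2 * k + 1"] by (simp add: o_def strict_mono_def)
  have valid: "valid (0, 2 * k + 1, True)" for k by (simp add: valid_def)
  have "t = 0"
  proof -
    have "Y (0, 2 * k + 1, True) (0, 2 * k + 1, True) = of_real (czero X0 True 0 (2 * k + 1) - t)" for k
      unfolding Y_eq step_matrix_diagonal using valid[of k] by (simp add: step_matrix_def del: czero.simps)
    with Y_tendsto_0[OF lim, of "\<lambda>k. (0, 2 * k + 1, True)"]
    have "(\<lambda>k. of_real (czero X0 True 0 (2 * k + 1) - t) :: complex) \<longlonglongrightarrow> of_real 0" by simp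
    then have l0: "(\<lambda>k. czero X0 True 0 (2 * k + 1) - t) \<longlonglongrightarrow> 0" unfolding tendsto_of_real_iff .
    \<comment> \<open>At j = 0 the power q^(2 j) is 1 and this constant equals - q^2, so the
      diagonal entry tends to - (q^2 + 1) t.\<close>
    let ?c = "\<kappa> * \<kappa> / q * (1 - q powr 2 - (1 - q powr 4))"
    have eq: "czero X0 True 0 (2 * k + 1) - t = ?c * hB True (2 * k + 1) + \<kappa> * \<kappa> * (q - q powr 3) * q powr (2 * real (2 * k + 1) + 0) * hB True (2 * k + 1) - t" for k
      using q by (simp add: field_simps)
    have "(\<lambda>k. czero X0 True 0 (2 * k + 1) - t) \<longlonglongrightarrow> ?c * t + 0 - t"
      unfolding eq
      by (intro tendsto_diff tendsto_add tendsto_mult tendsto_const sub[OF hB_econv] sub[OF czero_X0_econv(2)])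
    then have "?c * t + 0 - t = 0" by (rule LIMSEQ_unique) (rule l0)
    moreover have "?c = - (q * q)"
    proof -
      have "q powr 2 = q * q" "q powr 4 = q * q * (q * q)" using powr_add[of q 1 1] powr_add[of q 2 2] q by simp_all
      moreover have "q * q < 1" using mult_strict_mono[of q 1 q 1] q by simp
      ultimately show ?thesis using q by (simp add: kappa_sq field_simps)
    qed
    ultimately have "- (q * q) * t + 0 - t = 0" by (simp only:)
    then have "(q * q + 1) * t = 0" by (simp add: algebra_simps)
    moreover have "q * q + 1 \<noteq> 0" by (metis add_pos_nonneg add.commute less_irrefl zero_le_square zero_less_one)
    ultimately show "t = 0" by simp
  qed
  moreover have "t = 1"
  proof -
    have "Y (1, 2 * k + 2, True) (0, 2 * k + 1, True) = of_real (cplus X0 True 0 (2 * k + 1))" for k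
      unfolding Y_eq step_matrix_diagonal using valid[of k] by (simp add: step_matrix_def del: cplus.simps)
    with Y_tendsto_0[OF lim, of "\<lambda>k. (1, 2 * k + 2, True)"]
    have "(\<lambda>k. of_real (cplus X0 True 0 (2 * k + 1)) :: complex) \<longlonglongrightarrow> of_real 0" by simp
    then have l0: "(\<lambda>k. cplus X0 True 0 (2 * k + 1)) \<longlonglongrightarrow> 0" unfolding tendsto_of_real_iff .
    \<comment> \<open>The entry that raises l by 1 tends to this positive constant times
      \<open>alpha_limit\<close>, hence to a positive multiple of sqrt (1 - t).\<close>
    let ?c = "q powr (1/2) * V 1 * sqrt (qnum q 2)"
    have eq: "cplus X0 True 0 (2 * k + 1) = ?c * V (real (2 * k + 1) + 1) * hA True (2 * k + 1)" for k
      by simp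
    have "(\<lambda>k. cplus X0 True 0 (2 * k + 1)) \<longlonglongrightarrow> ?c * 1 * alpha_limit"
      unfolding eq by (intro tendsto_mult tendsto_const sub[OF hA_econv] sub[OF V_nat_econv(2)])
    then have "?c * 1 * alpha_limit = 0" by (rule LIMSEQ_unique) (rule l0)
    moreover have "0 < qnum q 2"
      unfolding qnum_V[of 2, simplified] using kappa_pos V_pos[of 2] q by simp
    moreover have "0 < V 1" by (rule V_pos) simp
    ultimately show "t = 1" using q by (simp add: alpha_limit_def)
  qed
  ultimately show False by simp
qed

lemma dimension_spectrum_podles: "has_dimension_spectrum (podles_image q t) {1, 2}"
proof (rule dimension_spectrum_if_flip_good)
  show "flip_good a" if "a \<in> podles_image q t" for a
    using that flip_good_podles_rep unfolding podles_image_eq by blast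
  show "square_x0 \<in> podles_image q t" unfolding podles_image_eq square_x0_def by (rule rangeI)
  show "expsmall wj (\<lambda>p. entry square_x0 (fst p) (snd p))" by (rule square_x0_small)
  show "\<not> shell_trace (entry square_x0) \<longlonglongrightarrow> 0" by (rule shell_trace_square_x0_nonzero)
qed

end

theorem proposition8p3:
  fixes q t :: real
  assumes "0 < q" "q < 1" "0 \<le> t" "t \<le> 1"
  shows "has_dimension_spectrum (podles_image q t) {1, 2}"
proof -
  interpret podles_parameters q t by unfold_locales (use assms in auto)
  show ?thesis by (rule dimension_spectrum_podles)
qed

end
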